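(* Let $K:\mathbb R\to\overline{\mathbb R}$ be such that $K$ and $K^2$ are Lebesgue integrable. Let the random array $\{X_t(n)\}$, the filtration $\{\mathcal F_t\}$ and the sequence $\{\beta_n\}$ satisfy conditions HL0, HL1, HL2, HL4, HL6, HL7, HL8 and HL9 listed in the context. Suppose that: (i) $\{h_n\}$ is a positive sequence with $\beta_n^{-1}h_n+\beta_n(nh_n)^{-1}\to0$; and (ii) for each $x\in\mathbb R$ and $t_0$ as in HL7, $\frac{\beta_n}{nh_n}\sum_{t=1}^{t_0-1}K\left(\frac{X_t(n)-x}{h_n}\right)=o_p(1)$. Then, for each $x\in\mathbb R$, as $n\to\infty$, $$\frac{\beta_n}{h_nn}\sum_{t=1}^nK\left(\frac{X_t(n)-x}{h_n}\right)\overset{d}{\rightarrow}\Phi_{X^+}(-X^-)\int_{\mathbb R}K(u)\,du .$$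
   Context: All limits are as $n\to\infty$ unless indicated otherwise. $\overline{\mathbb R}$ is the extended real line. For $\eta\in(0,1)$ let $\Omega_n(\eta):=\{(s,t)\in\mathbb N^2:\lfloor\eta n\rfloor\le s\le\lfloor(1-\eta)n\rfloor,\ \lfloor\eta n\rfloor+s\le t\le n\}$. The conditions are: HL0: $\{X_t(n)\}_{t=1}^n$, $n\in\mathbb N$, is a random array and $\{\mathcal F_t\}_{t=-\infty}^{\infty}$ a filtration such that $X_t(n)$ is $\mathcal F_t$-measurable for all $t$ and $n$; $\{\beta_n\}$ is a positive sequence with $\beta_n\to\infty$. HL1: $X_t(n)=X_t^+(n)+X_t^-(n)+R_t(n)$, where $X_t^-(n)$ is $\mathcal F_0$-measurable and $\sup_{1\le t\le n}\mathbf P\{\beta_n^{-1}|R_t(n)|>\epsilon\}\to0$ for every $\epsilon>0$. HL2: there are random variables $X^+$ and $X^-$, where $X^+$ has a bounded continuous density $\Phi_{X^+}$, such that for every $\delta\in(0,1)$ and every $\{t_n\}$ with $\lfloor n\delta\rfloor\le t_n\le n$: (a) for all bounded continuous $h:\mathbb R\to\mathbb R$, $\mathbf E[h(\beta_n^{-1}X_{t_n}^+(n))\mid\mathcal F_0]\overset{p}{\to}\int_{\mathbb R}h(x)\Phi_{X^+}(x)dx$; and (b) $\beta_n^{-1}X_{t_n}^-(n)\overset{d}{\to}X^-$ and $\beta_n^{-1}[X_n^-(n)-X_{t_n}^-(n)]\overset{p}{\to}0$. HL4: for every bounded and Lipschitz continuous $g:\mathbb R\to\mathbb R$, $\frac1n\sum_{t=1}^n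 g(\beta_n^{-1}X_t(n))=\frac1n\sum_{t=1}^n\mathbf E[g(\beta_n^{-1}X_t(n))\mid\mathcal F_0]+o_p(1)$. HL6: $\sup_{n\in\mathbb N}\frac{\beta_n}{n}\sum_{t=t_0}^n\beta_t^{-1}<\infty$, for $t_0$ as in HL7. HL7: let $X_0(n):=0$ and $t>s\ge0$. Conditionally on $\mathcal F_s$, $\beta_{t-s}^{-1}(X_t(n)-X_s(n))$ has density $\mathcal D_{t,s,n}(x)$ such that for some $n_0,t_0\ge1$, $\sup_{n\ge n_0,\,0\le s<t\le n,\,t-s\ge t_0}\sup_x\mathcal D_{t,s,n}(x)<\infty$. HL8: for all $q_0,q_1>0$, $\lim_{\eta\downarrow0}\limsup_{n\to\infty}\sup_{(s,t)\in\Omega_n(\eta)}\sup_{|x|\le q_0\eta^{q_1}}|\mathcal D_{t,s,n}(x)-\mathcal D_{t,s,n}(0)|=0$. HL9: for $t_0$ as in HL7: (a) $\lim_{\eta\to0}\lim_{n\to\infty}\frac{\beta_n}{n}\sum_{t=\lfloor(1-\eta)n\rfloor}^n\beta_t^{-1}=0$; (b) $\lim_{\eta\to0}\lim_{n\to\infty}\frac{\beta_n}{n}\sum_{t=t_0}^{\lfloor\eta n\rfloor}\beta_t^{-1}=0$; (c) $\limsup_{n\to\infty}\frac{\beta_n}{n}\sum_{t=t_0}^n\beta_t^{-1}<\infty$; (d) there exist $l_0,l_1>0$ such that $\liminf_{n\to\infty}\beta_n^{-1}\inf_{(s,t)\in\Omega_n(\eta)}\beta_{t-s}\ge\eta^{l_1}/l_0$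 for all $\eta\in(0,1)$; (e) $\sup_{n\ge1}\sup_{1\le t\le n}\beta_n^{-1}\beta_t<\infty$. *)

theory Defs
  imports "HOL-Probability.Probability"
begin

section \<open>Modes of convergence\<close>

text \<open>The summands are extended real valued because the kernel \<open>K\<close> is.\<close>

definition small_o_p :: "'a measure \<Rightarrow> (nat \<Rightarrow> 'a \<Rightarrow> ereal) \<Rightarrow> bool" where
  "small_o_p M Y \<longleftrightarrow>
     (\<forall>\<epsilon>::real. \<epsilon> > 0 \<longrightarrow>
        (\<lambda>n. measure M {\<omega> \<in> space M. \<bar>Y n \<omega>\<bar> > ereal \<epsilon>}) \<longlonglongrightarrow> 0)"

definition conv_prob :: "'a measure \<Rightarrow> (nat \<Rightarrow> 'a \<Rightarrow> real) \<Rightarrow> real \<Rightarrow> bool" where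
  "conv_prob M Y c \<longleftrightarrow> small_o_p M (\<lambda>n \<omega>. ereal (Y n \<omega> - c))"

text \<open>
  Convergence in distribution, the limit living on a possibly different probability space.
  The library's \<^const>\<open>weak_conv_m\<close> only covers measures on the real line, so it does not apply to
  extended real valued variables; on the real line both notions agree, see below.
\<close>

definition conv_distr ::
    "'a measure \<Rightarrow> (nat \<Rightarrow> 'a \<Rightarrow> 'c::topological_space) \<Rightarrow> 'b measure \<Rightarrow> ('b \<Rightarrow> 'c) \<Rightarrow> bool" where
  "conv_distr M Y N Z \<longleftrightarrow>
     (\<forall>f::'c \<Rightarrow> real. continuous_on UNIV f \<and> bounded (range f) \<longrightarrow>
        (\<lambda>n. \<integral>\<omega>. f (Y n \<omega>) \<partial>M) \<longlonglongrightarrow> (\<integral>\<omega>. f (Z \<omega>) \<partial>N))"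

lemma conv_distr_iff_weak_conv_m:
  fixes Y :: "nat \<Rightarrow> 'a \<Rightarrow> real" and Z :: "'b \<Rightarrow> real"
  assumes M: "prob_space M" and N: "prob_space N"
    and Y [measurable]: "\<And>n. Y n \<in> borel_measurable M"
    and Z [measurable]: "Z \<in> borel_measurable N"
  shows "conv_distr M Y N Z \<longleftrightarrow> weak_conv_m (\<lambda>n. distr M borel (Y n)) (distr N borel Z)"
proof -
  have dY: "real_distribution (distr M borel (Y n))" for n
    using M by (intro prob_space.real_distribution_distr) auto
  have dZ: "real_distribution (distr N borel Z)"
    using N by (intro prob_space.real_distribution_distr) auto
  have eq: "(\<integral>x. f x \<partial>distr M borel (Y n)) = (\<integral>\<omega>. f (Y n \<omega>) \<partial>M)"
    "(\<integral>x. f x \<partial>distr N borel Z) = (\<integral>\<omega>. f (Z \<omega>) \<partial>N)"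
    if "continuous_on UNIV f" for f :: "real \<Rightarrow> real" and n
    using borel_measurable_continuous_onI[OF that] by (auto intro!: integral_distr)
  show ?thesis
  proof
    assume *: "conv_distr M Y N Z"
    show "weak_conv_m (\<lambda>n. distr M borel (Y n)) (distr N borel Z)"
    proof (rule integral_bdd_continuous_conv_imp_weak_conv[OF dY dZ])
      fix f :: "real \<Rightarrow> real"
      assume "\<And>x. isCont f x" "\<And>x. \<bar>f x\<bar> \<le> 1"
      then have "continuous_on UNIV f" "bounded (range f)"
        by (auto simp: continuous_on_eq_continuous_at bounded_iff)
      then show "(\<lambda>n. integral\<^sup>L (distr M borel (Y n)) f) \<longlonglongrightarrow> integral\<^sup>L (distr N borel Z) f"
        using * by (simp add: eq conv_distr_def)
    qed
  next
    assume *: "weak_conv_m (\<lambda>n. distr M borel (Y n)) (distr N borel Z)"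
    show "conv_distr M Y N Z"
      unfolding conv_distr_def
    proof (intro allI impI)
      fix f :: "real \<Rightarrow> real"
      assume f: "continuous_on UNIV f \<and> bounded (range f)"
      then obtain B where "\<And>x. norm (f x) \<le> B" by (auto simp: bounded_iff)
      moreover have "\<And>x. isCont f x"
        using f by (auto simp: continuous_on_eq_continuous_at)
      ultimately show "(\<lambda>n. \<integral>\<omega>. f (Y n \<omega>) \<partial>M) \<longlonglongrightarrow> (\<integral>\<omega>. f (Z \<omega>) \<partial>N)"
        using weak_conv_imp_integral_bdd_continuous_conv[OF dY dZ *, of f B] f
        by (simp add: eq)
    qed
  qed
qed

section \<open>Lebesgue integration of extended real valued functions\<close>

text \<open>
  Bochner integration does not cover \<^typ>\<open>ereal\<close>. The integral is the difference of the integrals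
  of the positive and the negative part; note that \<^const>\<open>e2ennreal\<close> maps negative values to 0.
\<close>

definition ereal_integrable :: "'a measure \<Rightarrow> ('a \<Rightarrow> ereal) \<Rightarrow> bool" where
  "ereal_integrable M f \<longleftrightarrow> f \<in> borel_measurable M \<and> (\<integral>\<^sup>+u. e2ennreal \<bar>f u\<bar> \<partial>M) < \<infinity>"

definition ereal_integral :: "'a measure \<Rightarrow> ('a \<Rightarrow> ereal) \<Rightarrow> real" where
  "ereal_integral M f =
     enn2real (\<integral>\<^sup>+u. e2ennreal (f u) \<partial>M) - enn2real (\<integral>\<^sup>+u. e2ennreal (- f u) \<partial>M)"

lemma ereal_integral_ereal:
  assumes "integrable M (f :: 'a \<Rightarrow> real)"
  shows "ereal_integrable M (\<lambda>u. ereal (f u))"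
    and "ereal_integral M (\<lambda>u. ereal (f u)) = integral\<^sup>L M f"
  using assms
  by (auto simp: ereal_integrable_def ereal_integral_def real_lebesgue_integral_def
      integrable_iff_bounded e2ennreal_ereal)

section \<open>Conditional densities\<close>

text \<open>
  \<open>D \<omega>\<close> is the density at the sample point \<open>\<omega>\<close> of the regular conditional distribution of \<open>Y\<close> given
  the sub-sigma-algebra \<open>G\<close>. It may depend on \<open>\<omega>\<close>; a density not depending on \<open>\<omega>\<close> is the special
  case in which \<open>Y\<close> is independent of \<open>G\<close>.
\<close>

definition has_cond_density ::
    "'a measure \<Rightarrow> 'a measure \<Rightarrow> ('a \<Rightarrow> real) \<Rightarrow> ('a \<Rightarrow> real \<Rightarrow> real) \<Rightarrow> bool" where
  "has_cond_density M G Y D \<longleftrightarrow>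
     (\<lambda>(\<omega>, x). D \<omega> x) \<in> borel_measurable (G \<Otimes>\<^sub>M borel) \<and>
     (\<forall>\<omega>\<in>space M. \<forall>x. D \<omega> x \<ge> 0) \<and>
     (\<forall>A\<in>sets borel. AE \<omega> in M.
        nn_cond_exp M G (\<lambda>\<omega>'. indicator A (Y \<omega>')) \<omega>
          = (\<integral>\<^sup>+x. ennreal (D \<omega> x) * indicator A x \<partial>lborel))"

section \<open>The conditions\<close>

text \<open>
  Throughout, \<open>X n t\<close> is the array entry with time index \<open>t\<close> in row \<open>n\<close>, and likewise for
  \<open>Xp\<close>, \<open>Xm\<close>, \<open>R\<close> (the three components of the decomposition). Rows are indexed by \<open>n \<ge> 1\<close> and
  only entries with \<open>1 \<le> t \<le> n\<close> are meaningful, apart from the convention on \<open>X n 0\<close> in \<open>HL7\<close>.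
  \<open>D n s t\<close> is the conditional density of the rescaled increment between times \<open>s\<close> and \<open>t\<close>.
\<close>

definition Omega :: "nat \<Rightarrow> real \<Rightarrow> (nat \<times> nat) set" where
  "Omega n \<eta> = {(s, t).
     \<lfloor>\<eta> * real n\<rfloor> \<le> int s \<and> int s \<le> \<lfloor>(1 - \<eta>) * real n\<rfloor> \<and>
     \<lfloor>\<eta> * real n\<rfloor> + int s \<le> int t \<and> t \<le> n}"

definition HL0 ::
    "'a measure \<Rightarrow> (int \<Rightarrow> 'a measure) \<Rightarrow> (nat \<Rightarrow> nat \<Rightarrow> 'a \<Rightarrow> real) \<Rightarrow> (nat \<Rightarrow> real) \<Rightarrow> bool" where
  "HL0 M F X \<beta> \<longleftrightarrow>
     filtration (space M) F \<and> (\<forall>t. subalgebra M (F t)) \<and>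
     (\<forall>n\<ge>1. \<forall>t\<in>{1..n}. X n t \<in> borel_measurable (F (int t))) \<and>
     (\<forall>n\<ge>1. \<beta> n > 0) \<and> filterlim \<beta> at_top sequentially"

definition HL1 ::
    "'a measure \<Rightarrow> (int \<Rightarrow> 'a measure) \<Rightarrow> (nat \<Rightarrow> nat \<Rightarrow> 'a \<Rightarrow> real) \<Rightarrow> (nat \<Rightarrow> real) \<Rightarrow>
     (nat \<Rightarrow> nat \<Rightarrow> 'a \<Rightarrow> real) \<Rightarrow> (nat \<Rightarrow> nat \<Rightarrow> 'a \<Rightarrow> real) \<Rightarrow> (nat \<Rightarrow> nat \<Rightarrow> 'a \<Rightarrow> real) \<Rightarrow> bool" where
  "HL1 M F X \<beta> Xp Xm R \<longleftrightarrow>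
     (\<forall>n\<ge>1. \<forall>t\<in>{1..n}.
        Xp n t \<in> borel_measurable M \<and> Xm n t \<in> borel_measurable (F 0) \<and>
        R n t \<in> borel_measurable M \<and>
        (\<forall>\<omega>\<in>space M. X n t \<omega> = Xp n t \<omega> + Xm n t \<omega> + R n t \<omega>)) \<and>
     (\<forall>\<epsilon>>0. (\<lambda>n. SUP t\<in>{1..n}. measure M {\<omega> \<in> space M. \<bar>R n t \<omega>\<bar> / \<beta> n > \<epsilon>}) \<longlonglongrightarrow> 0)"

text \<open>
  The limits \<open>LXp\<close> and \<open>LXm\<close> are random variables on a probability space \<open>N\<close> of their own, and
  \<open>\<Phi>\<close> is the bounded continuous version of the density of \<open>LXp\<close>. Nonnegativity is stated because
  \<^const>\<open>ennreal\<close> truncates negative values.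
\<close>

definition HL2 ::
    "'a measure \<Rightarrow> (int \<Rightarrow> 'a measure) \<Rightarrow> (nat \<Rightarrow> real) \<Rightarrow>
     (nat \<Rightarrow> nat \<Rightarrow> 'a \<Rightarrow> real) \<Rightarrow> (nat \<Rightarrow> nat \<Rightarrow> 'a \<Rightarrow> real) \<Rightarrow>
     'b measure \<Rightarrow> ('b \<Rightarrow> real) \<Rightarrow> ('b \<Rightarrow> real) \<Rightarrow> (real \<Rightarrow> real) \<Rightarrow> bool" where
  "HL2 M F \<beta> Xp Xm N LXp LXm \<Phi> \<longleftrightarrow>
     LXp \<in> borel_measurable N \<and> LXm \<in> borel_measurable N \<and>
     (\<forall>x. \<Phi> x \<ge> 0) \<and> continuous_on UNIV \<Phi> \<and> bounded (range \<Phi>) \<and>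
     distributed N lborel LXp (\<lambda>x. ennreal (\<Phi> x)) \<and>
     (\<forall>\<delta>\<in>{0<..<1}. \<forall>\<tau>::nat \<Rightarrow> nat. (\<forall>n. \<lfloor>real n * \<delta>\<rfloor> \<le> int (\<tau> n) \<and> \<tau> n \<le> n) \<longrightarrow>
        (\<forall>h::real \<Rightarrow> real. continuous_on UNIV h \<and> bounded (range h) \<longrightarrow>
           conv_prob M (\<lambda>n. real_cond_exp M (F 0) (\<lambda>\<omega>. h (Xp n (\<tau> n) \<omega> / \<beta> n)))
             (\<integral>x. h x * \<Phi> x \<partial>lborel)) \<and>
        conv_distr M (\<lambda>n \<omega>. Xm n (\<tau> n) \<omega> / \<beta> n) N LXm \<and>
        conv_prob M (\<lambda>n \<omega>. (Xm n n \<omega> - Xm n (\<tau> n) \<omega>) / \<beta> n) 0)"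

definition HL4 ::
    "'a measure \<Rightarrow> (int \<Rightarrow> 'a measure) \<Rightarrow> (nat \<Rightarrow> nat \<Rightarrow> 'a \<Rightarrow> real) \<Rightarrow> (nat \<Rightarrow> real) \<Rightarrow> bool" where
  "HL4 M F X \<beta> \<longleftrightarrow>
     (\<forall>g::real \<Rightarrow> real. bounded (range g) \<and> (\<exists>C. C-lipschitz_on UNIV g) \<longrightarrow>
        conv_prob M
          (\<lambda>n \<omega>. 1 / real n * (\<Sum>t=1..n. g (X n t \<omega> / \<beta> n))
             - 1 / real n * (\<Sum>t=1..n. real_cond_exp M (F 0) (\<lambda>\<omega>'. g (X n t \<omega>' / \<beta> n)) \<omega>)) 0)"

definition HL6 :: "(nat \<Rightarrow> real) \<Rightarrow> nat \<Rightarrow> bool" where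
  "HL6 \<beta> t0 \<longleftrightarrow> bdd_above ((\<lambda>n. \<beta> n / real n * (\<Sum>t=t0..n. 1 / \<beta> t)) ` {1..})"

text \<open>
  In \<open>HL7\<close> and \<open>HL8\<close> the suprema of the possibly random densities are uniform in \<open>\<omega>\<close>, so that the
  bounds are deterministic.
\<close>

definition HL7 ::
    "'a measure \<Rightarrow> (int \<Rightarrow> 'a measure) \<Rightarrow> (nat \<Rightarrow> nat \<Rightarrow> 'a \<Rightarrow> real) \<Rightarrow> (nat \<Rightarrow> real) \<Rightarrow>
     (nat \<Rightarrow> nat \<Rightarrow> nat \<Rightarrow> 'a \<Rightarrow> real \<Rightarrow> real) \<Rightarrow> nat \<Rightarrow> bool" where
  "HL7 M F X \<beta> D t0 \<longleftrightarrow>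
     (\<forall>n\<ge>1. \<forall>\<omega>\<in>space M. X n 0 \<omega> = 0) \<and>
     (\<forall>n\<ge>1. \<forall>s t. s < t \<and> t \<le> n \<longrightarrow>
        has_cond_density M (F (int s)) (\<lambda>\<omega>. (X n t \<omega> - X n s \<omega>) / \<beta> (t - s)) (D n s t)) \<and>
     t0 \<ge> 1 \<and>
     (\<exists>n0\<ge>1. bdd_above {D n s t \<omega> x | n s t \<omega> x.
        n \<ge> n0 \<and> s < t \<and> t \<le> n \<and> t - s \<ge> t0 \<and> \<omega> \<in> space M})"

definition HL8 ::
    "'a measure \<Rightarrow> (nat \<Rightarrow> nat \<Rightarrow> nat \<Rightarrow> 'a \<Rightarrow> real \<Rightarrow> real) \<Rightarrow> bool" where
  "HL8 M D \<longleftrightarrow>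
     (\<forall>q0>0. \<forall>q1>0.
        ((\<lambda>\<eta>::real. limsup (\<lambda>n. SUP (s, t)\<in>Omega n \<eta>. SUP \<omega>\<in>space M.
             SUP x\<in>{x. \<bar>x\<bar> \<le> q0 * \<eta> powr q1}. ereal \<bar>D n s t \<omega> x - D n s t \<omega> 0\<bar>))
         \<longlongrightarrow> 0) (at_right 0))"

text \<open>
  In the iterated limits of \<open>HL9\<close> the inner limit is required to exist for all small \<open>\<eta>\<close>.
  Infima over empty \<open>Omega n \<eta>\<close> (which occur for large \<open>\<eta>\<close>) are infinite.
\<close>

definition HL9 :: "(nat \<Rightarrow> real) \<Rightarrow> nat \<Rightarrow> bool" where
  "HL9 \<beta> t0 \<longleftrightarrow>
     (\<exists>L::real \<Rightarrow> real.
        (\<forall>\<^sub>F \<eta> in at_right 0.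
           (\<lambda>n. \<beta> n / real n * (\<Sum>t=nat \<lfloor>(1 - \<eta>) * real n\<rfloor>..n. 1 / \<beta> t)) \<longlonglongrightarrow> L \<eta>) \<and>
        (L \<longlongrightarrow> 0) (at_right 0)) \<and>
     (\<exists>L::real \<Rightarrow> real.
        (\<forall>\<^sub>F \<eta> in at_right 0.
           (\<lambda>n. \<beta> n / real n * (\<Sum>t=t0..nat \<lfloor>\<eta> * real n\<rfloor>. 1 / \<beta> t)) \<longlonglongrightarrow> L \<eta>) \<and>
        (L \<longlongrightarrow> 0) (at_right 0)) \<and>
     limsup (\<lambda>n. ereal (\<beta> n / real n * (\<Sum>t=t0..n. 1 / \<beta> t))) < \<infinity> \<and>
     (\<exists>l0>0. \<exists>l1>0. \<forall>\<eta>\<in>{0<..<1::real}.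
        liminf (\<lambda>n. ereal (1 / \<beta> n) * (INF (s, t)\<in>Omega n \<eta>. ereal (\<beta> (t - s))))
          \<ge> ereal (\<eta> powr l1 / l0)) \<and>
     bdd_above {\<beta> t / \<beta> n | n t. 1 \<le> t \<and> t \<le> n}"

end

theory Submission
  imports Defs
begin

text \<open>
  Truncating \<open>K\<close> to a bounded kernel \<open>k\<close> of bounded support changes the kernel sum over \<open>t \<ge> t0\<close>
  by little in mean, because the densities are bounded.
  For such a \<open>k\<close>, the rescaled kernel minus \<open>(\<integral>k) \<cdot> hat e\<close> has mean zero and is supported in \<open>[-e, e]\<close>.
  In the second moment of its average along the array, a pair \<open>(s, t)\<close> in \<open>Omega n \<eta>\<close> therefore only
  sees increments of the conditional density near 0. For \<open>e = \<eta>\<^bsup>l1 + 1\<^esup>\<close> these are evaluated at points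
  of order \<open>\<eta>\<close> by the lower bound on \<open>\<beta> (t - s)\<close>, hence are small, while all other pairs are negligible.
  The average of the Lipschitz function \<open>hat e\<close> is asymptotically its conditional mean given \<open>F 0\<close>,
  that is \<open>\<integral>hat e (u + m) \<Phi>(u) du\<close> at \<open>m = Xm n n / \<beta> n\<close>. It remains to let \<open>n \<rightarrow> \<infinity>\<close> and then
  \<open>e \<rightarrow> 0\<close>.
\<close>

section \<open>Conditional densities\<close>

text \<open>The inputs come in different modes: condition (ii), HL1, HL4 and the conditional limit
  in HL2 hold in probability, while the densities yield bounds in mean and in second moment. All
  errors are therefore measured by the mean of \<open>min 1 \<bar>Y\<bar>\<close>, which is
  subadditive, is at most the mean of \<open>\<bar>Y\<bar>\<close>, and tends to 0 when
  \<open>Y\<close> does so in probability. The width \<open>e\<close> cannot be prescribed. It is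
  tied to \<eta>, which has to suit HL8 and both edge sums of HL9 at once, so one only obtains some
  \<open>e\<close> below any given bound. This suffices because the smoothed limit is close to the
  final one for all small \<open>e\<close>. The point \<open>x\<close> disappears because
  \<open>x / \<beta> n\<close> and \<open>bw n / \<beta> n\<close> vanish: on the scale
  \<open>\<beta> n\<close> the kernel concentrates at 0. There \<open>X\<close> near 0 means that
  the conditionally random part is near minus the part known at time 0, which is the origin of the
  minus sign in \<open>\<Phi> (- LXm \<omega>)\<close>. That known part, at time \<open>t\<close>,
  may be replaced by its value at the end of the row as long as \<open>t / n\<close> stays away from
  0; the remaining fraction of indices is made small.\<close>

lemma has_cond_density_distr:
  assumes "prob_space M" and G: "subalgebra M G"
    and Y [measurable]: "Y \<in> borel_measurable M" and D: "has_cond_density M G Y D"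
  shows "distr M (G \<Otimes>\<^sub>M borel) (\<lambda>\<omega>. (\<omega>, Y \<omega>))
    = density (restr_to_subalg M G \<Otimes>\<^sub>M lborel) (\<lambda>(\<omega>, x). ennreal (D \<omega> x))"
proof -
  interpret prob_space M by fact
  interpret finite_measure_subalgebra M G
    by unfold_locales (fact G)
  let ?R = "restr_to_subalg M G"
  have sR [measurable_cong]: "sets ?R = sets G"
    by (rule sets_restr_to_subalg[OF G])
  have spG: "space G = space M"
    using G by (simp add: subalgebra_def)
  have idm [measurable]: "(\<lambda>\<omega>. \<omega>) \<in> measurable M G"
    by (rule measurable_from_subalg[OF G]) simp
  have Dm [measurable]: "(\<lambda>(\<omega>, x). D \<omega> x) \<in> borel_measurable (G \<Otimes>\<^sub>M borel)"
    using D by (simp add: has_cond_density_def)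
  have setsR: "sets (?R \<Otimes>\<^sub>M lborel) = sets (G \<Otimes>\<^sub>M (borel :: real measure))"
    by (rule sets_pair_measure_cong) (simp_all add: sR)
  have Dm': "(\<lambda>(\<omega>, x). ennreal (D \<omega> x)) \<in> borel_measurable (?R \<Otimes>\<^sub>M lborel)"
    by measurable
  \<comment> \<open>The null set in the definition of a conditional density may depend on
    \<open>B\<close>. Integrating against the indicator of a set \<open>A\<close> in
    \<open>G\<close> removes it for each rectangle separately.\<close>
  have rect: "emeasure (distr M (G \<Otimes>\<^sub>M borel) (\<lambda>\<omega>. (\<omega>, Y \<omega>))) (A \<times> B)
      = emeasure (density (?R \<Otimes>\<^sub>M lborel) (\<lambda>(\<omega>, x). ennreal (D \<omega> x))) (A \<times> B)"
    if A [measurable]: "A \<in> sets G" and B [measurable]: "B \<in> sets borel" for A B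
  proof -
    have [measurable]: "A \<in> sets M"
      using A G by (auto simp: subalgebra_def)
    have cB: "AE \<omega> in M. nn_cond_exp M G (\<lambda>\<omega>'. indicator B (Y \<omega>')) \<omega>
          = (\<integral>\<^sup>+x. ennreal (D \<omega> x) * indicator B x \<partial>lborel)"
      using D B by (simp add: has_cond_density_def)
    have "emeasure (distr M (G \<Otimes>\<^sub>M borel) (\<lambda>\<omega>. (\<omega>, Y \<omega>))) (A \<times> B)
        = (\<integral>\<^sup>+\<omega>. indicator A \<omega> * indicator B (Y \<omega>) \<partial>M)"
      by (subst nn_integral_indicator[symmetric], simp, subst nn_integral_distr)
         (auto simp: indicator_times intro!: nn_integral_cong)
    also have "\<dots> = (\<integral>\<^sup>+\<omega>. indicator A \<omega> * nn_cond_exp M G (\<lambda>\<omega>'. indicator B (Y \<omega>')) \<omega> \<partial>M)"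
      by (rule nn_cond_exp_intg[symmetric]) auto
    also have "\<dots> = (\<integral>\<^sup>+\<omega>. indicator A \<omega> * (\<integral>\<^sup>+x. ennreal (D \<omega> x) * indicator B x \<partial>lborel) \<partial>M)"
      using cB by (intro nn_integral_cong_AE) auto
    also have "\<dots> = (\<integral>\<^sup>+\<omega>. indicator A \<omega> * (\<integral>\<^sup>+x. ennreal (D \<omega> x) * indicator B x \<partial>lborel) \<partial>?R)"
      by (rule nn_integral_subalgebra2[OF G, symmetric]) measurable
    also have "\<dots> = (\<integral>\<^sup>+\<omega>. (\<integral>\<^sup>+x. ennreal (D \<omega> x) * indicator (A \<times> B) (\<omega>, x) \<partial>lborel) \<partial>?R)"
    proof (rule nn_integral_cong)
      fix \<omega> assume "\<omega> \<in> space ?R"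
      then have [measurable]: "(\<lambda>x. D \<omega> x) \<in> borel_measurable borel"
        using measurable_Pair2[OF Dm, of \<omega>] by (simp add: spG space_restr_to_subalg)
      show "indicator A \<omega> * (\<integral>\<^sup>+x. ennreal (D \<omega> x) * indicator B x \<partial>lborel)
          = (\<integral>\<^sup>+x. ennreal (D \<omega> x) * indicator (A \<times> B) (\<omega>, x) \<partial>lborel)"
        by (subst nn_integral_cmult[symmetric]) (auto simp: indicator_times mult_ac)
    qed
    also have "\<dots> = (\<integral>\<^sup>+p. (case p of (\<omega>, x) \<Rightarrow> ennreal (D \<omega> x)) * indicator (A \<times> B) p \<partial>(?R \<Otimes>\<^sub>M lborel))"
      by (subst lborel.nn_integral_fst[symmetric]) (use Dm' in \<open>auto intro!: borel_measurable_times\<close>)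
    also have "\<dots> = emeasure (density (?R \<Otimes>\<^sub>M lborel) (\<lambda>(\<omega>, x). ennreal (D \<omega> x))) (A \<times> B)"
      by (subst emeasure_density[OF Dm']) (simp_all add: setsR)
    finally show ?thesis .
  qed
  \<comment> \<open>Rectangles are closed under intersection and generate the product sigma-algebra,
    and the measures are finite, so agreement on rectangles is enough.\<close>
  let ?E = "{A \<times> B | A B. A \<in> sets G \<and> B \<in> sets (borel :: real measure)}"
  show ?thesis
  proof (rule measure_eqI_generator_eq[where E = ?E and \<Omega> = "space G \<times> space borel"
        and A = "\<lambda>_. space G \<times> space borel"])
    show "Int_stable ?E"
      by (rule Int_stable_pair_measure_generator)
    show "?E \<subseteq> Pow (space G \<times> space borel)"
      using sets.sets_into_space by fastforce
    show "sets (distr M (G \<Otimes>\<^sub>M borel) (\<lambda>\<omega>. (\<omega>, Y \<omega>))) = sigma_sets (space G \<times> space borel) ?E"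
      by (simp add: sets_pair_measure)
    show "sets (density (?R \<Otimes>\<^sub>M lborel) (\<lambda>(\<omega>, x). ennreal (D \<omega> x))) = sigma_sets (space G \<times> space borel) ?E"
      using setsR by (simp add: sets_pair_measure)
    show "emeasure (distr M (G \<Otimes>\<^sub>M borel) (\<lambda>\<omega>. (\<omega>, Y \<omega>))) (space G \<times> space borel) \<noteq> \<infinity>" for i :: nat
      using finite_measure.emeasure_finite[OF finite_measure_distr[of "\<lambda>\<omega>. (\<omega>, Y \<omega>)" "G \<Otimes>\<^sub>M borel"]]
      by simp
    show "range (\<lambda>_. space G \<times> space borel) \<subseteq> ?E"
      by blast
  qed (use rect in auto)
qed

text \<open>Fubini on the joint law of the sample point and \<open>Y\<close>. The integrand may
  depend on \<omega> through \<open>G\<close>; this is how the past position and factors determined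
  by the past enter later. Integrability of the product with the density is inherited from the
  bounded integrand on the probability space.\<close>

lemma has_cond_density_integral:
  assumes "prob_space M" and G: "subalgebra M G"
    and Y [measurable]: "Y \<in> borel_measurable M" and D: "has_cond_density M G Y D"
    and f [measurable]: "(\<lambda>(\<omega>, x). f \<omega> x) \<in> borel_measurable (G \<Otimes>\<^sub>M borel)"
    and B: "\<And>\<omega> x. \<omega> \<in> space M \<Longrightarrow> \<bar>f \<omega> x\<bar> \<le> (B::real)"
  shows "(\<integral>\<omega>. f \<omega> (Y \<omega>) \<partial>M) = (\<integral>\<omega>. (\<integral>x. D \<omega> x * f \<omega> x \<partial>lborel) \<partial>M)"
    and "integrable M (\<lambda>\<omega>. (\<integral>x. D \<omega> x * f \<omega> x \<partial>lborel))"
proof -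
  interpret prob_space M by fact
  let ?R = "restr_to_subalg M G"
  have sR [measurable_cong]: "sets ?R = sets G"
    by (rule sets_restr_to_subalg[OF G])
  have spG: "space G = space M"
    using G by (simp add: subalgebra_def)
  have idm [measurable]: "(\<lambda>\<omega>. \<omega>) \<in> measurable M G"
    by (rule measurable_from_subalg[OF G]) simp
  have Dm [measurable]: "(\<lambda>(\<omega>, x). D \<omega> x) \<in> borel_measurable (G \<Otimes>\<^sub>M borel)"
    using D by (simp add: has_cond_density_def)
  interpret R: prob_space ?R
    by (rule prob_space_restr_to_subalg) fact+
  interpret P: pair_sigma_finite ?R lborel ..
  let ?f = "\<lambda>(\<omega>, x). f \<omega> x" and ?D = "\<lambda>(\<omega>, x). D \<omega> x"
  have ED: "distr M (G \<Otimes>\<^sub>M borel) (\<lambda>\<omega>. (\<omega>, Y \<omega>)) = density (?R \<Otimes>\<^sub>M lborel) (\<lambda>p. ennreal (?D p))"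
    using has_cond_density_distr[OF assms(1-4)] by (simp add: case_prod_unfold)
  have D0: "AE p in ?R \<Otimes>\<^sub>M lborel. 0 \<le> ?D p"
    using D by (intro AE_I2) (auto simp: has_cond_density_def space_pair_measure space_restr_to_subalg)
  have "integrable M (\<lambda>\<omega>. f \<omega> (Y \<omega>))"
    by (rule integrable_const_bound[of _ B]) (use B in auto)
  then have "integrable (distr M (G \<Otimes>\<^sub>M borel) (\<lambda>\<omega>. (\<omega>, Y \<omega>))) ?f"
    by (subst integrable_distr_eq) auto
  then have int: "integrable (?R \<Otimes>\<^sub>M lborel) (\<lambda>p. ?D p * ?f p)"
    unfolding ED by (subst (asm) integrable_density) (use D0 in auto)
  have "integrable ?R (\<lambda>\<omega>. \<integral>x. D \<omega> x * f \<omega> x \<partial>lborel)"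
    using P.integrable_fst'[OF int] by simp
  then show "integrable M (\<lambda>\<omega>. (\<integral>x. D \<omega> x * f \<omega> x \<partial>lborel))"
    by (rule integrable_from_subalg[OF G])
  have "(\<integral>\<omega>. f \<omega> (Y \<omega>) \<partial>M) = (\<integral>p. ?f p \<partial>distr M (G \<Otimes>\<^sub>M borel) (\<lambda>\<omega>. (\<omega>, Y \<omega>)))"
    by (subst integral_distr) auto
  also have "\<dots> = (\<integral>p. ?D p * ?f p \<partial>(?R \<Otimes>\<^sub>M lborel))"
    unfolding ED by (subst integral_density) (use D0 in auto)
  also have "\<dots> = (\<integral>\<omega>. (\<integral>x. D \<omega> x * f \<omega> x \<partial>lborel) \<partial>?R)"
    using P.integral_fst'[OF int] by simp
  also have "\<dots> = (\<integral>\<omega>. (\<integral>x. D \<omega> x * f \<omega> x \<partial>lborel) \<partial>M)"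
    by (rule integral_subalgebra2[OF G]) measurable
  finally show "(\<integral>\<omega>. f \<omega> (Y \<omega>) \<partial>M) = (\<integral>\<omega>. (\<integral>x. D \<omega> x * f \<omega> x \<partial>lborel) \<partial>M)" .
qed

text \<open>The usual gauge for convergence in probability, a single number in which errors known in
  probability and errors known in mean can be added.\<close>

definition trunc_mean :: "'a measure \<Rightarrow> ('a \<Rightarrow> real) \<Rightarrow> real" where
  "trunc_mean M Y = (\<integral>\<omega>. min 1 \<bar>Y \<omega>\<bar> \<partial>M)"

context prob_space
begin

lemma integrable_trunc [simp]:
  "Y \<in> borel_measurable M \<Longrightarrow> integrable M (\<lambda>\<omega>. min 1 \<bar>Y \<omega>\<bar> :: real)"
  by (rule integrable_const_bound[of _ 1]) auto

lemma trunc_mean_nonneg: "trunc_mean M Y \<ge> 0"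
  unfolding trunc_mean_def by (rule Bochner_Integration.integral_nonneg) auto

lemma trunc_mean_mono_sum:
  assumes [measurable]: "Y \<in> borel_measurable M" "U \<in> borel_measurable M" "V \<in> borel_measurable M"
    and "AE \<omega> in M. \<bar>Y \<omega>\<bar> \<le> \<bar>U \<omega>\<bar> + \<bar>V \<omega>\<bar>"
  shows "trunc_mean M Y \<le> trunc_mean M U + trunc_mean M V"
proof -
  have "AE \<omega> in M. min 1 \<bar>Y \<omega>\<bar> \<le> min 1 \<bar>U \<omega>\<bar> + min 1 \<bar>V \<omega>\<bar>"
    using assms(4) by eventually_elim linarith
  then have "(\<integral>\<omega>. min 1 \<bar>Y \<omega>\<bar> \<partial>M) \<le> (\<integral>\<omega>. min 1 \<bar>U \<omega>\<bar> + min 1 \<bar>V \<omega>\<bar> \<partial>M)"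
    by (intro integral_mono_AE) auto
  then show ?thesis
    by (simp add: trunc_mean_def)
qed

lemma trunc_mean_le_expectation:
  assumes "integrable M Y"
  shows "trunc_mean M Y \<le> (\<integral>\<omega>. \<bar>Y \<omega>\<bar> \<partial>M)"
  unfolding trunc_mean_def using assms by (intro integral_mono) auto

text \<open>If \<open>\<bar>y\<bar> \<le> B\<close> and \<open>1 \<le> B\<close>, then
  \<open>\<bar>y\<bar> \<le> B * min 1 \<bar>y\<bar>\<close>. This upgrades convergence in
  probability of bounded variables to convergence in mean.\<close>

lemma expectation_le_trunc_mean:
  assumes [measurable]: "Y \<in> borel_measurable M" and "AE \<omega> in M. \<bar>Y \<omega>\<bar> \<le> B" "1 \<le> B"
  shows "(\<integral>\<omega>. \<bar>Y \<omega>\<bar> \<partial>M) \<le> B * trunc_mean M Y"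
proof -
  have *: "\<bar>y\<bar> \<le> B * min 1 \<bar>y\<bar>" if "\<bar>y\<bar> \<le> B" for y :: real
    using that \<open>1 \<le> B\<close> mult_right_mono[of 1 B "\<bar>y\<bar>"] by (auto simp: min_def)
  have "integrable M (\<lambda>\<omega>. B * min 1 \<bar>Y \<omega>\<bar>)"
    by (intro integrable_mult_right) auto
  moreover have "AE \<omega> in M. \<bar>Y \<omega>\<bar> \<le> B * min 1 \<bar>Y \<omega>\<bar>"
    using assms(2) by eventually_elim (rule *)
  moreover have "integrable M (\<lambda>\<omega>. \<bar>Y \<omega>\<bar>)"
    by (rule integrable_const_bound[of _ B]) (use assms in auto)
  ultimately have "(\<integral>\<omega>. \<bar>Y \<omega>\<bar> \<partial>M) \<le> (\<integral>\<omega>. B * min 1 \<bar>Y \<omega>\<bar> \<partial>M)"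
    by (intro integral_mono_AE)
  then show ?thesis
    by (simp add: trunc_mean_def)
qed

text \<open>Pointwise, \<open>min 1 \<bar>y\<bar>\<close> is at most \<open>r / 2\<close> plus the
  indicator of \<open>\<bar>y\<bar> > r / 2\<close>. Measurability is asked only from
  \<open>n0\<close> on, since rows too short to contain the times in question carry no
  information.\<close>

lemma trunc_mean_tendsto_0:
  assumes Y: "\<And>n. n \<ge> n0 \<Longrightarrow> Y n \<in> borel_measurable M"
    and "small_o_p M (\<lambda>n \<omega>. ereal (Y n \<omega>))"
  shows "(\<lambda>n. trunc_mean M (Y n)) \<longlonglongrightarrow> 0"
proof (rule LIMSEQ_I)
  fix r :: real assume r: "r > 0"
  then have "(\<lambda>n. measure M {\<omega> \<in> space M. \<bar>ereal (Y n \<omega>)\<bar> > ereal (r/2)}) \<longlonglongrightarrow> 0"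
    using assms(2) half_gt_zero unfolding small_o_p_def by blast
  then have ev: "\<forall>\<^sub>F n in sequentially. measure M {\<omega> \<in> space M. \<bar>Y n \<omega>\<bar> > r/2} < r/2"
    using order_tendstoD(2)[of _ 0 _ "r/2"] r by auto
  have "\<forall>\<^sub>F n in sequentially. norm (trunc_mean M (Y n) - 0) < r"
    using ev eventually_ge_at_top[of n0]
  proof eventually_elim
    case (elim n)
    note [measurable] = Y[OF elim(2)]
    have ii: "integrable M (\<lambda>\<omega>. r/2 + indicator {\<omega> \<in> space M. \<bar>Y n \<omega>\<bar> > r/2} \<omega>)"
      by (intro Bochner_Integration.integrable_add) (auto simp: less_top[symmetric])
    have "trunc_mean M (Y n) \<le> (\<integral>\<omega>. r/2 + indicator {\<omega> \<in> space M. \<bar>Y n \<omega>\<bar> > r/2} \<omega> \<partial>M)"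
      unfolding trunc_mean_def
      by (rule integral_mono[OF integrable_trunc ii]) (use r in \<open>auto simp: indicator_def min_def\<close>)
    also have "\<dots> = r/2 + measure M {\<omega> \<in> space M. \<bar>Y n \<omega>\<bar> > r/2}"
      by (subst Bochner_Integration.integral_add) (auto simp: prob_space less_top[symmetric])
    finally show ?case
      using elim trunc_mean_nonneg[of "Y n"] by auto
  qed
  then show "\<exists>no. \<forall>n\<ge>no. norm (trunc_mean M (Y n) - 0) < r"
    by (simp add: eventually_sequentially)
qed

text \<open>At distance at most 1 the Lipschitz bound applies, beyond it the trivial bound
  \<open>2 * B\<close>; together they give a multiple of
  \<open>min 1 \<bar>x - y\<bar>\<close>.\<close>

lemma expectation_lipschitz_diff:
  fixes f :: "real \<Rightarrow> real"
  assumes [measurable]: "U \<in> borel_measurable M" "V \<in> borel_measurable M"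
    and f: "L-lipschitz_on UNIV f" and b: "\<And>x. \<bar>f x\<bar> \<le> B"
  shows "\<bar>(\<integral>\<omega>. f (U \<omega>) \<partial>M) - (\<integral>\<omega>. f (V \<omega>) \<partial>M)\<bar>
      \<le> (L + 2 * B) * trunc_mean M (\<lambda>\<omega>. U \<omega> - V \<omega>)" (is ?A)
    and "(\<integral>\<omega>. \<bar>f (U \<omega>) - f (V \<omega>)\<bar> \<partial>M) \<le> (L + 2 * B) * trunc_mean M (\<lambda>\<omega>. U \<omega> - V \<omega>)" (is ?B)
proof -
  have [measurable]: "f \<in> borel_measurable borel"
    using lipschitz_on_continuous_on[OF f] by (rule borel_measurable_continuous_onI)
  have L: "L \<ge> 0" and B: "B \<ge> 0"
    using f lipschitz_on_nonneg b[of 0] by auto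
  have *: "\<bar>f x - f y\<bar> \<le> (L + 2 * B) * min 1 \<bar>x - y\<bar>" for x y
  proof (cases "\<bar>x - y\<bar> \<le> 1")
    case True
    then have "\<bar>f x - f y\<bar> \<le> L * min 1 \<bar>x - y\<bar>"
      using lipschitz_onD[OF f, of x y] by (simp add: dist_real_def)
    then show ?thesis
      using B mult_nonneg_nonneg[of "2 * B" "min 1 \<bar>x - y\<bar>"]
      unfolding distrib_right by linarith
  next
    case False
    have "\<bar>f x - f y\<bar> \<le> 2 * B"
      using b[of x] b[of y] by linarith
    then show ?thesis using False L by simp
  qed
  have i: "integrable M (\<lambda>\<omega>. f (U \<omega>))" "integrable M (\<lambda>\<omega>. f (V \<omega>))"
    by (rule integrable_const_bound[of _ B]; use b in auto)+
  have "(\<integral>\<omega>. \<bar>f (U \<omega>) - f (V \<omega>)\<bar> \<partial>M) \<le> (\<integral>\<omega>. (L + 2 * B) * min 1 \<bar>U \<omega> - V \<omega>\<bar> \<partial>M)"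
    using * i by (intro integral_mono integrable_mult_right) auto
  then show B: ?B
    by (simp add: trunc_mean_def)
  have "\<bar>(\<integral>\<omega>. f (U \<omega>) \<partial>M) - (\<integral>\<omega>. f (V \<omega>) \<partial>M)\<bar> \<le> (\<integral>\<omega>. \<bar>f (U \<omega>) - f (V \<omega>)\<bar> \<partial>M)"
    using i by (subst Bochner_Integration.integral_diff[symmetric])
      (auto intro!: integral_abs_bound simp del: Bochner_Integration.integral_diff)
  with B show ?A by linarith
qed

end

lemma lborel_integral_affine:
  fixes g :: "real \<Rightarrow> real"
  assumes "0 < b" "0 < c"
  shows "(\<integral>u. g ((x + b * u) / c) \<partial>lborel) = c / b * (\<integral>u. g u \<partial>lborel)"
    and "integrable lborel g \<Longrightarrow> integrable lborel (\<lambda>u. g ((x + b * u) / c))"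
proof -
  have *: "(x + b * u) / c = x / c + (b / c) * u" for u
    by (simp add: add_divide_distrib)
  show "(\<integral>u. g ((x + b * u) / c) \<partial>lborel) = c / b * (\<integral>u. g u \<partial>lborel)"
    unfolding * using assms lborel_integral_real_affine[of "b / c" g "x / c"] by (simp add: field_simps)
  show "integrable lborel (\<lambda>u. g ((x + b * u) / c))" if "integrable lborel g"
    unfolding * using assms lborel_integrable_real_affine[OF that, of "b / c" "x / c"] by simp
qed

text \<open>Two scales occur: \<open>b\<close> normalises the increment from \<open>Xs\<close> to
  \<open>Xt\<close> and will be \<open>\<beta> (t - s)\<close>, while \<open>c\<close> normalises
  the position at which functions are evaluated and will be \<open>\<beta> n\<close>. If
  \<open>u\<close> is the normalised increment, then \<open>Xt / c\<close> equals
  \<open>(Xs + b * u) / c\<close>.\<close>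

locale cond_density_increment = prob_space M for M :: "'a measure" +
  fixes G :: "'a measure" and Xs Xt :: "'a \<Rightarrow> real" and b c :: real
    and D :: "'a \<Rightarrow> real \<Rightarrow> real"
  assumes G: "subalgebra M G"
    and Xs [measurable]: "Xs \<in> borel_measurable G"
    and Xt [measurable]: "Xt \<in> borel_measurable M"
    and b: "0 < b" and c: "0 < c"
    and D: "has_cond_density M G (\<lambda>\<omega>. (Xt \<omega> - Xs \<omega>) / b) D"
begin

lemma Xs_measurable [measurable]: "Xs \<in> borel_measurable M"
  by (rule measurable_from_subalg[OF G Xs])

lemma measurable_density [measurable]: "\<omega> \<in> space M \<Longrightarrow> D \<omega> \<in> borel_measurable borel"
proof -
  assume "\<omega> \<in> space M"
  then show "D \<omega> \<in> borel_measurable borel"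
    using D measurable_Pair2[of "\<lambda>(\<omega>, x). D \<omega> x" G borel borel \<omega>] G
    by (simp add: has_cond_density_def subalgebra_def)
qed

lemma density_nonneg: "\<omega> \<in> space M \<Longrightarrow> 0 \<le> D \<omega> u"
  using D by (simp add: has_cond_density_def)

lemma expectation_mult_increment:
  fixes g :: "real \<Rightarrow> real" and H :: "'a \<Rightarrow> real"
  assumes g [measurable]: "g \<in> borel_measurable borel" and gB: "\<And>x. \<bar>g x\<bar> \<le> B"
    and H [measurable]: "H \<in> borel_measurable G" and HB: "\<And>\<omega>. \<omega> \<in> space M \<Longrightarrow> \<bar>H \<omega>\<bar> \<le> B'"
  shows "(\<integral>\<omega>. H \<omega> * g (Xt \<omega> / c) \<partial>M)
      = (\<integral>\<omega>. H \<omega> * (\<integral>u. D \<omega> u * g ((Xs \<omega> + b * u) / c) \<partial>lborel) \<partial>M)"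
    and "integrable M (\<lambda>\<omega>. H \<omega> * (\<integral>u. D \<omega> u * g ((Xs \<omega> + b * u) / c) \<partial>lborel))"
proof -
  let ?f = "\<lambda>\<omega> u. H \<omega> * g ((Xs \<omega> + b * u) / c)"
  have m: "(\<lambda>(\<omega>, u). ?f \<omega> u) \<in> borel_measurable (G \<Otimes>\<^sub>M borel)"
    by measurable
  have bd: "\<bar>?f \<omega> u\<bar> \<le> B' * B" if "\<omega> \<in> space M" for \<omega> u
    unfolding abs_mult using HB[OF that] gB by (intro mult_mono order_trans[OF abs_ge_zero HB[OF that]]) auto
  have eq: "?f \<omega> ((Xt \<omega> - Xs \<omega>) / b) = H \<omega> * g (Xt \<omega> / c)" for \<omega>
    using b by simp
  have eq2: "(\<integral>u. D \<omega> u * ?f \<omega> u \<partial>lborel)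
      = H \<omega> * (\<integral>u. D \<omega> u * g ((Xs \<omega> + b * u) / c) \<partial>lborel)" for \<omega>
    unfolding integral_mult_right_zero[symmetric] by (simp add: mult_ac)
  have Ym: "(\<lambda>\<omega>. (Xt \<omega> - Xs \<omega>) / b) \<in> borel_measurable M"
    by measurable
  note * = has_cond_density_integral[OF prob_space_axioms G Ym D m bd]
  show "(\<integral>\<omega>. H \<omega> * g (Xt \<omega> / c) \<partial>M)
      = (\<integral>\<omega>. H \<omega> * (\<integral>u. D \<omega> u * g ((Xs \<omega> + b * u) / c) \<partial>lborel) \<partial>M)"
    using *(1) unfolding eq eq2 by simp
  show "integrable M (\<lambda>\<omega>. H \<omega> * (\<integral>u. D \<omega> u * g ((Xs \<omega> + b * u) / c) \<partial>lborel))"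
    using *(2) unfolding eq2 by simp
qed

lemma integrable_density_mult:
  assumes g: "integrable lborel g" and "\<omega> \<in> space M" and "\<And>u. D \<omega> u \<le> C"
  shows "integrable lborel (\<lambda>u. D \<omega> u * g ((Xs \<omega> + b * u) / c))"
proof (rule Bochner_Integration.integrable_bound)
  have [measurable]: "g \<in> borel_measurable borel" "D \<omega> \<in> borel_measurable borel"
    using borel_measurable_integrable[OF g] measurable_density[OF assms(2)] by auto
  show "integrable lborel (\<lambda>u. C * g ((Xs \<omega> + b * u) / c))"
    using lborel_integral_affine(2)[OF b c g] by auto
  show "(\<lambda>u. D \<omega> u * g ((Xs \<omega> + b * u) / c)) \<in> borel_measurable lborel"
    by measurable
  show "AE u in lborel. norm (D \<omega> u * g ((Xs \<omega> + b * u) / c)) \<le> norm (C * g ((Xs \<omega> + b * u) / c))"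
    using assms(3) density_nonneg[OF assms(2)]
    by (intro AE_I2) (auto simp: abs_mult intro!: mult_right_mono, meson abs_ge_self order_trans)
qed

text \<open>The law of the normalised increment is a mixture of laws with a density, so it does not
  charge Lebesgue null sets. This makes kernel sums insensitive to the values of the kernel on a
  null set.\<close>

lemma AE_increment:
  assumes "N \<in> null_sets lborel"
  shows "AE \<omega> in M. (Xt \<omega> - Xs \<omega>) / b \<notin> N"
proof -
  have [measurable]: "N \<in> sets borel"
    using assms by auto
  have Ym: "(\<lambda>\<omega>. (Xt \<omega> - Xs \<omega>) / b) \<in> borel_measurable M"
    by measurable
  have z: "(\<integral>x. D \<omega> x * indicator N x \<partial>lborel) = 0" for \<omega>
    using AE_not_in[OF assms] by (intro integral_eq_zero_AE) (auto elim!: eventually_mono)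
  have "measure M {\<omega> \<in> space M. (Xt \<omega> - Xs \<omega>) / b \<in> N}
      = (\<integral>\<omega>. indicator N ((Xt \<omega> - Xs \<omega>) / b) \<partial>M)"
  proof -
    have "measure M {\<omega> \<in> space M. (Xt \<omega> - Xs \<omega>) / b \<in> N}
        = (\<integral>\<omega>. indicator {\<omega> \<in> space M. (Xt \<omega> - Xs \<omega>) / b \<in> N} \<omega> \<partial>M)"
      by simp
    also have "\<dots> = (\<integral>\<omega>. indicator N ((Xt \<omega> - Xs \<omega>) / b) \<partial>M)"
      by (intro Bochner_Integration.integral_cong) (auto simp: indicator_def)
    finally show ?thesis .
  qed
  also have "\<dots> = 0"
    using has_cond_density_integral(1)[OF prob_space_axioms G Ym D, of "\<lambda>_ x. indicator N x" 1] z
    by (auto simp: indicator_def)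
  finally show ?thesis
    by (subst AE_iff_measurable[OF _ refl]) (auto simp: emeasure_eq_measure)
qed

text \<open>Bounding the density by \<open>C\<close> leaves a Lebesgue integral, and the
  substitution in it produces the factor \<open>c / b\<close>.\<close>

lemma expectation_mult_increment_le:
  assumes g: "g \<in> borel_measurable borel" and gB: "\<And>x. \<bar>g x\<bar> \<le> B" and gi: "integrable lborel g"
    and H: "H \<in> borel_measurable G" and HB: "\<And>\<omega>. \<omega> \<in> space M \<Longrightarrow> \<bar>H \<omega>\<bar> \<le> B'"
    and C: "\<And>\<omega> u. \<omega> \<in> space M \<Longrightarrow> D \<omega> u \<le> C"
  shows "(\<integral>\<omega>. \<bar>H \<omega> * g (Xt \<omega> / c)\<bar> \<partial>M) \<le> C * (c / b) * (\<integral>u. \<bar>g u\<bar> \<partial>lborel) * (\<integral>\<omega>. \<bar>H \<omega>\<bar> \<partial>M)"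
proof -
  note [measurable] = g H
  have [measurable]: "H \<in> borel_measurable M"
    by (rule measurable_from_subalg[OF G H])
  have gi': "integrable lborel (\<lambda>u. \<bar>g u\<bar>)"
    using gi by simp
  have iH: "integrable M (\<lambda>\<omega>. \<bar>H \<omega>\<bar>)"
    by (rule integrable_const_bound[of _ B']) (use HB in auto)
  have inner: "(\<integral>u. D \<omega> u * \<bar>g ((Xs \<omega> + b * u) / c)\<bar> \<partial>lborel) \<le> C * (c / b) * (\<integral>u. \<bar>g u\<bar> \<partial>lborel)"
    if \<omega>: "\<omega> \<in> space M" for \<omega>
  proof -
    have "(\<integral>u. D \<omega> u * \<bar>g ((Xs \<omega> + b * u) / c)\<bar> \<partial>lborel)
        \<le> (\<integral>u. C * \<bar>g ((Xs \<omega> + b * u) / c)\<bar> \<partial>lborel)"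
      using C[OF \<omega>] integrable_density_mult[OF gi' \<omega>] lborel_integral_affine(2)[OF b c gi']
      by (intro integral_mono mult_right_mono) auto
    also have "\<dots> = C * (c / b) * (\<integral>u. \<bar>g u\<bar> \<partial>lborel)"
      using lborel_integral_affine(1)[OF b c, of "\<lambda>u. \<bar>g u\<bar>"] by simp
    finally show ?thesis .
  qed
  note e = expectation_mult_increment[of "\<lambda>u. \<bar>g u\<bar>" B "\<lambda>\<omega>. \<bar>H \<omega>\<bar>" B']
  have "(\<integral>\<omega>. \<bar>H \<omega> * g (Xt \<omega> / c)\<bar> \<partial>M)
      = (\<integral>\<omega>. \<bar>H \<omega>\<bar> * (\<integral>u. D \<omega> u * \<bar>g ((Xs \<omega> + b * u) / c)\<bar> \<partial>lborel) \<partial>M)"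
    unfolding abs_mult using gB HB by (intro e) auto
  also have "\<dots> \<le> (\<integral>\<omega>. \<bar>H \<omega>\<bar> * (C * (c / b) * (\<integral>u. \<bar>g u\<bar> \<partial>lborel)) \<partial>M)"
    using gB HB iH inner by (intro integral_mono e mult_left_mono) auto
  also have "\<dots> = C * (c / b) * (\<integral>u. \<bar>g u\<bar> \<partial>lborel) * (\<integral>\<omega>. \<bar>H \<omega>\<bar> \<partial>M)"
    by simp
  finally show ?thesis .
qed

text \<open>
  When \<open>g\<close> has mean zero the density may be replaced by its increment from 0, and the support
  conditions on \<open>g\<close> and \<open>H\<close> confine its argument to a small neighbourhood of 0.
\<close>

lemma expectation_mult_increment_centred:
  assumes g: "g \<in> borel_measurable borel" and gB: "\<And>x. \<bar>g x\<bar> \<le> B" and gi: "integrable lborel g"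
    and H: "H \<in> borel_measurable G" and HB: "\<And>\<omega>. \<omega> \<in> space M \<Longrightarrow> \<bar>H \<omega>\<bar> \<le> B'"
    and C: "\<And>\<omega> u. \<omega> \<in> space M \<Longrightarrow> D \<omega> u \<le> C"
    and g0: "(\<integral>u. g u \<partial>lborel) = 0"
    and supp: "\<And>u. \<bar>u\<bar> > e \<Longrightarrow> g u = 0"
      "\<And>\<omega>. \<omega> \<in> space M \<Longrightarrow> \<bar>Xs \<omega> / c\<bar> > e \<Longrightarrow> H \<omega> = 0"
    and w: "\<And>\<omega> u. \<omega> \<in> space M \<Longrightarrow> \<bar>u\<bar> \<le> 2 * e * (c / b) \<Longrightarrow> \<bar>D \<omega> u - D \<omega> 0\<bar> \<le> w"
  shows "\<bar>\<integral>\<omega>. H \<omega> * g (Xt \<omega> / c) \<partial>M\<bar> \<le> w * (c / b) * (\<integral>u. \<bar>g u\<bar> \<partial>lborel) * (\<integral>\<omega>. \<bar>H \<omega>\<bar> \<partial>M)"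
proof -
  note [measurable] = g H
  have [measurable]: "H \<in> borel_measurable M"
    by (rule measurable_from_subalg[OF G H])
  have gi': "integrable lborel (\<lambda>u. \<bar>g u\<bar>)"
    using gi by simp
  have iH: "integrable M (\<lambda>\<omega>. \<bar>H \<omega>\<bar>)"
    by (rule integrable_const_bound[of _ B']) (use HB in auto)
  have inner: "\<bar>\<integral>u. D \<omega> u * g ((Xs \<omega> + b * u) / c) \<partial>lborel\<bar> \<le> w * (c / b) * (\<integral>u. \<bar>g u\<bar> \<partial>lborel)"
    if \<omega>: "\<omega> \<in> space M" and X: "\<bar>Xs \<omega> / c\<bar> \<le> e" for \<omega>
  proof -
    let ?g = "\<lambda>u. g ((Xs \<omega> + b * u) / c)"
    have i: "integrable lborel (\<lambda>u. D \<omega> u * ?g u)" "integrable lborel ?g"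
      using C[OF \<omega>] integrable_density_mult[OF gi \<omega>] lborel_integral_affine(2)[OF b c gi] by auto
    have le: "\<bar>(D \<omega> u - D \<omega> 0) * ?g u\<bar> \<le> w * \<bar>?g u\<bar>" for u
    proof (cases "?g u = 0")
      \<comment> \<open>Both \<open>Xs / c\<close> and the new position
        \<open>(Xs + b * u) / c\<close> lie in \<open>[-e, e]\<close>, so their difference
        \<open>b * u / c\<close> is at most \<open>2 * e\<close> in absolute value; hence the radius
        in the assumption on \<open>w\<close>.\<close>
      case False
      then have "\<bar>(Xs \<omega> + b * u) / c\<bar> \<le> e"
        using supp(1) by (meson not_less)
      then have "\<bar>b * u / c\<bar> \<le> 2 * e"
        using X unfolding add_divide_distrib by linarith
      then have "\<bar>u\<bar> \<le> 2 * e * (c / b)"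
        using b c by (simp add: abs_mult field_simps)
      from w[OF \<omega> this] show ?thesis
        unfolding abs_mult by (intro mult_right_mono) auto
    qed simp
    have "(\<integral>u. D \<omega> u * ?g u \<partial>lborel) = (\<integral>u. (D \<omega> u - D \<omega> 0) * ?g u \<partial>lborel)"
      using i lborel_integral_affine(1)[OF b c, of g] g0 by (simp add: left_diff_distrib)
    also have "\<bar>\<dots>\<bar> \<le> (\<integral>u. \<bar>(D \<omega> u - D \<omega> 0) * ?g u\<bar> \<partial>lborel)"
      by (rule integral_abs_bound)
    also have "\<dots> \<le> (\<integral>u. w * \<bar>?g u\<bar> \<partial>lborel)"
      using i le by (intro integral_mono) (auto simp: left_diff_distrib)
    also have "\<dots> = w * (c / b) * (\<integral>u. \<bar>g u\<bar> \<partial>lborel)"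
      using lborel_integral_affine(1)[OF b c, of "\<lambda>u. \<bar>g u\<bar>"] by simp
    finally show ?thesis .
  qed
  note e = expectation_mult_increment[of g B H B', OF g gB H HB]
  have "\<bar>\<integral>\<omega>. H \<omega> * g (Xt \<omega> / c) \<partial>M\<bar>
      = \<bar>\<integral>\<omega>. H \<omega> * (\<integral>u. D \<omega> u * g ((Xs \<omega> + b * u) / c) \<partial>lborel) \<partial>M\<bar>"
    using e(1) by simp
  also have "\<dots> \<le> (\<integral>\<omega>. \<bar>H \<omega> * (\<integral>u. D \<omega> u * g ((Xs \<omega> + b * u) / c) \<partial>lborel)\<bar> \<partial>M)"
    by (rule integral_abs_bound)
  also have "\<dots> \<le> (\<integral>\<omega>. \<bar>H \<omega>\<bar> * (w * (c / b) * (\<integral>u. \<bar>g u\<bar> \<partial>lborel)) \<partial>M)"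
  proof (rule integral_mono)
    show "integrable M (\<lambda>\<omega>. \<bar>H \<omega> * (\<integral>u. D \<omega> u * g ((Xs \<omega> + b * u) / c) \<partial>lborel)\<bar>)"
      using e(2) by (rule integrable_abs)
    show "\<bar>H \<omega> * (\<integral>u. D \<omega> u * g ((Xs \<omega> + b * u) / c) \<partial>lborel)\<bar>
        \<le> \<bar>H \<omega>\<bar> * (w * (c / b) * (\<integral>u. \<bar>g u\<bar> \<partial>lborel))" if "\<omega> \<in> space M" for \<omega>
    proof (cases "\<bar>Xs \<omega> / c\<bar> \<le> e")
      case True
      then show ?thesis
        using inner[OF that] unfolding abs_mult by (intro mult_left_mono) auto
    next
      case False
      then show ?thesis using supp(2)[OF that] by simp
    qed
  qed (use iH in auto)
  also have "\<dots> = w * (c / b) * (\<integral>u. \<bar>g u\<bar> \<partial>lborel) * (\<integral>\<omega>. \<bar>H \<omega>\<bar> \<partial>M)"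
    by simp
  finally show ?thesis .
qed

end

section \<open>Double sums dominated by products over index and lag\<close>

lemma sum_shift_le:
  fixes f :: "nat \<Rightarrow> real"
  assumes "\<And>k. 0 \<le> f k"
  shows "(\<Sum>t=s..n. f (t - s)) \<le> (\<Sum>k=0..n. f k)"
proof -
  have "(\<Sum>t=s..n. f (t - s)) = sum f ((\<lambda>t. t - s) ` {s..n})"
    by (subst sum.reindex) (auto simp: inj_on_def)
  also have "\<dots> \<le> (\<Sum>k=0..n. f k)"
    using assms by (intro sum_mono2) auto
  finally show ?thesis .
qed

text \<open>Describe a pair \<open>s \<le> t\<close> by its index \<open>s\<close> and its lag
  \<open>t - s\<close>. Either \<open>s < m\<close>, or \<open>m' < s\<close>, or the lag is below
  \<open>m\<close>, or the sharper bound with \<open>w\<close> applies. In each case the bound is a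
  product, so the double sum reduces to single sums. Small index and small lag both cost
  \<open>S1\<close>, hence \<open>2 * S1\<close>; the outer factor 2 comes from symmetry.\<close>

lemma sum_square_le_lagged:
  fixes e :: "nat \<Rightarrow> nat \<Rightarrow> real" and b :: "nat \<Rightarrow> real"
  assumes b: "\<And>k. 0 \<le> b k" and w: "0 \<le> w"
    and sym: "\<And>s t. e s t = e t s" and e0: "\<And>s t. 0 \<le> e s t"
    and e1: "\<And>s t. 1 \<le> s \<Longrightarrow> s \<le> t \<Longrightarrow> t \<le> n \<Longrightarrow> e s t \<le> b s * b (t - s)"
    and e2: "\<And>s t. 1 \<le> s \<Longrightarrow> m \<le> s \<Longrightarrow> s \<le> m' \<Longrightarrow> m + s \<le> t \<Longrightarrow> t \<le> n \<Longrightarrow> e s t \<le> w * (b s * b (t - s))"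
    and P: "(\<Sum>k=0..n. b k) \<le> P"
    and S1: "(\<Sum>k=0..n. if k < m then b k else 0) \<le> S1"
    and S2: "(\<Sum>k=0..n. if m' < k then b k else 0) \<le> S2"
  shows "(\<Sum>s=1..n. \<Sum>t=1..n. e s t) \<le> 2 * (P * (2 * S1 + S2 + w * P))"
proof -
  let ?q = "\<lambda>s. (if s < m then b s else 0) + (if m' < s then b s else 0) + w * b s"
  let ?r = "\<lambda>k. if k < m then b k else 0"
  have q0: "0 \<le> ?q s" for s
    using b w by simp
  have P0: "0 \<le> P"
    using b by (intro order_trans[OF _ P] sum_nonneg)
  have S10: "0 \<le> S1"
    using b by (intro order_trans[OF _ S1] sum_nonneg) auto
  have *: "e s t \<le> ?q s * b (t - s) + b s * ?r (t - s)" if "1 \<le> s" "s \<le> t" "t \<le> n" for s t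
  proof -
    have bb: "0 \<le> b s * b (t - s)"
      using b by simp
    have "s < m \<or> m' < s \<or> t - s < m \<or> (m \<le> s \<and> s \<le> m' \<and> m + s \<le> t)"
      using that by arith
    then consider "s < m" | "m' < s" | "t - s < m" | "m \<le> s \<and> s \<le> m' \<and> m + s \<le> t"
      by blast
    moreover have "?q s * b (t - s) + b s * ?r (t - s) = (if s < m then b s * b (t - s) else 0)
        + (if m' < s then b s * b (t - s) else 0) + w * (b s * b (t - s))
        + (if t - s < m then b s * b (t - s) else 0)"
      by (simp add: distrib_right)
    moreover have "0 \<le> w * (b s * b (t - s))"
      using bb w by simp
    ultimately show ?thesis
      using bb e1[OF that] e2[of s t] that by cases (auto split: if_splits)
  qed
  \<comment> \<open>The diagonal term occurs in both halves, which only enlarges the bound.\<close>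
  have split: "(\<Sum>t=1..n. e s t) \<le> (\<Sum>t=s..n. e s t) + (\<Sum>t=1..s. e t s)" if "s \<in> {1..n}" for s
  proof -
    have "(\<Sum>t=1..n. e s t) \<le> (\<Sum>t\<in>{s..n} \<union> {1..s}. e s t)"
      using that e0 by (intro sum_mono2) auto
    also have "\<dots> \<le> (\<Sum>t=s..n. e s t) + (\<Sum>t=1..s. e s t)"
      using e0 by (subst sum.union_inter[symmetric]) (auto intro!: sum_nonneg)
    finally show ?thesis
      using sym by simp
  qed
  have "(\<Sum>s=1..n. \<Sum>t=1..n. e s t) \<le> (\<Sum>s=1..n. (\<Sum>t=s..n. e s t) + (\<Sum>t=1..s. e t s))"
    by (intro sum_mono split)
  also have "\<dots> = (\<Sum>s=1..n. \<Sum>t=s..n. e s t) + (\<Sum>s=1..n. \<Sum>t=1..s. e t s)"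
    by (rule sum.distrib)
  also have "(\<Sum>s=1..n. \<Sum>t=1..s. e t s) = (\<Sum>s=1..n. \<Sum>t=s..n. e s t)"
    by (simp add: sum.Sigma) (rule sum.reindex_bij_witness[of _ prod.swap prod.swap], auto)
  also have "(\<Sum>s=1..n. \<Sum>t=s..n. e s t) + (\<Sum>s=1..n. \<Sum>t=s..n. e s t)
      = 2 * (\<Sum>s=1..n. \<Sum>t=s..n. e s t)"
    by simp
  also have "(\<Sum>s=1..n. \<Sum>t=s..n. e s t) \<le> (\<Sum>s=1..n. \<Sum>t=s..n. ?q s * b (t - s) + b s * ?r (t - s))"
    using * by (intro sum_mono) auto
  also have "\<dots> = (\<Sum>s=1..n. ?q s * (\<Sum>t=s..n. b (t - s)) + b s * (\<Sum>t=s..n. ?r (t - s)))"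
    by (simp only: sum.distrib sum_distrib_left)
  also have "\<dots> \<le> (\<Sum>s=1..n. ?q s * P + b s * S1)"
    using b P S1 q0 w
    by (intro sum_mono add_mono mult_left_mono order_trans[OF sum_shift_le]) auto
  also have "\<dots> \<le> (\<Sum>s=0..n. ?q s * P + b s * S1)"
    using q0 b P0 S10 w by (intro sum_mono2 add_nonneg_nonneg mult_nonneg_nonneg) auto
  also have "\<dots> = (\<Sum>s=0..n. ?q s) * P + (\<Sum>s=0..n. b s) * S1"
    unfolding sum_distrib_right by (rule sum.distrib)
  also have "(\<Sum>s=0..n. ?q s) = (\<Sum>s=0..n. ?r s) + (\<Sum>s=0..n. if m' < s then b s else 0) + w * (\<Sum>s=0..n. b s)"
    by (simp only: sum.distrib sum_distrib_left)
  also have "(\<dots>) * P + (\<Sum>s=0..n. b s) * S1 \<le> (S1 + S2 + w * P) * P + P * S1"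
    using S1 S2 P w P0 S10 by (intro add_mono mult_right_mono mult_left_mono)
  also have "\<dots> = P * (2 * S1 + S2 + w * P)"
    by (simp add: algebra_simps)
  finally show ?thesis by simp
qed

section \<open>Smoothing kernels\<close>

text \<open>The triangular density on \<open>[-e, e]\<close>. It is Lipschitz because HL4 speaks of
  bounded Lipschitz functions, and compactly supported so that the centred kernel is localised near
  0.\<close>

definition hat :: "real \<Rightarrow> real \<Rightarrow> real" where
  "hat e v = max 0 (1 - \<bar>v\<bar> / e) / e"

lemma continuous_hat: "e > 0 \<Longrightarrow> continuous_on UNIV (hat e)"
  unfolding hat_def by (intro continuous_intros) auto

lemma measurable_hat [measurable]: "hat e \<in> borel_measurable borel"
  unfolding hat_def by measurable

lemma hat_nonneg: "e > 0 \<Longrightarrow> 0 \<le> hat e v"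
  by (simp add: hat_def)

lemma hat_le: "e > 0 \<Longrightarrow> hat e v \<le> 1 / e"
  by (auto simp: hat_def intro!: divide_right_mono)

lemma abs_hat_le: "e > 0 \<Longrightarrow> \<bar>hat e v\<bar> \<le> 1 / e"
  using hat_le hat_nonneg by simp

lemma hat_eq_0: "e > 0 \<Longrightarrow> \<bar>v\<bar> > e \<Longrightarrow> hat e v = 0"
  by (simp add: hat_def)

lemma hat_lipschitz: "e > 0 \<Longrightarrow> (1 / e\<^sup>2)-lipschitz_on UNIV (hat e)"
proof (rule lipschitz_onI)
  fix x y assume e: "e > 0"
  have "\<bar>max 0 (1 - \<bar>x\<bar> / e) - max 0 (1 - \<bar>y\<bar> / e)\<bar> \<le> \<bar>\<bar>x\<bar> / e - \<bar>y\<bar> / e\<bar>"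
    by linarith
  also have "\<dots> = \<bar>\<bar>x\<bar> - \<bar>y\<bar>\<bar> / e"
    using e by (simp add: diff_divide_distrib[symmetric])
  also have "\<dots> \<le> \<bar>x - y\<bar> / e"
    using e by (intro divide_right_mono) linarith+
  finally have "\<bar>max 0 (1 - \<bar>x\<bar> / e) - max 0 (1 - \<bar>y\<bar> / e)\<bar> / e \<le> \<bar>x - y\<bar> / e / e"
    using e by (intro divide_right_mono) auto
  then show "dist (hat e x) (hat e y) \<le> 1 / e\<^sup>2 * dist x y"
    using e by (simp add: hat_def dist_real_def power2_eq_square diff_divide_distrib[symmetric])
qed simp

lemma hat_integral:
  assumes e: "e > 0"
  shows "integrable lborel (hat e)" "(\<integral>v. hat e v \<partial>lborel) = 1"
proof -
  have "has_bochner_integral lborel (\<lambda>v. (1 + v) * indicator {-1..0} v) (0 - (-1 + (-1)\<^sup>2 / 2) :: real)"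
    using has_bochner_integral_FTC_Icc_real[of "-1" 0 "\<lambda>v. v + v\<^sup>2 / 2" "\<lambda>v. 1 + v"]
    by (force intro!: derivative_eq_intros)
  moreover have "has_bochner_integral lborel (\<lambda>v. (1 - v) * indicator {0..1} v) ((1 - 1\<^sup>2 / 2) - 0 :: real)"
    using has_bochner_integral_FTC_Icc_real[of 0 1 "\<lambda>v. v - v\<^sup>2 / 2" "\<lambda>v. 1 - v"]
    by (force intro!: derivative_eq_intros)
  ultimately have "has_bochner_integral lborel
      (\<lambda>v::real. (1 + v) * indicator {-1..0} v + (1 - v) * indicator {0..1} v) 1"
    using has_bochner_integral_add by fastforce
  \<comment> \<open>At 0 both indicators equal 1 and the sum is 2 instead of 1, so the identity
    holds off a single point.\<close>
  moreover have "AE v in lborel. (1 + v) * indicator {-1..0} v + (1 - v) * indicator {0..1} v = hat 1 v"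
    using AE_lborel_singleton[of 0] by eventually_elim (auto simp: hat_def indicator_def)
  ultimately have h1: "has_bochner_integral lborel (hat 1) 1"
    by (subst has_bochner_integral_cong_AE[symmetric, where f = "\<lambda>v::real. (1 + v) * indicator {-1..0} v + (1 - v) * indicator {0..1} v"])
       auto
  have s: "hat e v = hat 1 ((0 + 1 * v) / e) / e" for v
    using e by (simp add: hat_def)
  show "integrable lborel (hat e)"
    unfolding s[abs_def] using h1 e
    by (intro Bochner_Integration.integrable_divide lborel_integral_affine(2))
       (auto simp: has_bochner_integral_iff)
  show "(\<integral>v. hat e v \<partial>lborel) = 1"
    unfolding s using h1 e lborel_integral_affine(1)[of 1 e "hat 1" 0]
    by (simp add: has_bochner_integral_iff)
qed

text \<open>Since \<open>hat e\<close> is even, this is the convolution of \<open>\<Phi>\<close>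
  with \<open>hat e\<close> at \<open>- m\<close>. It is also the mean of
  \<open>hat e (U + m)\<close> for a variable \<open>U\<close> with density
  \<open>\<Phi>\<close>.\<close>

definition smooth :: "(real \<Rightarrow> real) \<Rightarrow> real \<Rightarrow> real \<Rightarrow> real" where
  "smooth \<Phi> e m = (\<integral>u. hat e (u + m) * \<Phi> u \<partial>lborel)"

locale bounded_continuous_density =
  fixes \<Phi> :: "real \<Rightarrow> real"
  assumes nonneg: "\<And>x. 0 \<le> \<Phi> x" and cont: "continuous_on UNIV \<Phi>" and bdd: "bounded (range \<Phi>)"
    and integrable: "integrable lborel \<Phi>" and integral: "(\<integral>u. \<Phi> u \<partial>lborel) = 1"
begin

lemma measurable [measurable]: "\<Phi> \<in> borel_measurable borel"
  by (rule borel_measurable_continuous_onI[OF cont])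

lemma integrable_mult:
  assumes [measurable]: "h \<in> borel_measurable borel" and "\<And>u. \<bar>h u\<bar> \<le> (B::real)"
  shows "integrable lborel (\<lambda>u. h u * \<Phi> u)"
proof (rule Bochner_Integration.integrable_bound)
  show "integrable lborel (\<lambda>u. B * \<Phi> u)"
    using integrable by simp
  show "AE u in lborel. norm (h u * \<Phi> u) \<le> norm (B * \<Phi> u)"
    using assms(2) by (intro AE_I2) (auto simp: abs_mult intro!: mult_right_mono, meson abs_ge_self order_trans)
qed simp

lemma abs_integral_mult_le:
  assumes [measurable]: "h \<in> borel_measurable borel" and "\<And>u. \<bar>h u\<bar> \<le> (B::real)"
  shows "\<bar>\<integral>u. h u * \<Phi> u \<partial>lborel\<bar> \<le> B"
proof -
  have "\<bar>\<integral>u. h u * \<Phi> u \<partial>lborel\<bar> \<le> (\<integral>u. \<bar>h u * \<Phi> u\<bar> \<partial>lborel)"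
    by (rule integral_abs_bound)
  also have "\<dots> \<le> (\<integral>u. B * \<Phi> u \<partial>lborel)"
    using assms(2) nonneg integrable integrable_abs[OF integrable_mult[OF assms]]
    by (intro integral_mono) (auto simp: abs_mult intro!: mult_right_mono)
  finally show ?thesis
    by (simp add: integral)
qed

lemma smooth_lipschitz:
  assumes e: "e > 0"
  shows "(1 / e\<^sup>2)-lipschitz_on UNIV (smooth \<Phi> e)"
proof (rule lipschitz_onI)
  fix x y :: real
  have i: "integrable lborel (\<lambda>u. hat e (u + z) * \<Phi> u)" for z
    by (rule integrable_mult[of _ "1 / e"]) (use abs_hat_le[OF e] in auto)
  have "smooth \<Phi> e x - smooth \<Phi> e y = (\<integral>u. (hat e (u + x) - hat e (u + y)) * \<Phi> u \<partial>lborel)"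
    using i by (simp add: smooth_def left_diff_distrib)
  also have "\<bar>\<dots>\<bar> \<le> 1 / e\<^sup>2 * \<bar>x - y\<bar>"
    using lipschitz_onD[OF hat_lipschitz[OF e]]
    by (intro abs_integral_mult_le) (auto simp: dist_real_def dest: spec[of _ "_ + x"], metis (no_types) UNIV_I add_diff_cancel_left)
  finally show "dist (smooth \<Phi> e x) (smooth \<Phi> e y) \<le> 1 / e\<^sup>2 * dist x y"
    by (simp add: dist_real_def)
qed simp

lemma abs_smooth_le: "e > 0 \<Longrightarrow> \<bar>smooth \<Phi> e m\<bar> \<le> 1 / e"
  unfolding smooth_def by (rule abs_integral_mult_le) (use abs_hat_le in auto)

text \<open>The substitution \<open>u = e * v - m\<close> moves \<open>e\<close> from the kernel
  into the argument of \<open>\<Phi>\<close>, so that the integrands have a common integrable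
  majorant as \<open>e\<close> varies.\<close>

lemma smooth_eq:
  assumes e: "e > 0"
  shows "smooth \<Phi> e m = (\<integral>v. hat 1 v * \<Phi> (e * v - m) \<partial>lborel)"
proof -
  have "smooth \<Phi> e m = e * (\<integral>v. hat e ((- m + e * v) + m) * \<Phi> (- m + e * v) \<partial>lborel)"
    unfolding smooth_def
    using e lborel_integral_real_affine[of e "\<lambda>u. hat e (u + m) * \<Phi> u" "- m"] by simp
  also have "\<dots> = (\<integral>v. e * (hat e ((- m + e * v) + m) * \<Phi> (- m + e * v)) \<partial>lborel)"
    by (simp only: integral_mult_right_zero)
  also have "\<dots> = (\<integral>v. hat 1 v * \<Phi> (e * v - m) \<partial>lborel)"
    using e by (intro Bochner_Integration.integral_cong) (auto simp: hat_def abs_mult)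
  finally show ?thesis .
qed

lemma smooth_tendsto:
  assumes e: "\<And>k. 0 < e k" and lim: "e \<longlonglongrightarrow> 0"
  shows "(\<lambda>k. smooth \<Phi> (e k) m) \<longlonglongrightarrow> \<Phi> (- m)"
proof -
  obtain B where B: "\<And>x. \<bar>\<Phi> x\<bar> \<le> B"
    using bdd by (auto simp: bounded_iff)
  have "(\<lambda>k. \<integral>v. hat 1 v * \<Phi> (e k * v - m) \<partial>lborel) \<longlonglongrightarrow> (\<integral>v. hat 1 v * \<Phi> (- m) \<partial>lborel)"
  proof (rule integral_dominated_convergence)
    show "integrable lborel (\<lambda>v. hat 1 v * B)"
      using hat_integral(1)[of 1] by simp
    show "AE v in lborel. (\<lambda>k. hat 1 v * \<Phi> (e k * v - m)) \<longlonglongrightarrow> hat 1 v * \<Phi> (- m)"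
    proof (rule AE_I2)
      fix v :: real
      have "isCont \<Phi> (- m)"
        using cont by (simp add: continuous_on_eq_continuous_at)
      moreover have "(\<lambda>k. e k * v - m) \<longlonglongrightarrow> 0 * v - m"
        by (intro tendsto_intros lim)
      ultimately have "(\<lambda>k. \<Phi> (e k * v - m)) \<longlonglongrightarrow> \<Phi> (- m)"
        using isCont_tendsto_compose[of "- m" \<Phi>] by simp
      then show "(\<lambda>k. hat 1 v * \<Phi> (e k * v - m)) \<longlonglongrightarrow> hat 1 v * \<Phi> (- m)"
        by (intro tendsto_intros)
    qed
    show "AE v in lborel. norm (hat 1 v * \<Phi> (e k * v - m)) \<le> hat 1 v * B" for k
      using B hat_nonneg[of 1] by (auto simp: abs_mult intro!: mult_left_mono)
  qed auto
  then show ?thesis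
    using hat_integral[of 1] by (simp add: smooth_eq[OF e])
qed

end

section \<open>Conditional expectations of smoothed functionals\<close>

lemma (in sigma_finite_subalgebra) expectation_abs_cond_exp_le:
  assumes f: "integrable M f"
  shows "(\<integral>\<omega>. \<bar>real_cond_exp M F f \<omega>\<bar> \<partial>M) \<le> (\<integral>\<omega>. \<bar>f \<omega>\<bar> \<partial>M)"
proof -
  have fa: "integrable M (\<lambda>\<omega>. \<bar>f \<omega>\<bar>)"
    using f by simp
  have "AE \<omega> in M. real_cond_exp M F f \<omega> \<le> real_cond_exp M F (\<lambda>\<omega>. \<bar>f \<omega>\<bar>) \<omega>"
    using f fa by (intro real_cond_exp_mono) auto
  moreover have "AE \<omega> in M. real_cond_exp M F (\<lambda>\<omega>. (-1) * \<bar>f \<omega>\<bar>) \<omega> \<le> real_cond_exp M F f \<omega>"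
    using f fa by (intro real_cond_exp_mono) (auto simp: abs_le_iff)
  moreover have "AE \<omega> in M. real_cond_exp M F (\<lambda>\<omega>. (-1) * \<bar>f \<omega>\<bar>) \<omega> = (-1) * real_cond_exp M F (\<lambda>\<omega>. \<bar>f \<omega>\<bar>) \<omega>"
    by (rule real_cond_exp_cmult[OF fa])
  ultimately have "AE \<omega> in M. \<bar>real_cond_exp M F f \<omega>\<bar> \<le> real_cond_exp M F (\<lambda>\<omega>. \<bar>f \<omega>\<bar>) \<omega>"
    by eventually_elim linarith
  then have "(\<integral>\<omega>. \<bar>real_cond_exp M F f \<omega>\<bar> \<partial>M) \<le> (\<integral>\<omega>. real_cond_exp M F (\<lambda>\<omega>. \<bar>f \<omega>\<bar>) \<omega> \<partial>M)"
    using real_cond_exp_int(1)[OF f] real_cond_exp_int(1)[OF fa] by (intro integral_mono_AE) auto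
  then show ?thesis
    using real_cond_exp_int(2)[OF fa] by simp
qed

lemma (in finite_measure_subalgebra) abs_cond_exp_le:
  assumes f: "integrable M f" and B: "\<And>\<omega>. \<omega> \<in> space M \<Longrightarrow> \<bar>f \<omega>\<bar> \<le> B"
  shows "AE \<omega> in M. \<bar>real_cond_exp M F f \<omega>\<bar> \<le> B"
proof -
  have "AE \<omega> in M. real_cond_exp M F f \<omega> \<ge> - B"
    by (rule real_cond_exp_ge_c[OF f]) (use B in \<open>auto simp: abs_le_iff minus_le_iff\<close>)
  moreover have "AE \<omega> in M. real_cond_exp M F f \<omega> \<le> B"
    by (rule real_cond_exp_le_c[OF f]) (use B in \<open>auto simp: abs_le_iff\<close>)
  ultimately show ?thesis
    by eventually_elim auto
qed

text \<open>The continuous ramps \<open>f k\<close> dominate the indicator of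
  \<open>\<bar>x\<bar> \<ge> k + 1\<close> and vanish pointwise as \<open>k\<close> grows. One picks
  \<open>k\<close> for the limit variable and transfers the strict inequality to the sequence by
  convergence in distribution.\<close>

lemma (in prob_space) conv_distr_tight:
  fixes Y :: "nat \<Rightarrow> 'a \<Rightarrow> real" and Z :: "'b \<Rightarrow> real"
  assumes N: "prob_space N" and Z [measurable]: "Z \<in> borel_measurable N"
    and Y: "\<And>n. 1 \<le> n \<Longrightarrow> Y n \<in> borel_measurable M"
    and conv: "conv_distr M Y N Z" and r: "0 < r"
  obtains A where "\<forall>\<^sub>F n in sequentially. measure M {\<omega> \<in> space M. A \<le> \<bar>Y n \<omega>\<bar>} < r"
proof -
  interpret N: prob_space N by fact
  define f :: "nat \<Rightarrow> real \<Rightarrow> real" where "f k x = max 0 (min 1 (\<bar>x\<bar> - real k))" for k x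
  have f_cont: "continuous_on UNIV (f k)" for k
    unfolding f_def by (intro continuous_intros)
  then have [measurable]: "f k \<in> borel_measurable borel" for k
    by (rule borel_measurable_continuous_onI)
  have f_bd: "\<bar>f k x\<bar> \<le> 1" "0 \<le> f k x" for k x
    by (auto simp: f_def)
  have "(\<lambda>k. \<integral>\<omega>. f k (Z \<omega>) \<partial>N) \<longlonglongrightarrow> (\<integral>\<omega>. 0 \<partial>N)"
  proof (rule integral_dominated_convergence[where w = "\<lambda>_. 1"])
    show "AE \<omega> in N. (\<lambda>k. f k (Z \<omega>)) \<longlonglongrightarrow> 0"
    proof (rule AE_I2)
      fix \<omega>
      have "\<forall>\<^sub>F k in sequentially. f k (Z \<omega>) = 0"
        using eventually_ge_at_top[of "nat \<lceil>\<bar>Z \<omega>\<bar>\<rceil>"] by eventually_elim (auto simp: f_def nat_le_iff ceiling_le_iff)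
      then show "(\<lambda>k. f k (Z \<omega>)) \<longlonglongrightarrow> 0"
        by (rule tendsto_eventually)
    qed
  qed (use f_bd in auto)
  then have "\<forall>\<^sub>F k in sequentially. (\<integral>\<omega>. f k (Z \<omega>) \<partial>N) < r"
    using r by (intro order_tendstoD) auto
  then obtain k where k: "(\<integral>\<omega>. f k (Z \<omega>) \<partial>N) < r"
    by (auto simp: eventually_sequentially)
  have "bounded (range (f k))"
    using f_bd by (auto simp: bounded_iff intro!: exI[of _ 1])
  then have "(\<lambda>n. \<integral>\<omega>. f k (Y n \<omega>) \<partial>M) \<longlonglongrightarrow> (\<integral>\<omega>. f k (Z \<omega>) \<partial>N)"
    using conv f_cont by (simp add: conv_distr_def)
  then have "\<forall>\<^sub>F n in sequentially. (\<integral>\<omega>. f k (Y n \<omega>) \<partial>M) < r"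
    using k by (rule order_tendstoD)
  then have "\<forall>\<^sub>F n in sequentially. measure M {\<omega> \<in> space M. real k + 1 \<le> \<bar>Y n \<omega>\<bar>} < r"
    using eventually_ge_at_top[of 1]
  proof eventually_elim
    case (elim n)
    note [measurable] = Y[OF elim(2)]
    let ?A = "{\<omega> \<in> space M. real k + 1 \<le> \<bar>Y n \<omega>\<bar>}"
    have i: "integrable M (\<lambda>\<omega>. f k (Y n \<omega>))"
      by (rule integrable_const_bound[of _ 1]) (use f_bd in auto)
    have "measure M ?A = (\<integral>\<omega>. indicator ?A \<omega> \<partial>M)"
      by simp
    also have "\<dots> \<le> (\<integral>\<omega>. f k (Y n \<omega>) \<partial>M)"
    proof (rule integral_mono[OF _ i])
      show "integrable M (indicator ?A :: 'a \<Rightarrow> real)"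
        by (auto simp: less_top[symmetric])
    qed (auto simp: indicator_def f_def)
    finally show ?case using elim by simp
  qed
  then show ?thesis by (rule that)
qed

text \<open>\<open>P n\<close> is the part with limiting conditional density \<open>\<Phi>\<close>
  given \<open>G\<close>, and \<open>m n\<close> the part known to \<open>G\<close>. The conclusions
  compare random quantities along the same row, so tightness of \<open>m n\<close> takes the place
  of a limit.\<close>

locale conditional_limit = prob_space M + bounded_continuous_density \<Phi>
  for M :: "'a measure" and \<Phi> +
  fixes G :: "'a measure" and P m :: "nat \<Rightarrow> 'a \<Rightarrow> real"
  assumes G: "subalgebra M G"
    and P: "\<And>n. 1 \<le> n \<Longrightarrow> P n \<in> borel_measurable M"
    and m: "\<And>n. 1 \<le> n \<Longrightarrow> m n \<in> borel_measurable G"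
    and cond_conv: "\<And>h. continuous_on UNIV h \<Longrightarrow> bounded (range h) \<Longrightarrow>
      conv_prob M (\<lambda>n. real_cond_exp M G (\<lambda>\<omega>. h (P n \<omega>))) (\<integral>x. h x * \<Phi> x \<partial>lborel)"
    and tight: "\<And>r. 0 < r \<Longrightarrow> \<exists>A. \<forall>\<^sub>F n in sequentially. measure M {\<omega> \<in> space M. A \<le> \<bar>m n \<omega>\<bar>} < r"
begin

sublocale finite_measure_subalgebra M G
  by unfold_locales (rule G)

lemma integrable_hat:
  assumes [measurable]: "V \<in> borel_measurable M" and e: "0 < e"
  shows "integrable M (\<lambda>\<omega>. hat e (V \<omega>))"
  by (rule integrable_const_bound[of _ "1 / e"]) (use abs_hat_le[OF e] in auto)

text \<open>For a fixed shift \<open>a\<close>, the translate of \<open>hat e\<close> is a bounded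
  continuous test function, and boundedness turns the resulting convergence in probability into
  convergence in mean.\<close>

lemma cond_exp_hat_shift_tendsto:
  assumes e: "0 < e"
  shows "(\<lambda>n. \<integral>\<omega>. \<bar>real_cond_exp M G (\<lambda>\<omega>. hat e (P n \<omega> + a)) \<omega> - smooth \<Phi> e a\<bar> \<partial>M) \<longlonglongrightarrow> 0"
proof -
  let ?T = "\<lambda>n. real_cond_exp M G (\<lambda>\<omega>. hat e (P n \<omega> + a))"
  \<comment> \<open>Each of the two terms is at most \<open>1 / e\<close>; the maximum with 1 is
    required by the comparison with truncated means.\<close>
  let ?B = "max 1 (2 / e)"
  have "continuous_on UNIV (\<lambda>x. hat e (x + a))"
    by (rule continuous_on_compose2[OF continuous_hat[OF e]]) (auto intro!: continuous_intros)
  moreover have "bounded (range (\<lambda>x. hat e (x + a)))"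
    using abs_hat_le[OF e] by (auto simp: bounded_iff)
  ultimately have "small_o_p M (\<lambda>n \<omega>. ereal (?T n \<omega> - smooth \<Phi> e a))"
    using cond_conv[of "\<lambda>x. hat e (x + a)"] by (simp add: conv_prob_def smooth_def)
  then have lim: "(\<lambda>n. ?B * trunc_mean M (\<lambda>\<omega>. ?T n \<omega> - smooth \<Phi> e a)) \<longlonglongrightarrow> 0"
    by (intro tendsto_mult_right_zero trunc_mean_tendsto_0[of 1]) auto
  show ?thesis
  proof (rule Lim_null_comparison[OF _ lim])
    show "\<forall>\<^sub>F n in sequentially. norm (\<integral>\<omega>. \<bar>?T n \<omega> - smooth \<Phi> e a\<bar> \<partial>M)
        \<le> ?B * trunc_mean M (\<lambda>\<omega>. ?T n \<omega> - smooth \<Phi> e a)"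
      using eventually_ge_at_top[of 1]
    proof eventually_elim
      case (elim n)
      note [measurable] = P[OF elim]
      have "AE \<omega> in M. \<bar>?T n \<omega>\<bar> \<le> 1 / e"
        using e by (intro abs_cond_exp_le integrable_hat abs_hat_le) auto
      then have "AE \<omega> in M. \<bar>?T n \<omega> - smooth \<Phi> e a\<bar> \<le> ?B"
      proof eventually_elim
        case (elim \<omega>)
        then show ?case
          using abs_smooth_le[OF e, of a] by (auto simp: max_def)
      qed
      then have "(\<integral>\<omega>. \<bar>?T n \<omega> - smooth \<Phi> e a\<bar> \<partial>M) \<le> ?B * trunc_mean M (\<lambda>\<omega>. ?T n \<omega> - smooth \<Phi> e a)"
        by (intro expectation_le_trunc_mean) auto
      then show ?case by simp
    qed
  qed
qed

text \<open>The cells of width \<open>k\<close> partition the line, so at most one indicator is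
  nonzero, and the bound on \<open>v\<close> places its index in the range.\<close>

lemma cell_sum:
  fixes y :: "int \<Rightarrow> real" and K :: nat
  assumes k: "0 < k" and "\<bar>v\<bar> < real K * k"
  shows "(\<Sum>j\<in>{- int K..<int K}. (if \<lfloor>v / k\<rfloor> = j then 1 else 0) * y j) = y \<lfloor>v / k\<rfloor>"
proof -
  have "- real K \<le> v / k" "v / k < real K"
    using assms by (auto simp: field_simps abs_less_iff)
  then have "\<lfloor>v / k\<rfloor> \<in> {- int K..<int K}"
    by (auto simp: le_floor_iff floor_less_iff)
  then show ?thesis
    by (subst sum.remove[of _ "\<lfloor>v / k\<rfloor>"]) (auto intro!: sum.neutral)
qed

text \<open>
  The \<open>G\<close>-measurable argument \<open>m n\<close> is discretised into finitely many cells of width \<open>k\<close>,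
  so that only deterministic shifts of \<open>P n\<close> have to be dealt with.
\<close>

lemma cond_exp_hat_tendsto:
  assumes e: "0 < e"
  shows "(\<lambda>n. \<integral>\<omega>. \<bar>real_cond_exp M G (\<lambda>\<omega>. hat e (P n \<omega> + m n \<omega>)) \<omega> - smooth \<Phi> e (m n \<omega>)\<bar> \<partial>M) \<longlonglongrightarrow> 0"
proof (rule LIMSEQ_I)
  fix r :: real assume r: "0 < r"
  \<comment> \<open>The functions to be discretised have Lipschitz constant
    \<open>1 / e\<^sup>2\<close>, so moving within a cell of this width costs at most
    \<open>r / 8\<close>.\<close>
  define k where "k = e\<^sup>2 * r / 8"
  have k: "0 < k" "1 / e\<^sup>2 * k = r / 8"
    using e r by (auto simp: k_def)
  \<comment> \<open>Far out only the trivial bound \<open>1 / e\<close> is available; with this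
    probability the far region contributes less than \<open>r / 8\<close>.\<close>
  obtain A where A: "\<forall>\<^sub>F n in sequentially. measure M {\<omega> \<in> space M. A \<le> \<bar>m n \<omega>\<bar>} < e * r / 8"
    using tight[of "e * r / 8"] e r by auto
  obtain K :: nat where K: "A / k < real K"
    using reals_Archimedean2 by blast
  let ?J = "{- int K..<int K}"
  define T where "T n j = real_cond_exp M G (\<lambda>\<omega>. hat e (P n \<omega> + k * of_int j))" for n j
  have "(\<lambda>n. \<Sum>j\<in>?J. \<integral>\<omega>. \<bar>T n j \<omega> - smooth \<Phi> e (k * of_int j)\<bar> \<partial>M) \<longlonglongrightarrow> (\<Sum>j\<in>?J. 0)"
    unfolding T_def by (intro tendsto_sum cond_exp_hat_shift_tendsto e)
  then have "\<forall>\<^sub>F n in sequentially. (\<Sum>j\<in>?J. \<integral>\<omega>. \<bar>T n j \<omega> - smooth \<Phi> e (k * of_int j)\<bar> \<partial>M) < r / 4"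
    using r by (intro order_tendstoD(2)[of _ 0]) auto
  then have "\<forall>\<^sub>F n in sequentially.
      norm ((\<integral>\<omega>. \<bar>real_cond_exp M G (\<lambda>\<omega>. hat e (P n \<omega> + m n \<omega>)) \<omega> - smooth \<Phi> e (m n \<omega>)\<bar> \<partial>M) - 0) < r"
    using A eventually_ge_at_top[of 1]
  proof eventually_elim
    case (elim n)
    note [measurable] = P[OF elim(3)] m[OF elim(3)]
    have [measurable]: "m n \<in> borel_measurable M"
      by (rule measurable_from_subalg[OF G]) simp
    have [measurable]: "smooth \<Phi> e \<in> borel_measurable borel"
      by (intro borel_measurable_continuous_onI lipschitz_on_continuous_on[OF smooth_lipschitz[OF e]])
    define I where "I j \<omega> = (if \<lfloor>m n \<omega> / k\<rfloor> = j then 1 else 0 :: real)" for j :: int and \<omega>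
    have [measurable]: "I j \<in> borel_measurable G" for j
      unfolding I_def by measurable
    have [measurable]: "I j \<in> borel_measurable M" for j
      by (rule measurable_from_subalg[OF G]) simp
    have I01: "0 \<le> I j \<omega>" "I j \<omega> \<le> 1" for j \<omega>
      by (auto simp: I_def)
    define h where "h j \<omega> = hat e (P n \<omega> + k * of_int j)" for j \<omega>
    have [measurable]: "h j \<in> borel_measurable M" for j
      unfolding h_def by measurable
    have ih: "integrable M (h j)" for j
      unfolding h_def using e by (intro integrable_hat) auto
    have iIh: "integrable M (\<lambda>\<omega>. I j \<omega> * h j \<omega>)" for j
    proof (rule Bochner_Integration.integrable_bound[OF ih[of j]])
      show "AE \<omega> in M. norm (I j \<omega> * h j \<omega>) \<le> norm (h j \<omega>)"
        using I01[of j] by (intro AE_I2) (auto simp: abs_mult intro!: mult_left_le_one_le)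
    qed simp
    have iT: "integrable M (T n j)" for j
      using real_cond_exp_int(1)[OF ih[of j]] by (simp add: T_def h_def[abs_def])
    define U where "U \<omega> = (\<Sum>j\<in>?J. I j \<omega> * h j \<omega>)" for \<omega>
    have iU: "integrable M U"
      unfolding U_def using iIh by auto
    define S where "S = {\<omega> \<in> space M. A \<le> \<bar>m n \<omega>\<bar>}"
    have [measurable]: "S \<in> sets M"
      unfolding S_def by measurable
    define err where "err \<omega> = r / 8 + 1 / e * indicator S \<omega>" for \<omega>
    have ierr: "integrable M err"
      unfolding err_def by (intro Bochner_Integration.integrable_add integrable_mult_right)
        (auto simp: less_top[symmetric])
    have Eerr: "(\<integral>\<omega>. err \<omega> \<partial>M) < r / 4"
    proof -
      have "(\<integral>\<omega>. err \<omega> \<partial>M) = r / 8 + 1 / e * measure M S"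
        unfolding err_def by (subst Bochner_Integration.integral_add) (auto simp: less_top[symmetric] prob_space)
      moreover have "1 / e * measure M S < r / 8"
        using elim(2) e by (simp add: S_def field_simps)
      ultimately show ?thesis
        by linarith
    qed
    \<comment> \<open>This is applied twice: to \<open>smooth \<Phi> e\<close>, and for each fixed
      \<omega> to the translate of \<open>hat e\<close> by \<open>P n \<omega>\<close>.\<close>
    have disc: "\<bar>f (m n \<omega>) - (\<Sum>j\<in>?J. I j \<omega> * f (k * of_int j))\<bar> \<le> err \<omega>"
      if \<omega>: "\<omega> \<in> space M" and lip: "(1 / e\<^sup>2)-lipschitz_on UNIV f" and f: "\<And>x. \<bar>f x\<bar> \<le> 1 / e" for f \<omega>
    proof (cases "\<bar>m n \<omega>\<bar> < real K * k")
      case True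
      let ?j = "\<lfloor>m n \<omega> / k\<rfloor>"
      have "of_int ?j * k \<le> m n \<omega>" "m n \<omega> < (of_int ?j + 1) * k"
        by (rule floor_divide_lower[OF k(1)], rule floor_divide_upper[OF k(1)])
      then have "\<bar>m n \<omega> - k * of_int ?j\<bar> \<le> k"
        using k(1) by (simp add: algebra_simps)
      then have "1 / e\<^sup>2 * \<bar>m n \<omega> - k * of_int ?j\<bar> \<le> r / 8"
        unfolding k(2)[symmetric] by (intro mult_left_mono) auto
      then have "\<bar>f (m n \<omega>) - f (k * of_int ?j)\<bar> \<le> r / 8"
        using lipschitz_onD[OF lip, of "m n \<omega>" "k * of_int ?j", OF UNIV_I UNIV_I]
        unfolding dist_real_def by linarith
      moreover have "r / 8 \<le> err \<omega>"
        using e by (simp add: err_def)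
      ultimately show ?thesis
        using cell_sum[OF k(1) True, of "\<lambda>j. f (k * of_int j)"] by (simp add: I_def)
    next
      case False
      \<comment> \<open>Outside the open range only the left endpoint still belongs to a cell. It is
        a grid point, so there the discretised value is exact; elsewhere it is 0, and the bound
        \<open>1 / e\<close> on \<open>S\<close> covers the error.\<close>
      have "\<lfloor>m n \<omega> / k\<rfloor> = j \<Longrightarrow> j \<in> ?J \<Longrightarrow> m n \<omega> = - (real K * k)" for j
        using False k(1) floor_less_iff[of "m n \<omega> / k" "int K"] le_floor_iff[of "- int K" "m n \<omega> / k"]
        by (auto simp: field_simps not_less)
      then have Ij: "(\<Sum>j\<in>?J. I j \<omega> * f (k * of_int j)) = 0
          \<or> (\<Sum>j\<in>?J. I j \<omega> * f (k * of_int j)) = f (m n \<omega>)"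
        using k(1) by (auto simp: mult.commute[of k "real K"] I_def sum.delta' if_distrib[of "\<lambda>x. x * _"] cong: if_cong)
      moreover have "A < real K * k"
        using K k(1) by (simp add: field_simps)
      then have "\<omega> \<in> S"
        using False \<omega> by (simp add: S_def)
      ultimately show ?thesis
        using f[of "m n \<omega>"] e r by (auto simp: err_def)
    qed
    have lip_shift: "(1 / e\<^sup>2)-lipschitz_on UNIV (\<lambda>x. hat e (p + x))" for p
      using lipschitz_onD[OF hat_lipschitz[OF e]] by (intro lipschitz_onI) (auto, metis dist_add_cancel)
    define V where "V \<omega> = hat e (P n \<omega> + m n \<omega>) - U \<omega>" for \<omega>
    have iV: "integrable M V"
      unfolding V_def using iU e by (intro Bochner_Integration.integrable_diff integrable_hat) auto
    have EV: "(\<integral>\<omega>. \<bar>V \<omega>\<bar> \<partial>M) \<le> (\<integral>\<omega>. err \<omega> \<partial>M)"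
    proof (rule integral_mono[OF integrable_abs[OF iV] ierr])
      show "\<bar>V \<omega>\<bar> \<le> err \<omega>" if "\<omega> \<in> space M" for \<omega>
        using disc[OF that lip_shift abs_hat_le[OF e]] by (simp add: V_def U_def h_def)
    qed
    \<comment> \<open>The cell indicators are \<open>G\<close>-measurable and can be pulled out,
      leaving conditional means at the deterministic shifts \<open>k * of_int j\<close>.\<close>
    have "AE \<omega> in M. real_cond_exp M G (\<lambda>\<omega>. I j \<omega> * h j \<omega>) \<omega> = I j \<omega> * T n j \<omega>" for j
      unfolding T_def h_def[symmetric] using iIh by (intro real_cond_exp_mult) (auto simp: h_def[abs_def, symmetric])
    then have "AE \<omega> in M. \<forall>j\<in>?J. real_cond_exp M G (\<lambda>\<omega>. I j \<omega> * h j \<omega>) \<omega> = I j \<omega> * T n j \<omega>"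
      by (intro AE_finite_allI) auto
    moreover have "AE \<omega> in M. real_cond_exp M G U \<omega> = (\<Sum>j\<in>?J. real_cond_exp M G (\<lambda>\<omega>. I j \<omega> * h j \<omega>) \<omega>)"
      unfolding U_def using iIh by (intro real_cond_exp_sum) auto
    moreover have "AE \<omega> in M. real_cond_exp M G V \<omega>
        = real_cond_exp M G (\<lambda>\<omega>. hat e (P n \<omega> + m n \<omega>)) \<omega> - real_cond_exp M G U \<omega>"
      unfolding V_def using iU e by (intro real_cond_exp_diff integrable_hat) auto
    ultimately have "AE \<omega> in M. \<bar>real_cond_exp M G (\<lambda>\<omega>. hat e (P n \<omega> + m n \<omega>)) \<omega> - smooth \<Phi> e (m n \<omega>)\<bar>
        \<le> \<bar>real_cond_exp M G V \<omega>\<bar> + (\<Sum>j\<in>?J. \<bar>T n j \<omega> - smooth \<Phi> e (k * of_int j)\<bar>) + err \<omega>"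
      using AE_space
    proof eventually_elim
      case (elim \<omega>)
      have "\<bar>(\<Sum>j\<in>?J. I j \<omega> * T n j \<omega>) - (\<Sum>j\<in>?J. I j \<omega> * smooth \<Phi> e (k * of_int j))\<bar>
          \<le> (\<Sum>j\<in>?J. \<bar>I j \<omega> * T n j \<omega> - I j \<omega> * smooth \<Phi> e (k * of_int j)\<bar>)"
        unfolding sum_subtractf[symmetric] by (rule sum_abs)
      also have "\<dots> \<le> (\<Sum>j\<in>?J. \<bar>T n j \<omega> - smooth \<Phi> e (k * of_int j)\<bar>)"
        unfolding right_diff_distrib[symmetric] abs_mult
        by (intro sum_mono) (auto simp: I_def)
      finally have "\<bar>(\<Sum>j\<in>?J. I j \<omega> * T n j \<omega>) - (\<Sum>j\<in>?J. I j \<omega> * smooth \<Phi> e (k * of_int j))\<bar>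
          \<le> (\<Sum>j\<in>?J. \<bar>T n j \<omega> - smooth \<Phi> e (k * of_int j)\<bar>)" .
      moreover have "real_cond_exp M G (\<lambda>\<omega>. hat e (P n \<omega> + m n \<omega>)) \<omega>
          = real_cond_exp M G V \<omega> + (\<Sum>j\<in>?J. I j \<omega> * T n j \<omega>)"
        using elim(1-3) by simp
      ultimately show ?case
        using disc[OF elim(4) smooth_lipschitz[OF e] abs_smooth_le[OF e]] by linarith
    qed
    then have "(\<integral>\<omega>. \<bar>real_cond_exp M G (\<lambda>\<omega>. hat e (P n \<omega> + m n \<omega>)) \<omega> - smooth \<Phi> e (m n \<omega>)\<bar> \<partial>M)
        \<le> (\<integral>\<omega>. \<bar>real_cond_exp M G V \<omega>\<bar> + (\<Sum>j\<in>?J. \<bar>T n j \<omega> - smooth \<Phi> e (k * of_int j)\<bar>) + err \<omega> \<partial>M)"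
    proof (rule integral_mono_AE[rotated -1])
      have ic: "integrable M (real_cond_exp M G (\<lambda>\<omega>. hat e (P n \<omega> + m n \<omega>)))"
        using e by (intro real_cond_exp_int integrable_hat) auto
      moreover have "integrable M (\<lambda>\<omega>. smooth \<Phi> e (m n \<omega>))"
        by (rule integrable_const_bound[of _ "1 / e"]) (use abs_smooth_le[OF e] in auto)
      ultimately show "integrable M (\<lambda>\<omega>. \<bar>real_cond_exp M G (\<lambda>\<omega>. hat e (P n \<omega> + m n \<omega>)) \<omega> - smooth \<Phi> e (m n \<omega>)\<bar>)"
        by auto
      show "integrable M (\<lambda>\<omega>. \<bar>real_cond_exp M G V \<omega>\<bar> + (\<Sum>j\<in>?J. \<bar>T n j \<omega> - smooth \<Phi> e (k * of_int j)\<bar>) + err \<omega>)"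
        using ierr real_cond_exp_int(1)[OF iV] iT by auto
    qed
    also have "\<dots> = (\<integral>\<omega>. \<bar>real_cond_exp M G V \<omega>\<bar> \<partial>M)
        + (\<Sum>j\<in>?J. \<integral>\<omega>. \<bar>T n j \<omega> - smooth \<Phi> e (k * of_int j)\<bar> \<partial>M) + (\<integral>\<omega>. err \<omega> \<partial>M)"
      using ierr real_cond_exp_int(1)[OF iV] iT
      by (simp add: Bochner_Integration.integral_add Bochner_Integration.integral_sum)
    \<comment> \<open>Discretising \<open>hat e\<close> and discretising
      \<open>smooth \<Phi> e\<close> each cost less than \<open>r / 4\<close>, and so do the
      finitely many shifts together.\<close>
    also have "\<dots> < r"
      using expectation_abs_cond_exp_le[OF iV] EV Eerr elim(1) r by linarith
    finally show ?case by simp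
  qed
  then show "\<exists>no. \<forall>n\<ge>no. norm ((\<integral>\<omega>. \<bar>real_cond_exp M G (\<lambda>\<omega>. hat e (P n \<omega> + m n \<omega>)) \<omega> - smooth \<Phi> e (m n \<omega>)\<bar> \<partial>M) - 0) < r"
    by (simp add: eventually_sequentially)
qed

text \<open>Conditional expectation contracts the mean absolute value, so an error of
  \<open>Y\<close> that vanishes in probability passes through the bounded Lipschitz function
  \<open>hat e\<close>. This absorbs the remainder and the change of time in the component known at
  time 0.\<close>

lemma cond_exp_hat_perturbed_tendsto:
  assumes e: "0 < e" and Y: "\<And>n. 1 \<le> n \<Longrightarrow> Y n \<in> borel_measurable M"
    and lim: "(\<lambda>n. trunc_mean M (\<lambda>\<omega>. Y n \<omega> - (P n \<omega> + m n \<omega>))) \<longlonglongrightarrow> 0"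
  shows "(\<lambda>n. \<integral>\<omega>. \<bar>real_cond_exp M G (\<lambda>\<omega>. hat e (Y n \<omega>)) \<omega> - smooth \<Phi> e (m n \<omega>)\<bar> \<partial>M) \<longlonglongrightarrow> 0"
proof (rule Lim_null_comparison)
  let ?c = "1 / e\<^sup>2 + 2 * (1 / e)"
  let ?E = "\<lambda>n. \<integral>\<omega>. \<bar>real_cond_exp M G (\<lambda>\<omega>. hat e (P n \<omega> + m n \<omega>)) \<omega> - smooth \<Phi> e (m n \<omega>)\<bar> \<partial>M"
  show "(\<lambda>n. ?c * trunc_mean M (\<lambda>\<omega>. Y n \<omega> - (P n \<omega> + m n \<omega>)) + ?E n) \<longlonglongrightarrow> 0"
    using tendsto_add[OF tendsto_mult_right_zero[OF lim] cond_exp_hat_tendsto[OF e]] by simp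
  show "\<forall>\<^sub>F n in sequentially.
      norm (\<integral>\<omega>. \<bar>real_cond_exp M G (\<lambda>\<omega>. hat e (Y n \<omega>)) \<omega> - smooth \<Phi> e (m n \<omega>)\<bar> \<partial>M)
      \<le> ?c * trunc_mean M (\<lambda>\<omega>. Y n \<omega> - (P n \<omega> + m n \<omega>)) + ?E n"
    using eventually_ge_at_top[of 1]
  proof eventually_elim
    case (elim n)
    note [measurable] = P[OF elim] Y[OF elim]
    have [measurable]: "m n \<in> borel_measurable M"
      by (rule measurable_from_subalg[OF G m[OF elim]])
    have [measurable]: "smooth \<Phi> e \<in> borel_measurable borel"
      by (intro borel_measurable_continuous_onI lipschitz_on_continuous_on[OF smooth_lipschitz[OF e]])
    have i: "integrable M (\<lambda>\<omega>. hat e (Y n \<omega>))" "integrable M (\<lambda>\<omega>. hat e (P n \<omega> + m n \<omega>))"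
      using e by (auto intro!: integrable_hat)
    have ism: "integrable M (\<lambda>\<omega>. smooth \<Phi> e (m n \<omega>))"
      by (rule integrable_const_bound[of _ "1 / e"]) (use abs_smooth_le[OF e] in auto)
    let ?V = "\<lambda>\<omega>. hat e (Y n \<omega>) - hat e (P n \<omega> + m n \<omega>)"
    have iV: "integrable M ?V"
      using i by simp
    have "AE \<omega> in M. real_cond_exp M G ?V \<omega> = real_cond_exp M G (\<lambda>\<omega>. hat e (Y n \<omega>)) \<omega>
        - real_cond_exp M G (\<lambda>\<omega>. hat e (P n \<omega> + m n \<omega>)) \<omega>"
      by (rule real_cond_exp_diff[OF i])
    then have "AE \<omega> in M. \<bar>real_cond_exp M G (\<lambda>\<omega>. hat e (Y n \<omega>)) \<omega> - smooth \<Phi> e (m n \<omega>)\<bar>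
        \<le> \<bar>real_cond_exp M G ?V \<omega>\<bar> + \<bar>real_cond_exp M G (\<lambda>\<omega>. hat e (P n \<omega> + m n \<omega>)) \<omega> - smooth \<Phi> e (m n \<omega>)\<bar>"
      by eventually_elim linarith
    then have "(\<integral>\<omega>. \<bar>real_cond_exp M G (\<lambda>\<omega>. hat e (Y n \<omega>)) \<omega> - smooth \<Phi> e (m n \<omega>)\<bar> \<partial>M)
        \<le> (\<integral>\<omega>. \<bar>real_cond_exp M G ?V \<omega>\<bar> + \<bar>real_cond_exp M G (\<lambda>\<omega>. hat e (P n \<omega> + m n \<omega>)) \<omega> - smooth \<Phi> e (m n \<omega>)\<bar> \<partial>M)"
      using real_cond_exp_int(1)[OF i(1)] real_cond_exp_int(1)[OF i(2)] real_cond_exp_int(1)[OF iV] ism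
      by (intro integral_mono_AE) auto
    also have "\<dots> = (\<integral>\<omega>. \<bar>real_cond_exp M G ?V \<omega>\<bar> \<partial>M) + ?E n"
      using real_cond_exp_int(1)[OF i(2)] real_cond_exp_int(1)[OF iV] ism
      by (intro Bochner_Integration.integral_add) auto
    also have "(\<integral>\<omega>. \<bar>real_cond_exp M G ?V \<omega>\<bar> \<partial>M) \<le> (\<integral>\<omega>. \<bar>?V \<omega>\<bar> \<partial>M)"
      by (rule expectation_abs_cond_exp_le[OF iV])
    also have "\<dots> \<le> ?c * trunc_mean M (\<lambda>\<omega>. Y n \<omega> - (P n \<omega> + m n \<omega>))"
      by (rule expectation_lipschitz_diff(2)[OF _ _ hat_lipschitz[OF e] abs_hat_le[OF e]]) auto
    finally show ?case by simp
  qed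
qed

end

section \<open>Arrays with conditional densities\<close>

text \<open>Takes the role of the Cauchy-Schwarz inequality: a second moment of at most
  \<open>d\<^sup>2\<close> gives a mean absolute value of at most \<open>2 * d\<close>.\<close>

lemma abs_le_square_div:
  fixes z d :: real
  assumes "0 < d"
  shows "\<bar>z\<bar> \<le> d + z\<^sup>2 / d"
proof -
  have "0 \<le> (\<bar>z\<bar> - d)\<^sup>2"
    by simp
  also have "(\<bar>z\<bar> - d)\<^sup>2 = z\<^sup>2 + d\<^sup>2 - 2 * (\<bar>z\<bar> * d)"
    by (simp add: power2_diff)
  finally have "\<bar>z\<bar> * d \<le> d\<^sup>2 + z\<^sup>2"
    using mult_nonneg_nonneg[of "\<bar>z\<bar>" d] assms by linarith
  then show ?thesis
    using assms by (simp add: field_simps power2_eq_square)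
qed

locale density_array = prob_space M for M :: "'a measure" +
  fixes F :: "int \<Rightarrow> 'a measure" and X :: "nat \<Rightarrow> nat \<Rightarrow> 'a \<Rightarrow> real" and \<beta> bw :: "nat \<Rightarrow> real"
    and D :: "nat \<Rightarrow> nat \<Rightarrow> nat \<Rightarrow> 'a \<Rightarrow> real \<Rightarrow> real" and t0 :: nat
  assumes HL0: "HL0 M F X \<beta>" and HL6: "HL6 \<beta> t0" and HL7: "HL7 M F X \<beta> D t0"
    and HL8: "HL8 M D" and HL9: "HL9 \<beta> t0"
    and bw_pos: "\<And>n. 1 \<le> n \<Longrightarrow> 0 < bw n"
    and bw_lim: "(\<lambda>n. bw n / \<beta> n + \<beta> n / (real n * bw n)) \<longlonglongrightarrow> 0"
begin

lemma subalg: "subalgebra M (F t)"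
  using HL0 by (simp add: HL0_def)

lemma \<beta>_pos: "1 \<le> n \<Longrightarrow> 0 < \<beta> n"
  using HL0 by (simp add: HL0_def)

lemma t0_ge_1: "1 \<le> t0"
  using HL7 by (simp add: HL7_def)

lemma \<beta>_at_top: "filterlim \<beta> at_top sequentially"
  using HL0 by (simp add: HL0_def)

lemma inverse_\<beta>_tendsto: "(\<lambda>n. 1 / \<beta> n) \<longlonglongrightarrow> 0"
  using tendsto_inverse_0_at_top[OF \<beta>_at_top] by (simp add: inverse_eq_divide)

lemma bw_over_\<beta>_tendsto: "(\<lambda>n. bw n / \<beta> n) \<longlonglongrightarrow> 0"
  and \<beta>_over_bw_tendsto: "(\<lambda>n. \<beta> n / (real n * bw n)) \<longlonglongrightarrow> 0"
proof -
  have "0 \<le> bw n / \<beta> n" "0 \<le> \<beta> n / (real n * bw n)" if "1 \<le> n" for n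
    using bw_pos[OF that] \<beta>_pos[OF that] by auto
  then have "norm (bw n / \<beta> n) \<le> bw n / \<beta> n + \<beta> n / (real n * bw n)"
    "norm (\<beta> n / (real n * bw n)) \<le> bw n / \<beta> n + \<beta> n / (real n * bw n)" if "1 \<le> n" for n
    unfolding real_norm_def using that by (smt (verit))+
  then show "(\<lambda>n. bw n / \<beta> n) \<longlonglongrightarrow> 0" "(\<lambda>n. \<beta> n / (real n * bw n)) \<longlonglongrightarrow> 0"
    by (auto intro!: Lim_null_comparison[OF _ bw_lim] eventually_sequentiallyI[of 1])
qed

lemma X_measurable_F: "1 \<le> n \<Longrightarrow> t \<le> n \<Longrightarrow> X n t \<in> borel_measurable (F (int t))"
proof (cases "t = 0")
  case True
  assume n: "1 \<le> n"
  have "X n 0 \<in> borel_measurable (F 0) \<longleftrightarrow> (\<lambda>\<omega>. 0 :: real) \<in> borel_measurable (F 0)"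
    using HL7 n subalg[of 0] by (intro measurable_cong) (simp add: HL7_def subalgebra_def)
  then show ?thesis using True by simp
next
  case False
  assume "1 \<le> n" "t \<le> n"
  then show ?thesis using HL0 False by (auto simp: HL0_def)
qed

lemma X_measurable: "1 \<le> n \<Longrightarrow> t \<le> n \<Longrightarrow> X n t \<in> borel_measurable M"
  using measurable_from_subalg[OF subalg X_measurable_F] .

lemma increment:
  assumes "1 \<le> n" "s < t" "t \<le> n"
  shows "cond_density_increment M (F (int s)) (X n s) (X n t) (\<beta> (t - s)) (\<beta> n) (D n s t)"
proof
  show "subalgebra M (F (int s))" by (rule subalg)
  show "X n s \<in> borel_measurable (F (int s))" "X n t \<in> borel_measurable M"
    using assms X_measurable_F X_measurable by auto
  show "0 < \<beta> (t - s)" "0 < \<beta> n"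
    using assms \<beta>_pos by auto
  show "has_cond_density M (F (int s)) (\<lambda>\<omega>. (X n t \<omega> - X n s \<omega>) / \<beta> (t - s)) (D n s t)"
    using HL7 assms by (auto simp: HL7_def)
qed

lemma X_0: "1 \<le> n \<Longrightarrow> \<omega> \<in> space M \<Longrightarrow> X n 0 \<omega> = 0"
  using HL7 by (auto simp: HL7_def)

text \<open>Because \<open>X n 0\<close> is 0, the position itself is an increment from time 0 and
  has a density after rescaling; null sets stay null under affine maps.\<close>

lemma AE_X_notin:
  assumes "N \<in> null_sets lborel" "1 \<le> t" "t \<le> n"
  shows "AE \<omega> in M. (X n t \<omega> - x) / bw n \<notin> N"
proof -
  have n: "1 \<le> n" using assms by simp
  interpret cond_density_increment M "F (int 0)" "X n 0" "X n t" "\<beta> (t - 0)" "\<beta> n" "D n 0 t"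
    using increment[of n 0 t] assms n by simp
  have \<beta>t: "0 < \<beta> t" and bw: "0 < bw n"
    using \<beta>_pos bw_pos assms n by auto
  let ?N = "{u \<in> space lborel. - x / bw n + \<beta> t / bw n * u \<in> N}"
  have [measurable]: "N \<in> sets borel"
    using assms by auto
  have "AE u in lborel. - x / bw n + \<beta> t / bw n * u \<notin> N"
    using AE_not_in[OF assms(1)] \<beta>t bw by (intro AE_borel_affine) auto
  then have "?N \<in> null_sets lborel"
    by (subst (asm) AE_iff_null_sets[symmetric, where N = ?N, simplified] | simp add: AE_iff_null)+
  from AE_increment[OF this] show ?thesis
    using AE_space
  proof eventually_elim
    case (elim \<omega>)
    have "- x / bw n + \<beta> t / bw n * (X n t \<omega> / \<beta> t) = (X n t \<omega> - x) / bw n"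
      using \<beta>t bw by (simp add: field_simps)
    then show ?case
      using elim X_0[OF n] \<beta>t by simp
  qed
qed

text \<open>\<open>C\<close> is normalised to be at least 1 so that it can also be inserted into
  estimates which do not contain it.\<close>

definition dens_bound :: "real \<Rightarrow> nat \<Rightarrow> bool" where
  "dens_bound C n0 \<longleftrightarrow> 1 \<le> C \<and> 1 \<le> n0 \<and>
    (\<forall>n s t. \<forall>\<omega>\<in>space M. \<forall>u. n0 \<le> n \<and> s < t \<and> t \<le> n \<and> t0 \<le> t - s \<longrightarrow> D n s t \<omega> u \<le> C)"

lemma dens_bound_exists: obtains C n0 where "dens_bound C n0"
proof -
  from HL7 obtain n0 where n0: "n0 \<ge> 1" and bd: "bdd_above {D n s t \<omega> x | n s t \<omega> x.
        n \<ge> n0 \<and> s < t \<and> t \<le> n \<and> t - s \<ge> t0 \<and> \<omega> \<in> space M}"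
    by (auto simp: HL7_def)
  then obtain C where C: "\<And>z. z \<in> {D n s t \<omega> x | n s t \<omega> x.
        n \<ge> n0 \<and> s < t \<and> t \<le> n \<and> t - s \<ge> t0 \<and> \<omega> \<in> space M} \<Longrightarrow> z \<le> C"
    by (auto simp: bdd_above_def)
  have "dens_bound (max 1 C) n0"
    unfolding dens_bound_def using n0 C by (fastforce simp: le_max_iff_disj)
  then show ?thesis by (rule that)
qed

lemma expectation_le_bounded:
  assumes "dens_bound C n0" "n0 \<le> n" "t0 \<le> t" "t \<le> n"
    and g: "g \<in> borel_measurable borel" and gB: "\<And>v. \<bar>g v\<bar> \<le> B" and gi: "integrable lborel g"
  shows "(\<integral>\<omega>. \<bar>g (X n t \<omega> / \<beta> n)\<bar> \<partial>M) \<le> C * (\<beta> n / \<beta> t) * (\<integral>u. \<bar>g u\<bar> \<partial>lborel)"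
proof -
  have n: "1 \<le> n" "0 < t" using assms t0_ge_1 by (auto simp: dens_bound_def)
  interpret cond_density_increment M "F (int 0)" "X n 0" "X n t" "\<beta> (t - 0)" "\<beta> n" "D n 0 t"
    using increment[of n 0 t] assms n by simp
  show ?thesis
    using expectation_mult_increment_le[OF g gB gi, of "\<lambda>_. 1" 1 C] assms n
    by (simp add: dens_bound_def prob_space)
qed

text \<open>The difference of a kernel and its truncation may be unbounded. The truncations
  \<open>min \<bar>g\<bar> k\<close> increase to \<open>\<bar>g\<bar>\<close> with uniformly bounded
  means, so monotone convergence gives integrability together with the bound.\<close>

lemma expectation_le:
  assumes db: "dens_bound C n0" and nt: "n0 \<le> n" "t0 \<le> t" "t \<le> n"
    and gi: "integrable lborel g"
  shows "integrable M (\<lambda>\<omega>. g (X n t \<omega> / \<beta> n))"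
    and "(\<integral>\<omega>. \<bar>g (X n t \<omega> / \<beta> n)\<bar> \<partial>M) \<le> C * (\<beta> n / \<beta> t) * (\<integral>u. \<bar>g u\<bar> \<partial>lborel)"
proof -
  have n: "1 \<le> n" "1 \<le> t" using assms t0_ge_1 by (auto simp: dens_bound_def)
  have [measurable]: "g \<in> borel_measurable borel" "X n t \<in> borel_measurable M"
    using borel_measurable_integrable[OF gi] X_measurable n nt by auto
  have C: "0 \<le> C * (\<beta> n / \<beta> t)"
    using db \<beta>_pos n by (auto simp: dens_bound_def less_imp_le)
  let ?c = "C * (\<beta> n / \<beta> t) * (\<integral>u. \<bar>g u\<bar> \<partial>lborel)"
  define f where "f k v = min \<bar>g v\<bar> (real k)" for k v
  have [measurable]: "f k \<in> borel_measurable borel" for k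
    unfolding f_def by measurable
  have fi: "integrable lborel (f k)" for k
    by (rule Bochner_Integration.integrable_bound[OF gi]) (auto simp: f_def)
  have f0: "\<bar>f k v\<bar> = f k v" for k v
    by (simp add: f_def)
  have iM: "integrable M (\<lambda>\<omega>. f k (X n t \<omega> / \<beta> n))" for k
    by (rule integrable_const_bound[of _ "real k"]) (auto simp: f_def)
  have le: "(\<integral>\<omega>. f k (X n t \<omega> / \<beta> n) \<partial>M) \<le> ?c" for k
  proof -
    have "(\<integral>\<omega>. f k (X n t \<omega> / \<beta> n) \<partial>M) = (\<integral>\<omega>. \<bar>f k (X n t \<omega> / \<beta> n)\<bar> \<partial>M)"
      by (simp add: f0)
    also have "\<dots> \<le> C * (\<beta> n / \<beta> t) * (\<integral>u. \<bar>f k u\<bar> \<partial>lborel)"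
      by (rule expectation_le_bounded[OF db nt _ _ fi, of _ "real k"]) (auto simp: f_def)
    also have "\<dots> \<le> ?c"
      using C fi gi by (intro mult_left_mono integral_mono) (auto simp: f0, simp add: f_def)
    finally show ?thesis .
  qed
  have inc: "incseq (\<lambda>k. \<integral>\<omega>. f k (X n t \<omega> / \<beta> n) \<partial>M)"
    by (intro incseq_SucI integral_mono iM) (auto simp: f_def)
  obtain l where l: "(\<lambda>k. \<integral>\<omega>. f k (X n t \<omega> / \<beta> n) \<partial>M) \<longlonglongrightarrow> l"
    using incseq_convergent[OF inc, of ?c] le by blast
  have "AE \<omega> in M. (\<lambda>k. f k (X n t \<omega> / \<beta> n)) \<longlonglongrightarrow> \<bar>g (X n t \<omega> / \<beta> n)\<bar>"
  proof (rule AE_I2)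
    fix \<omega>
    let ?v = "X n t \<omega> / \<beta> n"
    have "\<forall>\<^sub>F k in sequentially. f k ?v = \<bar>g ?v\<bar>"
      using eventually_ge_at_top[of "nat \<lceil>\<bar>g ?v\<bar>\<rceil>"]
      by eventually_elim (auto simp: f_def nat_le_iff ceiling_le_iff)
    then show "(\<lambda>k. f k ?v) \<longlonglongrightarrow> \<bar>g ?v\<bar>"
      by (rule tendsto_eventually)
  qed
  moreover have "AE \<omega> in M. mono (\<lambda>k. f k (X n t \<omega> / \<beta> n))"
    by (intro AE_I2) (auto simp: mono_def f_def)
  ultimately have "has_bochner_integral M (\<lambda>\<omega>. \<bar>g (X n t \<omega> / \<beta> n)\<bar>) l"
    using iM l by (intro has_bochner_integral_monotone_convergence) auto
  then have "integrable M (\<lambda>\<omega>. \<bar>g (X n t \<omega> / \<beta> n)\<bar>)" "(\<integral>\<omega>. \<bar>g (X n t \<omega> / \<beta> n)\<bar> \<partial>M) = l"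
    by (auto simp: has_bochner_integral_iff)
  moreover have "l \<le> ?c"
    using l le by (intro LIMSEQ_le_const2[OF l]) auto
  ultimately show "integrable M (\<lambda>\<omega>. g (X n t \<omega> / \<beta> n))"
    "(\<integral>\<omega>. \<bar>g (X n t \<omega> / \<beta> n)\<bar> \<partial>M) \<le> ?c"
    by (auto simp: integrable_abs_iff)
qed

lemma \<beta>_sum_bound_exists:
  obtains Cb where "0 \<le> Cb" "\<And>n. 1 \<le> n \<Longrightarrow> \<beta> n / real n * (\<Sum>t=t0..n. 1 / \<beta> t) \<le> Cb"
proof -
  from HL6 obtain Cb where Cb: "\<And>n. 1 \<le> n \<Longrightarrow> \<beta> n / real n * (\<Sum>t=t0..n. 1 / \<beta> t) \<le> Cb"
    by (auto simp: HL6_def bdd_above_def)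
  then have "\<And>n. 1 \<le> n \<Longrightarrow> \<beta> n / real n * (\<Sum>t=t0..n. 1 / \<beta> t) \<le> max 0 Cb"
    by (simp add: le_max_iff_disj)
  then show ?thesis
    using that[of "max 0 Cb"] by simp
qed

text \<open>Lags below \<open>t0\<close> have no density bound and cost \<open>B\<close> each, and
  there are only \<open>t0\<close> of them. The other lags are collected by \<open>A\<close>, which
  starts at 1 because \<open>\<beta>\<close> is positive there. \<open>Q\<close> selects all lags,
  the small ones or the large ones. The factor \<open>real n\<close> is pulled out to be cancelled
  by the averaging.\<close>

lemma lagged_sum_le:
  assumes n: "1 \<le> n" and q: "0 \<le> q" and B: "0 \<le> B"
    and A: "finite A" "{k. t0 \<le> k \<and> k \<le> n \<and> Q k} \<subseteq> A" "A \<subseteq> {1..}"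
  shows "(\<Sum>k=0..n. if Q k then (if t0 \<le> k then q * (\<beta> n / \<beta> k) else B) else 0)
    \<le> real n * (real t0 * B / real n + q * (\<beta> n / real n * (\<Sum>k\<in>A. 1 / \<beta> k)))"
proof -
  let ?p = "\<lambda>k. q * (\<beta> n / \<beta> k)"
  have p0: "0 \<le> ?p k" if "1 \<le> k" for k
    using that q \<beta>_pos[OF n] \<beta>_pos[OF that] by simp
  have "(\<Sum>k=0..n. if Q k then (if t0 \<le> k then ?p k else B) else 0)
      \<le> (\<Sum>k=0..n. (if k < t0 then B else 0) + (if t0 \<le> k \<and> Q k then ?p k else 0))"
    using B by (intro sum_mono) auto
  also have "\<dots> = (\<Sum>k=0..n. if k < t0 then B else 0) + (\<Sum>k=0..n. if t0 \<le> k \<and> Q k then ?p k else 0)"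
    by (rule sum.distrib)
  also have "(\<Sum>k=0..n. if k < t0 then B else 0) \<le> (\<Sum>k<t0. B)"
    unfolding sum.inter_filter[OF finite_atLeastAtMost, symmetric] using B by (intro sum_mono2) auto
  also have "(\<Sum>k=0..n. if t0 \<le> k \<and> Q k then ?p k else 0) \<le> (\<Sum>k\<in>A. ?p k)"
    unfolding sum.inter_filter[OF finite_atLeastAtMost, symmetric] using A p0 by (intro sum_mono2) auto
  also have "(\<Sum>k<t0. B) + (\<Sum>k\<in>A. ?p k) = real n * (real t0 * B / real n + q * (\<beta> n / real n * (\<Sum>k\<in>A. 1 / \<beta> k)))"
    using n by (simp add: sum_distrib_left sum_divide_distrib field_simps)
  finally show ?thesis by simp
qed

end

section \<open>The second moment of centred kernel sums\<close>

locale kernel_array = density_array +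
  fixes k :: "real \<Rightarrow> real" and x A Bk :: real
  assumes k_measurable [measurable]: "k \<in> borel_measurable borel"
    and k_bounded: "\<And>u. \<bar>k u\<bar> \<le> Bk" and k_support: "\<And>u. A < \<bar>u\<bar> \<Longrightarrow> k u = 0"
begin

lemma k_integrable: "integrable lborel k"
proof -
  have "integrable lborel (\<lambda>u. indicator {- \<bar>A\<bar>..\<bar>A\<bar>} u *\<^sub>R k u)"
    by (rule integrableI_bounded_set_indicator[of _ _ _ Bk])
       (use k_bounded in \<open>auto simp: emeasure_lborel_Icc_eq\<close>)
  moreover have "(\<lambda>u. indicator {- \<bar>A\<bar>..\<bar>A\<bar>} u *\<^sub>R k u) = k"
  proof
    show "indicator {- \<bar>A\<bar>..\<bar>A\<bar>} u *\<^sub>R k u = k u" for u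
      using k_support[of u] by (cases "A < \<bar>u\<bar>") (auto simp: indicator_def)
  qed
  ultimately show ?thesis by simp
qed

definition mass :: real where "mass = (\<integral>u. k u \<partial>lborel)"

definition mass_abs :: real where "mass_abs = (\<integral>u. \<bar>k u\<bar> \<partial>lborel)"

text \<open>The argument stands for \<open>X n t / \<beta> n\<close>, for which the kernel argument
  is \<open>(X n t - x) / bw n\<close>. The prefactor compensates the substitution, so the first
  term has Lebesgue integral \<open>mass\<close> like the second.\<close>

definition centred :: "nat \<Rightarrow> real \<Rightarrow> real \<Rightarrow> real" where
  "centred n e v = \<beta> n / bw n * k ((- x + \<beta> n * v) / bw n) - mass * hat e v"

lemma measurable_centred [measurable]: "centred n e \<in> borel_measurable borel"
  unfolding centred_def by measurable

definition centred_bound :: "nat \<Rightarrow> real \<Rightarrow> real" where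
  "centred_bound n e = \<beta> n / bw n * Bk + \<bar>mass\<bar> / e"

lemma centred_bound:
  assumes "1 \<le> n" "0 < e"
  shows "\<bar>centred n e v\<bar> \<le> centred_bound n e" "0 \<le> centred_bound n e"
proof -
  have "0 \<le> \<beta> n / bw n"
    using \<beta>_pos bw_pos assms by (simp add: less_imp_le)
  then have "\<bar>\<beta> n / bw n * k ((- x + \<beta> n * v) / bw n)\<bar> \<le> \<beta> n / bw n * Bk"
    unfolding abs_mult using k_bounded by (metis abs_of_nonneg mult_left_mono)
  moreover have "\<bar>mass * hat e v\<bar> \<le> \<bar>mass\<bar> / e"
    using mult_left_mono[OF abs_hat_le[OF assms(2)], of "\<bar>mass\<bar>" v] by (simp add: abs_mult)
  ultimately show "\<bar>centred n e v\<bar> \<le> centred_bound n e"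
    unfolding centred_def centred_bound_def by linarith
  then show "0 \<le> centred_bound n e" by linarith
qed

lemma centred_integral:
  assumes n: "1 \<le> n" and e: "0 < e"
  shows "integrable lborel (centred n e)" "(\<integral>v. centred n e v \<partial>lborel) = 0"
    "(\<integral>v. \<bar>centred n e v\<bar> \<partial>lborel) \<le> 2 * mass_abs"
proof -
  note pos = \<beta>_pos[OF n] bw_pos[OF n]
  have i: "integrable lborel (\<lambda>v. k ((- x + \<beta> n * v) / bw n))"
    by (rule lborel_integral_affine(2)[OF pos k_integrable])
  then show ic: "integrable lborel (centred n e)"
    unfolding centred_def using hat_integral(1)[OF e] by simp
  show "(\<integral>v. centred n e v \<partial>lborel) = 0"
    unfolding centred_def using i hat_integral[OF e] lborel_integral_affine(1)[OF pos, of k "- x"] pos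
    by (simp add: mass_def)
  have m: "\<bar>mass\<bar> \<le> mass_abs"
    unfolding mass_def mass_abs_def by (rule integral_abs_bound)
  have "(\<integral>v. \<bar>centred n e v\<bar> \<partial>lborel)
      \<le> (\<integral>v. \<beta> n / bw n * \<bar>k ((- x + \<beta> n * v) / bw n)\<bar> + \<bar>mass\<bar> * hat e v \<partial>lborel)"
  proof (rule integral_mono)
    show "\<bar>centred n e v\<bar> \<le> \<beta> n / bw n * \<bar>k ((- x + \<beta> n * v) / bw n)\<bar> + \<bar>mass\<bar> * hat e v" for v
      unfolding centred_def using hat_nonneg[OF e, of v] pos
      by (intro order_trans[OF abs_triangle_ineq4]) (simp add: abs_mult)
  qed (use ic i hat_integral(1)[OF e] in auto)
  also have "\<dots> = mass_abs + \<bar>mass\<bar>"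
    using i hat_integral[OF e] lborel_integral_affine(1)[OF pos, of "\<lambda>u. \<bar>k u\<bar>" "- x"] pos
    by (simp add: mass_abs_def)
  finally show "(\<integral>v. \<bar>centred n e v\<bar> \<partial>lborel) \<le> 2 * mass_abs"
    using m by linarith
qed

text \<open>On the scale \<open>\<beta> n\<close> the support of the kernel lies within
  \<open>(\<bar>A\<bar> * bw n + \<bar>x\<bar>) / \<beta> n\<close> of 0, which tends to 0; from
  then on the support of \<open>hat e\<close> is the larger one.\<close>

lemma centred_support:
  assumes e: "0 < e"
  shows "\<forall>\<^sub>F n in sequentially. \<forall>v. e < \<bar>v\<bar> \<longrightarrow> centred n e v = 0"
proof -
  have "(\<lambda>n. \<bar>A\<bar> * (bw n / \<beta> n) + \<bar>x\<bar> * (1 / \<beta> n)) \<longlonglongrightarrow> \<bar>A\<bar> * 0 + \<bar>x\<bar> * 0"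
    by (intro tendsto_intros bw_over_\<beta>_tendsto inverse_\<beta>_tendsto)
  then have "\<forall>\<^sub>F n in sequentially. \<bar>A\<bar> * (bw n / \<beta> n) + \<bar>x\<bar> * (1 / \<beta> n) < e"
    using e by (intro order_tendstoD) auto
  then show ?thesis
    using eventually_ge_at_top[of 1]
  proof eventually_elim
    case (elim n)
    note pos = \<beta>_pos[OF elim(2)] bw_pos[OF elim(2)]
    show ?case
    proof (intro allI impI)
      fix v assume v: "e < \<bar>v\<bar>"
      have "\<bar>A\<bar> * bw n + \<bar>x\<bar> < e * \<beta> n"
        using elim(1) pos by (simp add: field_simps)
      also have "\<dots> \<le> \<bar>v\<bar> * \<beta> n"
        using v pos by simp
      also have "\<dots> \<le> \<bar>- x + \<beta> n * v\<bar> + \<bar>x\<bar>"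
        using pos abs_triangle_ineq[of "- x + \<beta> n * v" x] by (simp add: abs_mult mult.commute)
      finally have "\<bar>A\<bar> < \<bar>(- x + \<beta> n * v) / bw n\<bar>"
        using pos by (simp add: field_simps)
      then have "k ((- x + \<beta> n * v) / bw n) = 0"
        by (intro k_support) linarith
      then show "centred n e v = 0"
        using hat_eq_0[OF e v] by (simp add: centred_def)
    qed
  qed
qed

text \<open>The sup norm is of order \<open>\<beta> n / bw n\<close> and may diverge, but condition
  (i) makes it small compared with \<open>n\<close>. Hence the boundedly many short lags are
  negligible.\<close>

lemma centred_bound_tendsto: "(\<lambda>n. real t0 * centred_bound n e / real n) \<longlonglongrightarrow> 0"
proof -
  have "(\<lambda>n. real t0 * (Bk * (\<beta> n / (real n * bw n)) + \<bar>mass\<bar> / e * (1 / real n))) \<longlonglongrightarrow> real t0 * (Bk * 0 + \<bar>mass\<bar> / e * 0)"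
    by (intro tendsto_intros \<beta>_over_bw_tendsto lim_1_over_n)
  moreover have "real t0 * (Bk * (\<beta> n / (real n * bw n)) + \<bar>mass\<bar> / e * (1 / real n)) = real t0 * centred_bound n e / real n" for n
    by (simp add: centred_bound_def field_simps add_divide_distrib)
  ultimately show ?thesis by simp
qed

text \<open>
  One row of the array, with \<open>b j\<close> dominating the conditional mean of \<open>\<bar>centred n e\<bar>\<close> at lag \<open>j\<close>.
\<close>

lemma second_moment_row:
  assumes db: "dens_bound C n0" and n: "n0 \<le> n" and e: "0 < e" and w: "0 \<le> w" and m: "t0 \<le> m"
    and supp: "\<And>v. e < \<bar>v\<bar> \<Longrightarrow> centred n e v = 0"
    and near: "\<And>s t \<omega> u. m \<le> s \<Longrightarrow> s \<le> m' \<Longrightarrow> m + s \<le> t \<Longrightarrow> t \<le> n \<Longrightarrow> \<omega> \<in> space M \<Longrightarrow>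
      \<bar>u\<bar> \<le> 2 * e * (\<beta> n / \<beta> (t - s)) \<Longrightarrow> \<bar>D n s t \<omega> u - D n s t \<omega> 0\<bar> \<le> w"
  defines "b j \<equiv> if t0 \<le> j then C * (2 * mass_abs) * (\<beta> n / \<beta> j) else centred_bound n e"
  assumes P: "(\<Sum>j=0..n. b j) \<le> P"
    and S1: "(\<Sum>j=0..n. if j < m then b j else 0) \<le> S1"
    and S2: "(\<Sum>j=0..n. if m' < j then b j else 0) \<le> S2"
  shows "(\<integral>\<omega>. (\<Sum>t=1..n. centred n e (X n t \<omega> / \<beta> n))\<^sup>2 \<partial>M) \<le> 2 * (P * (2 * S1 + S2 + w * P))"
proof -
  have n1: "1 \<le> n" and C: "1 \<le> C"
    using db n by (auto simp: dens_bound_def)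
  let ?g = "centred n e" and ?B = "centred_bound n e"
  note gB = centred_bound[OF n1 e] and gi = centred_integral[OF n1 e]
  have ma: "0 \<le> mass_abs"
    unfolding mass_abs_def by simp
  have b0: "0 \<le> b j" for j
    using ma C gB(2) \<beta>_pos[OF n1] \<beta>_pos[of j] t0_ge_1 by (auto simp: b_def less_imp_le)
  have [measurable]: "X n t \<in> borel_measurable M" if "t \<in> {1..n}" for t
    using X_measurable that by simp
  let ?Y = "\<lambda>t \<omega>. ?g (X n t \<omega> / \<beta> n)"
  have iY: "integrable M (?Y t)" if "t \<in> {1..n}" for t
    using that by (intro integrable_const_bound[of _ ?B]) (use gB in auto)
  have iYY: "integrable M (\<lambda>\<omega>. ?Y s \<omega> * ?Y t \<omega>)" if "s \<in> {1..n}" "t \<in> {1..n}" for s t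
    using that by (intro integrable_const_bound[of _ "?B * ?B"])
      (use gB in \<open>auto simp: abs_mult intro!: mult_mono\<close>)
  \<comment> \<open>\<open>X n s\<close> is an increment from time 0, so \<open>s\<close> counts as
    a lag and is governed by the same function \<open>b\<close>.\<close>
  have E1: "(\<integral>\<omega>. \<bar>?Y s \<omega>\<bar> \<partial>M) \<le> b s" if s: "s \<in> {1..n}" for s
  proof (cases "t0 \<le> s")
    case True
    have "(\<integral>\<omega>. \<bar>?Y s \<omega>\<bar> \<partial>M) \<le> C * (\<beta> n / \<beta> s) * (\<integral>u. \<bar>?g u\<bar> \<partial>lborel)"
      using s True by (intro expectation_le(2)[OF db n _ _ gi(1)]) auto
    also have "\<dots> \<le> C * (\<beta> n / \<beta> s) * (2 * mass_abs)"
      using C \<beta>_pos[OF n1] \<beta>_pos[of s] s gi(3) by (intro mult_left_mono) auto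
    finally show ?thesis
      using True by (simp add: b_def mult_ac)
  next
    case False
    have "(\<integral>\<omega>. \<bar>?Y s \<omega>\<bar> \<partial>M) \<le> (\<integral>\<omega>. ?B \<partial>M)"
      using iY[OF s] gB by (intro integral_mono) auto
    then show ?thesis
      using False by (simp add: b_def prob_space)
  qed
  have E2: "(\<integral>\<omega>. \<bar>?Y s \<omega> * ?Y t \<omega>\<bar> \<partial>M) \<le> b s * b (t - s)" if "1 \<le> s" "s \<le> t" "t \<le> n" for s t
  proof (cases "t0 \<le> t - s")
    case True
    then have st: "s < t" using t0_ge_1 by simp
    interpret I: cond_density_increment M "F (int s)" "X n s" "X n t" "\<beta> (t - s)" "\<beta> n" "D n s t"
      by (rule increment) (use that st n1 in auto)
    have "(\<integral>\<omega>. \<bar>?Y s \<omega> * ?Y t \<omega>\<bar> \<partial>M)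
        \<le> C * (\<beta> n / \<beta> (t - s)) * (\<integral>u. \<bar>?g u\<bar> \<partial>lborel) * (\<integral>\<omega>. \<bar>?Y s \<omega>\<bar> \<partial>M)"
      by (rule I.expectation_mult_increment_le[OF _ gB(1) gi(1), of _ ?B])
         (use gB db n st that True in \<open>auto simp: dens_bound_def\<close>)
    also have "\<dots> \<le> C * (\<beta> n / \<beta> (t - s)) * (2 * mass_abs) * b s"
      using E1[of s] that C I.b I.c gi(3) ma b0 by (intro mult_mono) auto
    finally show ?thesis
      using True by (simp add: b_def[of "t - s"] mult_ac)
  next
    case False
    \<comment> \<open>For a short lag the second factor is replaced by its sup norm, which is the
      value of \<open>b\<close> there.\<close>
    have "(\<integral>\<omega>. \<bar>?Y s \<omega> * ?Y t \<omega>\<bar> \<partial>M) \<le> (\<integral>\<omega>. \<bar>?Y s \<omega>\<bar> * ?B \<partial>M)"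
    proof (rule integral_mono)
      show "\<bar>?Y s \<omega> * ?Y t \<omega>\<bar> \<le> \<bar>?Y s \<omega>\<bar> * ?B" for \<omega>
        unfolding abs_mult using gB by (intro mult_left_mono) auto
    qed (use that iYY[of s t] iY[of s] in auto)
    also have "\<dots> \<le> b s * ?B"
      using E1[of s] that gB(2) by (simp add: mult_right_mono)
    finally show ?thesis
      using False by (simp add: b_def[of "t - s"])
  qed
  have E3: "\<bar>\<integral>\<omega>. ?Y s \<omega> * ?Y t \<omega> \<partial>M\<bar> \<le> w * (b s * b (t - s))"
    if "1 \<le> s" "m \<le> s" "s \<le> m'" "m + s \<le> t" "t \<le> n" for s t
  proof -
    have st: "s < t" "t0 \<le> t - s" using that t0_ge_1 m by auto
    interpret I: cond_density_increment M "F (int s)" "X n s" "X n t" "\<beta> (t - s)" "\<beta> n" "D n s t"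
      by (rule increment) (use that st n1 in auto)
    have "\<bar>\<integral>\<omega>. ?Y s \<omega> * ?Y t \<omega> \<partial>M\<bar>
        \<le> w * (\<beta> n / \<beta> (t - s)) * (\<integral>u. \<bar>?g u\<bar> \<partial>lborel) * (\<integral>\<omega>. \<bar>?Y s \<omega>\<bar> \<partial>M)"
    proof (rule I.expectation_mult_increment_centred[OF _ gB(1) gi(1), of _ ?B _ e])
      show "D n s t \<omega> u \<le> C" if "\<omega> \<in> space M" for \<omega> u
        using that st \<open>t \<le> n\<close> db n by (auto simp: dens_bound_def)
      show "\<bar>D n s t \<omega> u - D n s t \<omega> 0\<bar> \<le> w"
        if "\<omega> \<in> space M" "\<bar>u\<bar> \<le> 2 * e * (\<beta> n / \<beta> (t - s))" for \<omega> u
        using near that \<open>m \<le> s\<close> \<open>s \<le> m'\<close> \<open>m + s \<le> t\<close> \<open>t \<le> n\<close> by blast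
    qed (use gB gi supp in auto)
    also have "\<dots> \<le> w * (\<beta> n / \<beta> (t - s)) * (2 * mass_abs) * b s"
      using E1[of s] that w I.b I.c gi(3) ma b0 by (intro mult_mono) auto
    \<comment> \<open>\<open>b (t - s)\<close> contains the density bound \<open>C\<close>, whereas
      the centred estimate has \<open>w\<close> in its place; \<open>1 \<le> C\<close> lets the
      missing factor be inserted.\<close>
    also have "\<dots> = 1 * (w * (\<beta> n / \<beta> (t - s)) * (2 * mass_abs) * b s)"
      by simp
    also have "\<dots> \<le> C * (w * (\<beta> n / \<beta> (t - s)) * (2 * mass_abs) * b s)"
      using C w I.b I.c ma b0[of s] by (intro mult_right_mono mult_nonneg_nonneg) auto
    finally show ?thesis
      using st by (simp add: b_def[of "t - s"] mult_ac)
  qed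
  let ?e = "\<lambda>s t. \<bar>\<integral>\<omega>. ?Y s \<omega> * ?Y t \<omega> \<partial>M\<bar>"
  have "(\<integral>\<omega>. (\<Sum>t=1..n. ?Y t \<omega>)\<^sup>2 \<partial>M) = (\<Sum>s=1..n. \<Sum>t=1..n. \<integral>\<omega>. ?Y s \<omega> * ?Y t \<omega> \<partial>M)"
  proof -
    have "(\<integral>\<omega>. (\<Sum>t=1..n. ?Y t \<omega>)\<^sup>2 \<partial>M) = (\<integral>\<omega>. (\<Sum>s=1..n. \<Sum>t=1..n. ?Y s \<omega> * ?Y t \<omega>) \<partial>M)"
      by (simp only: power2_eq_square sum_product)
    also have "\<dots> = (\<Sum>s=1..n. \<integral>\<omega>. (\<Sum>t=1..n. ?Y s \<omega> * ?Y t \<omega>) \<partial>M)"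
      using iYY by (intro Bochner_Integration.integral_sum Bochner_Integration.integrable_sum)
    also have "\<dots> = (\<Sum>s=1..n. \<Sum>t=1..n. \<integral>\<omega>. ?Y s \<omega> * ?Y t \<omega> \<partial>M)"
      using iYY by (intro sum.cong refl Bochner_Integration.integral_sum)
    finally show ?thesis .
  qed
  also have "\<dots> \<le> (\<Sum>s=1..n. \<Sum>t=1..n. ?e s t)"
    by (intro sum_mono) auto
  also have "\<dots> \<le> 2 * (P * (2 * S1 + S2 + w * P))"
  proof (rule sum_square_le_lagged[OF b0 w _ _ _ E3 P S1 S2])
    show "?e s t = ?e t s" for s t
      by (simp add: mult.commute)
    show "?e s t \<le> b s * b (t - s)" if "1 \<le> s" "s \<le> t" "t \<le> n" for s t
      using integral_abs_bound[of M "\<lambda>\<omega>. ?Y s \<omega> * ?Y t \<omega>"] E2[OF that] by linarith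
  qed auto
  finally show ?thesis .
qed

text \<open>HL8 with exponent \<open>q1 = 1\<close>, unpacked from nested extended real suprema into
  a pointwise bound.\<close>

lemma dens_increment_eventually:
  assumes q0: "0 < q0" and w: "0 < w"
  shows "\<forall>\<^sub>F \<eta> in at_right 0. \<forall>\<^sub>F n in sequentially. \<forall>(s, t)\<in>Omega n \<eta>. \<forall>\<omega>\<in>space M. \<forall>u.
    \<bar>u\<bar> \<le> q0 * \<eta> \<longrightarrow> \<bar>D n s t \<omega> u - D n s t \<omega> 0\<bar> \<le> w"
proof -
  let ?S = "\<lambda>\<eta> n. SUP (s, t)\<in>Omega n \<eta>. SUP \<omega>\<in>space M.
             SUP x\<in>{x. \<bar>x\<bar> \<le> q0 * \<eta> powr 1}. ereal \<bar>D n s t \<omega> x - D n s t \<omega> 0\<bar>"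
  have "((\<lambda>\<eta>. limsup (?S \<eta>)) \<longlongrightarrow> 0) (at_right 0)"
    using HL8[unfolded HL8_def, rule_format, OF q0 zero_less_one] .
  then have "\<forall>\<^sub>F \<eta> in at_right 0. limsup (?S \<eta>) < ereal w"
    using w by (intro order_tendstoD) auto
  then show ?thesis
    using eventually_at_right_less[of 0]
  proof eventually_elim
    case (elim \<eta>)
    have "\<forall>\<^sub>F n in sequentially. ?S \<eta> n < ereal w"
      using elim(1) by (rule Limsup_lessD)
    then show ?case
    proof eventually_elim
      case (elim n)
      show ?case
      proof (clarify)
        fix s t \<omega> u assume st: "(s, t) \<in> Omega n \<eta>" and \<omega>: "\<omega> \<in> space M" and u: "\<bar>u\<bar> \<le> q0 * \<eta>"
        have "ereal \<bar>D n s t \<omega> u - D n s t \<omega> 0\<bar>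
            \<le> (SUP x\<in>{x. \<bar>x\<bar> \<le> q0 * \<eta> powr 1}. ereal \<bar>D n s t \<omega> x - D n s t \<omega> 0\<bar>)"
          using u \<open>0 < \<eta>\<close> by (intro SUP_upper) auto
        also have "\<dots> \<le> (SUP \<omega>\<in>space M. SUP x\<in>{x. \<bar>x\<bar> \<le> q0 * \<eta> powr 1}. ereal \<bar>D n s t \<omega> x - D n s t \<omega> 0\<bar>)"
          using \<omega> by (rule SUP_upper)
        also have "\<dots> \<le> ?S \<eta> n"
          using SUP_upper[OF st, of "\<lambda>(s, t). SUP \<omega>\<in>space M.
             SUP x\<in>{x. \<bar>x\<bar> \<le> q0 * \<eta> powr 1}. ereal \<bar>D n s t \<omega> x - D n s t \<omega> 0\<bar>"] by simp
        also have "\<dots> < ereal w"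
          by fact
        finally show "\<bar>D n s t \<omega> u - D n s t \<omega> 0\<bar> \<le> w"
          by simp
      qed
    qed
  qed
qed

text \<open>HL9 (d) in reciprocal form. The condition \<open>s < t\<close> excludes lag 0, at which
  \<open>\<beta>\<close> is not assumed positive.\<close>

lemma \<beta>_lag_bound:
  obtains l0 l1 where "0 < l0" "0 < l1"
    "\<And>\<eta>. 0 < \<eta> \<Longrightarrow> \<eta> < 1 \<Longrightarrow> \<forall>\<^sub>F n in sequentially. \<forall>(s, t)\<in>Omega n \<eta>. s < t \<longrightarrow>
      \<beta> n / \<beta> (t - s) \<le> l0 / \<eta> powr l1"
proof -
  obtain l0 l1 where l: "0 < l0" "0 < l1" and lim: "\<And>\<eta>. \<eta> \<in> {0<..<1::real} \<Longrightarrow>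
        liminf (\<lambda>n. ereal (1 / \<beta> n) * (INF (s, t)\<in>Omega n \<eta>. ereal (\<beta> (t - s))))
          \<ge> ereal (\<eta> powr l1 / l0)"
    using HL9 unfolding HL9_def by blast
  \<comment> \<open>A lower bound on a limit inferior holds eventually only for strictly smaller
    constants, hence the doubled \<open>l0\<close>.\<close>
  show ?thesis
  proof (rule that[of "2 * l0" l1])
    fix \<eta> :: real assume \<eta>: "0 < \<eta>" "\<eta> < 1"
    have "ereal (\<eta> powr l1 / (2 * l0)) < ereal (\<eta> powr l1 / l0)"
      using l \<eta> by (simp add: field_simps)
    also have "\<dots> \<le> liminf (\<lambda>n. ereal (1 / \<beta> n) * (INF (s, t)\<in>Omega n \<eta>. ereal (\<beta> (t - s))))"
      using lim \<eta> by simp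
    finally have "\<forall>\<^sub>F n in sequentially. ereal (\<eta> powr l1 / (2 * l0))
        < ereal (1 / \<beta> n) * (INF (s, t)\<in>Omega n \<eta>. ereal (\<beta> (t - s)))"
      by (rule less_LiminfD)
    then show "\<forall>\<^sub>F n in sequentially. \<forall>(s, t)\<in>Omega n \<eta>. s < t \<longrightarrow> \<beta> n / \<beta> (t - s) \<le> 2 * l0 / \<eta> powr l1"
      using eventually_ge_at_top[of 1]
    proof eventually_elim
      case (elim n)
      show ?case
      proof clarify
        fix s t assume st: "(s, t) \<in> Omega n \<eta>" "s < t"
        have pos: "0 < \<beta> n" "0 < \<beta> (t - s)"
          using \<beta>_pos elim(2) st by auto
        have "(INF (s, t)\<in>Omega n \<eta>. ereal (\<beta> (t - s))) \<le> ereal (\<beta> (t - s))"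
          using INF_lower[OF st(1), of "\<lambda>(s, t). ereal (\<beta> (t - s))"] by simp
        then have "ereal (1 / \<beta> n) * (INF (s, t)\<in>Omega n \<eta>. ereal (\<beta> (t - s))) \<le> ereal (1 / \<beta> n) * ereal (\<beta> (t - s))"
          using pos by (intro ereal_mult_left_mono) auto
        with elim(1) have "ereal (\<eta> powr l1 / (2 * l0)) < ereal (1 / \<beta> n) * ereal (\<beta> (t - s))"
          by (rule less_le_trans)
        then have "\<eta> powr l1 / (2 * l0) < \<beta> (t - s) / \<beta> n"
          by simp
        then show "\<beta> n / \<beta> (t - s) \<le> 2 * l0 / \<eta> powr l1"
          using pos l \<eta> by (simp add: field_simps)
      qed
    qed
  qed (use l in auto)
qed

lemma \<beta>_edge_sums_eventually:
  assumes d: "0 < d"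
  shows "\<forall>\<^sub>F \<eta> in at_right 0. \<forall>\<^sub>F n in sequentially.
      \<beta> n / real n * (\<Sum>t=nat \<lfloor>(1 - \<eta>) * real n\<rfloor>..n. 1 / \<beta> t) < d"
    and "\<forall>\<^sub>F \<eta> in at_right 0. \<forall>\<^sub>F n in sequentially.
      \<beta> n / real n * (\<Sum>t=t0..nat \<lfloor>\<eta> * real n\<rfloor>. 1 / \<beta> t) < d"
proof -
  have *: "\<forall>\<^sub>F \<eta> in at_right 0. \<forall>\<^sub>F n in sequentially. S \<eta> n < d"
    if "\<exists>L::real \<Rightarrow> real. (\<forall>\<^sub>F \<eta> in at_right 0. S \<eta> \<longlonglongrightarrow> L \<eta>) \<and> (L \<longlongrightarrow> 0) (at_right 0)"
    for S :: "real \<Rightarrow> nat \<Rightarrow> real"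
  proof -
    obtain L where L: "\<forall>\<^sub>F \<eta> in at_right 0. S \<eta> \<longlonglongrightarrow> L \<eta>" "(L \<longlongrightarrow> 0) (at_right 0)"
      using \<open>\<exists>L. _ L\<close> by blast
    have "\<forall>\<^sub>F \<eta> in at_right 0. L \<eta> < d"
      using L(2) d by (rule order_tendstoD)
    with L(1) show ?thesis
      by eventually_elim (rule order_tendstoD)
  qed
  show "\<forall>\<^sub>F \<eta> in at_right 0. \<forall>\<^sub>F n in sequentially.
      \<beta> n / real n * (\<Sum>t=nat \<lfloor>(1 - \<eta>) * real n\<rfloor>..n. 1 / \<beta> t) < d"
    using HL9 unfolding HL9_def by (intro *) blast
  show "\<forall>\<^sub>F \<eta> in at_right 0. \<forall>\<^sub>F n in sequentially.
      \<beta> n / real n * (\<Sum>t=t0..nat \<lfloor>\<eta> * real n\<rfloor>. 1 / \<beta> t) < d"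
    using HL9 unfolding HL9_def by (intro *) blast
qed

end

context kernel_array
begin

text \<open>All parameters are reduced to one tolerance \<open>d\<close>: it bounds the oscillation
  of the densities, both edge sums and the short lags. The second moment of the sum is then at most
  \<open>(real n)\<^sup>2 * (d * Z)\<close>.\<close>

lemma second_moment_small:
  assumes r: "0 < r" and e1: "0 < e1"
  obtains e where "0 < e" "e < e1"
    "\<forall>\<^sub>F n in sequentially. (\<integral>\<omega>. (1 / real n * (\<Sum>t=1..n. centred n e (X n t \<omega> / \<beta> n)))\<^sup>2 \<partial>M) \<le> r"
proof -
  obtain C n0 where db: "dens_bound C n0" by (rule dens_bound_exists)
  obtain Cb where Cb: "0 \<le> Cb" "\<And>n. 1 \<le> n \<Longrightarrow> \<beta> n / real n * (\<Sum>t=t0..n. 1 / \<beta> t) \<le> Cb"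
    using \<beta>_sum_bound_exists by blast
  obtain l0 l1 where l: "0 < l0" "0 < l1" and lag: "\<And>\<eta>. 0 < \<eta> \<Longrightarrow> \<eta> < 1 \<Longrightarrow>
      \<forall>\<^sub>F n in sequentially. \<forall>(s, t)\<in>Omega n \<eta>. s < t \<longrightarrow> \<beta> n / \<beta> (t - s) \<le> l0 / \<eta> powr l1"
    using \<beta>_lag_bound by blast
  have ma: "0 \<le> mass_abs"
    unfolding mass_abs_def by simp
  define q where "q = C * (2 * mass_abs)"
  have q: "0 \<le> q"
    using db ma by (simp add: q_def dens_bound_def)
  \<comment> \<open>With \<open>d \<le> 1\<close>, the total of \<open>b\<close> is at most
    \<open>real n * (1 + q * Cb)\<close>. The bracket multiplying it consists of three edge sums
    \<open>real n * (d + q * d)\<close> and the oscillation term, together at most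
    \<open>real n * d * (4 + 3 * q + q * Cb)\<close>.\<close>
  define Z where "Z = 2 * ((1 + q * Cb) * (4 + 3 * q + q * Cb))"
  have Z: "0 < Z"
    unfolding Z_def using q Cb(1) by (intro mult_pos_pos add_pos_nonneg) auto
  define d where "d = min 1 (r / Z)"
  have d: "0 < d" "d \<le> 1" "d * Z \<le> r"
    using r Z by (auto simp: d_def min_def field_simps)
  \<comment> \<open>The radius \<open>2 * l0 * \<eta>\<close> is \<open>2 * e\<close> times the
    bound \<open>l0 / \<eta> powr l1\<close> on \<open>\<beta> n / \<beta> (t - s)\<close>, for the
    \<open>e\<close> defined below.\<close>
  have "\<forall>\<^sub>F \<eta> in at_right 0. (\<forall>\<^sub>F n in sequentially. \<forall>(s, t)\<in>Omega n \<eta>. \<forall>\<omega>\<in>space M. \<forall>u.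
      \<bar>u\<bar> \<le> 2 * l0 * \<eta> \<longrightarrow> \<bar>D n s t \<omega> u - D n s t \<omega> 0\<bar> \<le> d) \<and>
    (\<forall>\<^sub>F n in sequentially. \<beta> n / real n * (\<Sum>t=nat \<lfloor>(1 - \<eta>) * real n\<rfloor>..n. 1 / \<beta> t) < d) \<and>
    (\<forall>\<^sub>F n in sequentially. \<beta> n / real n * (\<Sum>t=t0..nat \<lfloor>\<eta> * real n\<rfloor>. 1 / \<beta> t) < d) \<and>
    \<eta> \<in> {0<..<min (1/2) e1}"
    using d l r e1 by (intro eventually_conj dens_increment_eventually \<beta>_edge_sums_eventually
        eventually_at_right_real) auto
  from eventually_happens'[OF trivial_limit_at_right_real this]
  obtain \<eta> where near: "\<forall>\<^sub>F n in sequentially. \<forall>(s, t)\<in>Omega n \<eta>. \<forall>\<omega>\<in>space M. \<forall>u.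
      \<bar>u\<bar> \<le> 2 * l0 * \<eta> \<longrightarrow> \<bar>D n s t \<omega> u - D n s t \<omega> 0\<bar> \<le> d"
    and hi: "\<forall>\<^sub>F n in sequentially. \<beta> n / real n * (\<Sum>t=nat \<lfloor>(1 - \<eta>) * real n\<rfloor>..n. 1 / \<beta> t) < d"
    and lo: "\<forall>\<^sub>F n in sequentially. \<beta> n / real n * (\<Sum>t=t0..nat \<lfloor>\<eta> * real n\<rfloor>. 1 / \<beta> t) < d"
    and \<eta>: "0 < \<eta>" "\<eta> < 1/2" "\<eta> < e1"
    unfolding greaterThanLessThan_iff min_less_iff_conj by blast
  have \<eta>1: "\<eta> < 1"
    using \<eta> by simp
  define e where "e = \<eta> * \<eta> powr l1"
  have "\<eta> powr l1 \<le> 1"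
    using \<eta> l by (intro powr_le1) auto
  then have "e \<le> \<eta>"
    using \<eta> by (simp add: e_def mult_left_le)
  then have e: "0 < e" "e < e1"
    using \<eta> by (simp add: e_def, linarith)
  \<comment> \<open>From this row on \<open>\<eta> * real n\<close> exceeds \<open>t0\<close>, so
    every lag of at least \<open>m\<close> is long enough for the density bound. Since \<eta> is
    below one half, \<open>m'\<close> is at least \<open>t0\<close> as well.\<close>
  obtain N :: nat where N: "real t0 / \<eta> < real N"
    using reals_Archimedean2 by blast
  have "\<forall>\<^sub>F n in sequentially. real t0 * centred_bound n e / real n < d"
    using centred_bound_tendsto d(1) by (rule order_tendstoD)
  then have "\<forall>\<^sub>F n in sequentially. (\<integral>\<omega>. (1 / real n * (\<Sum>t=1..n. centred n e (X n t \<omega> / \<beta> n)))\<^sup>2 \<partial>M) \<le> r"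
    using near hi lo lag[OF \<eta>(1) \<eta>1] centred_support[OF e(1)] eventually_ge_at_top[of n0] eventually_ge_at_top[of N]
  proof eventually_elim
    case (elim n)
    have n1: "1 \<le> n"
      using elim db by (auto simp: dens_bound_def)
    define m m' where "m = nat \<lfloor>\<eta> * real n\<rfloor>" and "m' = nat \<lfloor>(1 - \<eta>) * real n\<rfloor>"
    have "real t0 < \<eta> * real N"
      using N \<eta> by (simp add: field_simps)
    also have "\<dots> \<le> \<eta> * real n"
      using elim \<eta> by simp
    finally have t0n: "real t0 < \<eta> * real n" .
    also have "\<eta> * real n \<le> (1 - \<eta>) * real n"
      using \<eta> by (intro mult_right_mono) auto
    finally have m: "t0 \<le> m" "t0 \<le> m'"
      using t0n unfolding m_def m'_def by (auto simp: le_nat_iff le_floor_iff)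
    have im: "int m = \<lfloor>\<eta> * real n\<rfloor>" "int m' = \<lfloor>(1 - \<eta>) * real n\<rfloor>"
      using \<eta> by (auto simp: m_def m'_def)
    have B: "0 \<le> centred_bound n e"
      by (rule centred_bound(2)[OF n1 e(1)])
    let ?b = "\<lambda>j. if t0 \<le> j then q * (\<beta> n / \<beta> j) else centred_bound n e"
    have nd: "real t0 * centred_bound n e / real n \<le> d"
      using elim by simp
    note ls = lagged_sum_le[OF n1 q B]
    have fin: "real n * (real t0 * centred_bound n e / real n + q * S) \<le> real n * (d + q * S')"
      if "S \<le> S'" for S S'
      using nd that q by (intro mult_left_mono add_mono) auto
    have "(\<Sum>j=0..n. ?b j) = (\<Sum>j=0..n. if True then ?b j else 0)"
      by simp
    also have "\<dots> \<le> real n * (d + q * Cb)"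
      using t0_ge_1 by (intro order_trans[OF ls[of "{t0..n}"] fin[OF Cb(2)[OF n1]]]) auto
    finally have P: "(\<Sum>j=0..n. ?b j) \<le> real n * (d + q * Cb)" .
    have lo': "\<beta> n / real n * (\<Sum>t=t0..m. 1 / \<beta> t) \<le> d"
      unfolding m_def by (rule less_imp_le[OF elim(4)])
    have hi': "\<beta> n / real n * (\<Sum>t=m'..n. 1 / \<beta> t) \<le> d"
      unfolding m'_def by (rule less_imp_le[OF elim(3)])
    have S1: "(\<Sum>j=0..n. if j < m then ?b j else 0) \<le> real n * (d + q * d)"
      using t0_ge_1 by (intro order_trans[OF ls[of "{t0..m}"] fin[OF lo']]) auto
    have S2: "(\<Sum>j=0..n. if m' < j then ?b j else 0) \<le> real n * (d + q * d)"
      using t0_ge_1 m by (intro order_trans[OF ls[of "{m'..n}"] fin[OF hi']]) auto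
    let ?P = "real n * (d + q * Cb)" and ?S = "real n * (d + q * d)"
    have "(\<integral>\<omega>. (\<Sum>t=1..n. centred n e (X n t \<omega> / \<beta> n))\<^sup>2 \<partial>M) \<le> 2 * (?P * (2 * ?S + ?S + d * ?P))"
    proof (rule second_moment_row[OF db elim(7) e(1) less_imp_le[OF d(1)] m(1)])
      show "\<bar>D n s t \<omega> u - D n s t \<omega> 0\<bar> \<le> d"
        if st: "m \<le> s" "s \<le> m'" "m + s \<le> t" "t \<le> n" and \<omega>: "\<omega> \<in> space M"
          and u: "\<bar>u\<bar> \<le> 2 * e * (\<beta> n / \<beta> (t - s))" for s t \<omega> u
      proof -
        have Om: "(s, t) \<in> Omega n \<eta>" and "s < t"
          using st im m t0_ge_1 by (auto simp: Omega_def)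
        then have "\<beta> n / \<beta> (t - s) \<le> l0 / \<eta> powr l1"
          using elim by auto
        then have "2 * e * (\<beta> n / \<beta> (t - s)) \<le> 2 * e * (l0 / \<eta> powr l1)"
          using e by (intro mult_left_mono) auto
        also have "\<dots> = 2 * l0 * \<eta>"
          using \<eta> by (simp add: e_def)
        finally show ?thesis
          using u elim(2) Om \<omega> by fastforce
      qed
      show "centred n e v = 0" if "e < \<bar>v\<bar>" for v
        using elim that by blast
    qed (insert P S1 S2, simp_all only: q_def)
    also have "\<dots> = (real n)\<^sup>2 * (2 * ((d + q * Cb) * (d * (3 + 3 * q + (d + q * Cb)))))"
      by (simp add: power2_eq_square algebra_simps)
    also have "\<dots> \<le> (real n)\<^sup>2 * (2 * ((1 + q * Cb) * (d * (3 + 3 * q + (1 + q * Cb)))))"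
      using d q Cb(1) by (intro mult_left_mono mult_mono add_mono) auto
    also have "\<dots> = (real n)\<^sup>2 * (d * Z)"
      by (simp add: Z_def algebra_simps)
    also have "\<dots> \<le> (real n)\<^sup>2 * r"
      using d by (intro mult_left_mono) auto
    finally show ?case
      using n1 by (simp add: power_mult_distrib power_divide field_simps)
  qed
  with e show ?thesis by (rule that)
qed

end

section \<open>Convergence of smoothed averages\<close>

context prob_space
begin

lemma trunc_mean_cmult_le:
  assumes [measurable]: "Y \<in> borel_measurable M"
  shows "trunc_mean M (\<lambda>\<omega>. c * Y \<omega>) \<le> max 1 \<bar>c\<bar> * trunc_mean M Y"
proof -
  have "min 1 \<bar>c * y\<bar> \<le> max 1 \<bar>c\<bar> * min 1 \<bar>y\<bar>" for y
  proof (cases "\<bar>y\<bar> \<le> 1")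
    case True
    then show ?thesis
      unfolding abs_mult by (simp add: min.coboundedI2 mult_right_mono)
  qed (simp add: min.coboundedI1)
  then have "trunc_mean M (\<lambda>\<omega>. c * Y \<omega>) \<le> (\<integral>\<omega>. max 1 \<bar>c\<bar> * min 1 \<bar>Y \<omega>\<bar> \<partial>M)"
    unfolding trunc_mean_def by (intro integral_mono integrable_mult_right integrable_trunc) auto
  then show ?thesis
    by (simp add: trunc_mean_def)
qed

lemma trunc_mean_le_const:
  assumes "Y \<in> borel_measurable M" "\<And>\<omega>. \<omega> \<in> space M \<Longrightarrow> \<bar>Y \<omega>\<bar> \<le> c"
  shows "trunc_mean M Y \<le> c"
proof -
  have "trunc_mean M Y \<le> (\<integral>\<omega>. c \<partial>M)"
    unfolding trunc_mean_def using assms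
    by (intro integral_mono integrable_trunc) (auto intro: min.coboundedI2)
  then show ?thesis by (simp add: prob_space)
qed

end

locale limit_array = density_array + N: prob_space N for N :: "'b measure" +
  fixes Xp Xm R :: "nat \<Rightarrow> nat \<Rightarrow> 'a \<Rightarrow> real" and LXp LXm :: "'b \<Rightarrow> real" and \<Phi> :: "real \<Rightarrow> real"
  assumes HL1: "HL1 M F X \<beta> Xp Xm R" and HL2: "HL2 M F \<beta> Xp Xm N LXp LXm \<Phi>"
    and HL4: "HL4 M F X \<beta>"
begin

lemma LXm_measurable [measurable]: "LXm \<in> borel_measurable N"
  using HL2 by (simp add: HL2_def)

sublocale bounded_continuous_density \<Phi>
proof
  show nn: "0 \<le> \<Phi> x" for x
    using HL2 by (simp add: HL2_def)
  show cont: "continuous_on UNIV \<Phi>" and "bounded (range \<Phi>)"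
    using HL2 by (simp_all add: HL2_def)
  have m: "\<Phi> \<in> borel_measurable borel"
    by (rule borel_measurable_continuous_onI[OF cont])
  have "distributed N lborel LXp (\<lambda>x. ennreal (\<Phi> x))"
    using HL2 by (simp add: HL2_def)
  from distributed_nn_integral[OF this, of "\<lambda>_. 1"]
  have 1: "(\<integral>\<^sup>+x. ennreal (\<Phi> x) \<partial>lborel) = 1"
    by (simp add: N.emeasure_space_1)
  then show "integrable lborel \<Phi>"
    using nn m by (intro integrableI_nonneg) auto
  show "(\<integral>x. \<Phi> x \<partial>lborel) = 1"
    using nn m 1 by (subst integral_eq_nn_integral) auto
qed

text \<open>The terminal value is used for the whole row: by HL2 (b) it agrees asymptotically with
  the value at any time that is at least a fixed fraction of \<open>n\<close>.\<close>

abbreviation m :: "nat \<Rightarrow> 'a \<Rightarrow> real" where "m n \<omega> \<equiv> Xm n n \<omega> / \<beta> n"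

lemma m_measurable_F: "1 \<le> n \<Longrightarrow> m n \<in> borel_measurable (F 0)"
  using HL1 unfolding HL1_def by (intro borel_measurable_divide) auto

lemma m_measurable: "1 \<le> n \<Longrightarrow> m n \<in> borel_measurable M"
  using measurable_from_subalg[OF subalg m_measurable_F] .

text \<open>HL2 (b) along the sequence of final times, which is admissible for every fraction, for
  instance one half.\<close>

lemma m_conv_distr: "conv_distr M m N LXm"
proof -
  have "\<lfloor>real n * (1/2)\<rfloor> \<le> int n" for n
    by linarith
  then show ?thesis
    using HL2 unfolding HL2_def by (auto dest!: bspec[of _ _ "1/2"] spec[of _ "\<lambda>n. n"])
qed

text \<open>Measured in mean rather than in probability, so that these errors can be averaged over
  \<open>t\<close>.\<close>

definition cond_err :: "real \<Rightarrow> nat \<Rightarrow> nat \<Rightarrow> real" where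
  "cond_err e n t = (\<integral>\<omega>. \<bar>real_cond_exp M (F 0) (\<lambda>\<omega>. hat e (X n t \<omega> / \<beta> n)) \<omega> - smooth \<Phi> e (m n \<omega>)\<bar> \<partial>M)"

text \<open>Replacing \<open>X\<close> by its \<open>Xp\<close> part plus the terminal value
  \<open>m n\<close> leaves the remainder \<open>R\<close> and the change of \<open>Xm\<close>
  between \<open>\<tau> n\<close> and \<open>n\<close>, both vanishing in probability after scaling.
  That \<open>1 \<le> \<tau> n\<close> is stated separately because
  \<open>\<lfloor>real n * d\<rfloor>\<close> can be 0 while the decomposition starts at time
  1.\<close>

lemma cond_err_sequence:
  assumes e: "0 < e" and d: "d \<in> {0<..<1}"
    and tau: "\<And>n. \<lfloor>real n * d\<rfloor> \<le> int (\<tau> n) \<and> \<tau> n \<le> n" "\<And>n. 1 \<le> n \<Longrightarrow> 1 \<le> \<tau> n"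
  shows "(\<lambda>n. cond_err e n (\<tau> n)) \<longlonglongrightarrow> 0"
proof -
  have cc: "conv_prob M (\<lambda>n. real_cond_exp M (F 0) (\<lambda>\<omega>. h (Xp n (\<tau> n) \<omega> / \<beta> n))) (\<integral>x. h x * \<Phi> x \<partial>lborel)"
    if "continuous_on UNIV h" "bounded (range h)" for h :: "real \<Rightarrow> real"
    using HL2 d tau that unfolding HL2_def by blast
  have cm: "conv_prob M (\<lambda>n \<omega>. (Xm n n \<omega> - Xm n (\<tau> n) \<omega>) / \<beta> n) 0"
    using HL2 d tau unfolding HL2_def by blast
  have tn: "\<tau> n \<in> {1..n}" if "1 \<le> n" for n
    using tau that by simp
  have comp: "Xp n t \<in> borel_measurable M" "Xm n t \<in> borel_measurable M" "R n t \<in> borel_measurable M"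
    "X n t \<in> borel_measurable M"
    "\<And>\<omega>. \<omega> \<in> space M \<Longrightarrow> X n t \<omega> = Xp n t \<omega> + Xm n t \<omega> + R n t \<omega>"
    if "1 \<le> n" "t \<in> {1..n}" for n t
  proof -
    have *: "Xp n t \<in> borel_measurable M \<and> Xm n t \<in> borel_measurable (F 0) \<and> R n t \<in> borel_measurable M
        \<and> (\<forall>\<omega>\<in>space M. X n t \<omega> = Xp n t \<omega> + Xm n t \<omega> + R n t \<omega>)"
      using HL1 that unfolding HL1_def by blast
    then show "Xm n t \<in> borel_measurable M"
      using measurable_from_subalg[OF subalg[of 0]] by blast
    show "X n t \<in> borel_measurable M"
      using X_measurable that by simp
    show "Xp n t \<in> borel_measurable M" "R n t \<in> borel_measurable M"
      "\<And>\<omega>. \<omega> \<in> space M \<Longrightarrow> X n t \<omega> = Xp n t \<omega> + Xm n t \<omega> + R n t \<omega>"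
      using * by blast+
  qed
  have meas: "Xp n (\<tau> n) \<in> borel_measurable M" "Xm n (\<tau> n) \<in> borel_measurable M" "Xm n n \<in> borel_measurable M"
    "R n (\<tau> n) \<in> borel_measurable M" "X n (\<tau> n) \<in> borel_measurable M"
    and dec: "\<And>\<omega>. \<omega> \<in> space M \<Longrightarrow> X n (\<tau> n) \<omega> = Xp n (\<tau> n) \<omega> + Xm n (\<tau> n) \<omega> + R n (\<tau> n) \<omega>"
    if "1 \<le> n" for n
    using comp[OF that tn[OF that]] comp(2)[OF that, of n] that by auto
  interpret C: conditional_limit M \<Phi> "F 0" "\<lambda>n \<omega>. Xp n (\<tau> n) \<omega> / \<beta> n" m
  proof
    show "subalgebra M (F 0)" by (rule subalg)
    show "\<exists>A. \<forall>\<^sub>F n in sequentially. measure M {\<omega> \<in> space M. A \<le> \<bar>m n \<omega>\<bar>} < r" if "0 < r" for r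
      using conv_distr_tight[OF N.prob_space_axioms LXm_measurable m_measurable m_conv_distr that] by blast
  qed (use meas m_measurable_F cc in auto)
  have l1: "(\<lambda>n. trunc_mean M (\<lambda>\<omega>. (Xm n n \<omega> - Xm n (\<tau> n) \<omega>) / \<beta> n)) \<longlonglongrightarrow> 0"
    using cm meas by (intro trunc_mean_tendsto_0[of 1]) (auto simp: conv_prob_def)
  have "small_o_p M (\<lambda>n \<omega>. ereal (R n (\<tau> n) \<omega> / \<beta> n))"
    unfolding small_o_p_def
  proof (intro allI impI)
    fix \<epsilon> :: real assume \<epsilon>: "0 < \<epsilon>"
    let ?p = "\<lambda>n t. measure M {\<omega> \<in> space M. \<bar>R n t \<omega>\<bar> / \<beta> n > \<epsilon>}"
    have lim: "(\<lambda>n. SUP t\<in>{1..n}. ?p n t) \<longlonglongrightarrow> 0"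
      using HL1 \<epsilon> unfolding HL1_def by blast
    show "(\<lambda>n. measure M {\<omega> \<in> space M. \<bar>ereal (R n (\<tau> n) \<omega> / \<beta> n)\<bar> > ereal \<epsilon>}) \<longlonglongrightarrow> 0"
    proof (rule Lim_null_comparison[OF _ lim])
      show "\<forall>\<^sub>F n in sequentially. norm (measure M {\<omega> \<in> space M. \<bar>ereal (R n (\<tau> n) \<omega> / \<beta> n)\<bar> > ereal \<epsilon>})
          \<le> (SUP t\<in>{1..n}. ?p n t)"
        using eventually_ge_at_top[of 1]
      proof eventually_elim
        case (elim n)
        have "?p n (\<tau> n) \<le> (SUP t\<in>{1..n}. ?p n t)"
          using tau(1)[of n] tau(2)[OF elim] by (intro cSUP_upper) auto
        then show ?case
          using \<beta>_pos[OF elim] by (simp add: abs_divide)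
      qed
    qed
  qed
  then have l2: "(\<lambda>n. trunc_mean M (\<lambda>\<omega>. R n (\<tau> n) \<omega> / \<beta> n)) \<longlonglongrightarrow> 0"
    using meas by (intro trunc_mean_tendsto_0[of 1]) auto
  show ?thesis
    unfolding cond_err_def
  proof (rule C.cond_exp_hat_perturbed_tendsto[OF e])
    show "(\<lambda>\<omega>. X n (\<tau> n) \<omega> / \<beta> n) \<in> borel_measurable M" if "1 \<le> n" for n
      using meas[OF that] by auto
    show "(\<lambda>n. trunc_mean M (\<lambda>\<omega>. X n (\<tau> n) \<omega> / \<beta> n - (Xp n (\<tau> n) \<omega> / \<beta> n + m n \<omega>))) \<longlonglongrightarrow> 0"
    proof (rule Lim_null_comparison[OF _ tendsto_add_zero[OF l1 l2]])
      show "\<forall>\<^sub>F n in sequentially. norm (trunc_mean M (\<lambda>\<omega>. X n (\<tau> n) \<omega> / \<beta> n - (Xp n (\<tau> n) \<omega> / \<beta> n + m n \<omega>)))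
        \<le> trunc_mean M (\<lambda>\<omega>. (Xm n n \<omega> - Xm n (\<tau> n) \<omega>) / \<beta> n) + trunc_mean M (\<lambda>\<omega>. R n (\<tau> n) \<omega> / \<beta> n)"
        using eventually_ge_at_top[of 1]
      proof eventually_elim
        case (elim n)
        note [measurable] = meas[OF elim]
        have eq: "X n (\<tau> n) \<omega> / \<beta> n - (Xp n (\<tau> n) \<omega> / \<beta> n + m n \<omega>)
            = R n (\<tau> n) \<omega> / \<beta> n - (Xm n n \<omega> - Xm n (\<tau> n) \<omega>) / \<beta> n" if "\<omega> \<in> space M" for \<omega>
          using dec[OF elim that] by (simp add: add_divide_distrib diff_divide_distrib)
        have "trunc_mean M (\<lambda>\<omega>. X n (\<tau> n) \<omega> / \<beta> n - (Xp n (\<tau> n) \<omega> / \<beta> n + m n \<omega>))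
          \<le> trunc_mean M (\<lambda>\<omega>. (Xm n n \<omega> - Xm n (\<tau> n) \<omega>) / \<beta> n) + trunc_mean M (\<lambda>\<omega>. R n (\<tau> n) \<omega> / \<beta> n)"
        proof (rule trunc_mean_mono_sum)
          show "AE \<omega> in M. \<bar>X n (\<tau> n) \<omega> / \<beta> n - (Xp n (\<tau> n) \<omega> / \<beta> n + m n \<omega>)\<bar>
              \<le> \<bar>(Xm n n \<omega> - Xm n (\<tau> n) \<omega>) / \<beta> n\<bar> + \<bar>R n (\<tau> n) \<omega> / \<beta> n\<bar>"
          proof (rule AE_I2)
            fix \<omega> assume "\<omega> \<in> space M"
            then show "\<bar>X n (\<tau> n) \<omega> / \<beta> n - (Xp n (\<tau> n) \<omega> / \<beta> n + m n \<omega>)\<bar>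
              \<le> \<bar>(Xm n n \<omega> - Xm n (\<tau> n) \<omega>) / \<beta> n\<bar> + \<bar>R n (\<tau> n) \<omega> / \<beta> n\<bar>"
              unfolding eq[OF \<open>\<omega> \<in> space M\<close>] by linarith
          qed
        qed measurable
        then show ?case
          by (simp add: trunc_mean_nonneg)
      qed
    qed
  qed
qed

text \<open>Uniformity in \<open>t\<close>: test the sequential statement on the worst time index of each row.\<close>

lemma cond_err_uniform:
  assumes e: "0 < e" and d: "d \<in> {0<..<1}" and r: "0 < r"
  shows "\<forall>\<^sub>F n in sequentially. \<forall>t\<in>{1..n}. \<lfloor>real n * d\<rfloor> \<le> int t \<longrightarrow> cond_err e n t \<le> r"
proof -
  define bad where "bad n = {t\<in>{1..n}. \<lfloor>real n * d\<rfloor> \<le> int t \<and> \<not> cond_err e n t \<le> r}" for n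
  \<comment> \<open>The default \<open>n\<close> for rows without a bad index satisfies the range
    condition on \<open>\<tau>\<close>.\<close>
  define \<tau> where "\<tau> n = (if bad n = {} then n else SOME t. t \<in> bad n)" for n
  have tb: "\<tau> n \<in> bad n" if "bad n \<noteq> {}" for n
    using that some_in_eq[of "bad n"] by (simp add: \<tau>_def)
  have nd: "\<lfloor>real n * d\<rfloor> \<le> int n" for n
  proof -
    have "real n * d \<le> real n"
      using d by (simp add: mult_left_le)
    then show ?thesis by linarith
  qed
  have "(\<lambda>n. cond_err e n (\<tau> n)) \<longlonglongrightarrow> 0"
  proof (rule cond_err_sequence[OF e d])
    show "\<lfloor>real n * d\<rfloor> \<le> int (\<tau> n) \<and> \<tau> n \<le> n" for n
      using tb[of n] nd[of n] by (cases "bad n = {}") (auto simp: bad_def \<tau>_def)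
    show "1 \<le> \<tau> n" if "1 \<le> n" for n
      using tb[of n] that by (cases "bad n = {}") (auto simp: bad_def \<tau>_def)
  qed
  then have "\<forall>\<^sub>F n in sequentially. cond_err e n (\<tau> n) < r"
    using r by (rule order_tendstoD)
  then show ?thesis
  proof eventually_elim
    case (elim n)
    then have "bad n = {}"
      using tb[of n] by (auto simp: bad_def)
    then show ?case
      by (auto simp: bad_def)
  qed
qed

text \<open>HL4 replaces the average by the average of conditional means. These are uniformly close
  to \<open>smooth \<Phi> e (m n \<omega>)\<close> except for the first \<open>real n * d\<close>
  indices, where the trivial bound \<open>2 / e\<close> is used.\<close>

lemma hat_average_tendsto:
  assumes e: "0 < e"
  shows "(\<lambda>n. trunc_mean M (\<lambda>\<omega>. 1 / real n * (\<Sum>t=1..n. hat e (X n t \<omega> / \<beta> n)) - smooth \<Phi> e (m n \<omega>))) \<longlonglongrightarrow> 0"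
proof (rule LIMSEQ_I)
  fix r :: real assume r: "0 < r"
  interpret S: finite_measure_subalgebra M "F 0"
    by unfold_locales (rule subalg)
  \<comment> \<open>The early indices then contribute at most \<open>r / 4\<close>. With
    \<open>r / 2\<close> from HL4 and \<open>r / 5\<close> from the later indices the total stays
    below \<open>r\<close>.\<close>
  define d where "d = min (1/2) (e * r / 8)"
  have d: "d \<in> {0<..<1}" "2 / e * d \<le> r / 4"
    using e r by (auto simp: d_def min_def field_simps)
  let ?T = "\<lambda>n t. real_cond_exp M (F 0) (\<lambda>\<omega>. hat e (X n t \<omega> / \<beta> n))"
  let ?H = "\<lambda>n \<omega>. 1 / real n * (\<Sum>t=1..n. hat e (X n t \<omega> / \<beta> n))"
  let ?C = "\<lambda>n \<omega>. 1 / real n * (\<Sum>t=1..n. ?T n t \<omega>)"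
  have [measurable]: "smooth \<Phi> e \<in> borel_measurable borel"
    by (intro borel_measurable_continuous_onI lipschitz_on_continuous_on[OF smooth_lipschitz[OF e]])
  have Xm [measurable]: "X n t \<in> borel_measurable M" if "t \<in> {1..n}" for n t
    using X_measurable that by simp
  have "bounded (range (hat e))"
    using abs_hat_le[OF e] by (auto simp: bounded_iff)
  then have "conv_prob M (\<lambda>n \<omega>. ?H n \<omega> - ?C n \<omega>) 0"
    using HL4 hat_lipschitz[OF e] unfolding HL4_def by blast
  then have "(\<lambda>n. trunc_mean M (\<lambda>\<omega>. ?H n \<omega> - ?C n \<omega>)) \<longlonglongrightarrow> 0"
    by (intro trunc_mean_tendsto_0[of 1]) (auto simp: conv_prob_def)
  then have "\<forall>\<^sub>F n in sequentially. trunc_mean M (\<lambda>\<omega>. ?H n \<omega> - ?C n \<omega>) < r / 2"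
    using r by (intro order_tendstoD) auto
  moreover have "\<forall>\<^sub>F n in sequentially. \<forall>t\<in>{1..n}. \<lfloor>real n * d\<rfloor> \<le> int t \<longrightarrow> cond_err e n t \<le> r / 5"
    using r by (intro cond_err_uniform[OF e d(1)]) auto
  ultimately have "\<forall>\<^sub>F n in sequentially. norm (trunc_mean M (\<lambda>\<omega>. ?H n \<omega> - smooth \<Phi> e (m n \<omega>)) - 0) < r"
    using eventually_ge_at_top[of 1]
  proof eventually_elim
    case (elim n)
    note [measurable] = m_measurable[OF elim(3)]
    have iT: "integrable M (?T n t)" and T: "AE \<omega> in M. \<bar>?T n t \<omega>\<bar> \<le> 1 / e" if "t \<in> {1..n}" for t
    proof -
      have i: "integrable M (\<lambda>\<omega>. hat e (X n t \<omega> / \<beta> n))"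
        using Xm[OF that] by (intro integrable_const_bound[of _ "1 / e"]) (use abs_hat_le[OF e] in auto)
      show "integrable M (?T n t)"
        by (rule S.real_cond_exp_int(1)[OF i])
      show "AE \<omega> in M. \<bar>?T n t \<omega>\<bar> \<le> 1 / e"
        by (rule S.abs_cond_exp_le[OF i abs_hat_le[OF e]])
    qed
    have ism: "integrable M (\<lambda>\<omega>. smooth \<Phi> e (m n \<omega>))"
      by (rule integrable_const_bound[of _ "1 / e"]) (use abs_smooth_le[OF e] in auto)
    have ce: "cond_err e n t \<le> 2 / e" if t: "t \<in> {1..n}" for t
    proof -
      have "cond_err e n t \<le> (\<integral>\<omega>. 2 / e \<partial>M)"
        unfolding cond_err_def
      proof (rule integral_mono_AE)
        show "AE \<omega> in M. \<bar>?T n t \<omega> - smooth \<Phi> e (m n \<omega>)\<bar> \<le> 2 / e"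
          using T[OF t]
        proof eventually_elim
          case (elim \<omega>)
          then show ?case
            using abs_smooth_le[OF e, of "m n \<omega>"] by linarith
        qed
      qed (use iT[OF t] ism in auto)
      then show ?thesis
        by (simp add: prob_space)
    qed
    have iC: "integrable M (\<lambda>\<omega>. ?C n \<omega> - smooth \<Phi> e (m n \<omega>))"
      using iT ism by (intro Bochner_Integration.integrable_diff integrable_mult_right
          Bochner_Integration.integrable_sum)
    have "trunc_mean M (\<lambda>\<omega>. ?C n \<omega> - smooth \<Phi> e (m n \<omega>)) \<le> (\<integral>\<omega>. \<bar>?C n \<omega> - smooth \<Phi> e (m n \<omega>)\<bar> \<partial>M)"
      using iC by (rule trunc_mean_le_expectation)
    also have "\<dots> \<le> (\<integral>\<omega>. 1 / real n * (\<Sum>t=1..n. \<bar>?T n t \<omega> - smooth \<Phi> e (m n \<omega>)\<bar>) \<partial>M)"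
    proof (rule integral_mono)
      show "\<bar>?C n \<omega> - smooth \<Phi> e (m n \<omega>)\<bar> \<le> 1 / real n * (\<Sum>t=1..n. \<bar>?T n t \<omega> - smooth \<Phi> e (m n \<omega>)\<bar>)" for \<omega>
      proof -
        have "?C n \<omega> - smooth \<Phi> e (m n \<omega>) = 1 / real n * (\<Sum>t=1..n. ?T n t \<omega> - smooth \<Phi> e (m n \<omega>))"
          using elim(3) by (simp add: sum_subtractf field_simps)
        also have "\<bar>\<dots>\<bar> = 1 / real n * \<bar>\<Sum>t=1..n. ?T n t \<omega> - smooth \<Phi> e (m n \<omega>)\<bar>"
          by (simp add: abs_mult)
        also have "\<dots> \<le> 1 / real n * (\<Sum>t=1..n. \<bar>?T n t \<omega> - smooth \<Phi> e (m n \<omega>)\<bar>)"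
          by (intro mult_left_mono sum_abs) auto
        finally show ?thesis .
      qed
      show "integrable M (\<lambda>\<omega>. \<bar>?C n \<omega> - smooth \<Phi> e (m n \<omega>)\<bar>)"
        using iC by (rule integrable_abs)
      show "integrable M (\<lambda>\<omega>. 1 / real n * (\<Sum>t=1..n. \<bar>?T n t \<omega> - smooth \<Phi> e (m n \<omega>)\<bar>))"
        using iT ism by (intro integrable_mult_right Bochner_Integration.integrable_sum integrable_abs
            Bochner_Integration.integrable_diff)
    qed
    also have "\<dots> = 1 / real n * (\<Sum>t=1..n. cond_err e n t)"
      unfolding cond_err_def using iT ism
      by (subst integral_mult_right_zero, subst Bochner_Integration.integral_sum) auto
    also have "\<dots> \<le> 1 / real n * (\<Sum>t=1..n. (if int t < \<lfloor>real n * d\<rfloor> then 2 / e else 0) + r / 5)"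
      using ce elim(2) r e by (intro mult_left_mono sum_mono) (auto simp: add_increasing2)
    also have "(\<Sum>t=1..n. (if int t < \<lfloor>real n * d\<rfloor> then 2 / e else 0) + r / 5)
        = (\<Sum>t\<in>{t\<in>{1..n}. int t < \<lfloor>real n * d\<rfloor>}. 2 / e) + real n * (r / 5)"
      unfolding sum.distrib sum.inter_filter[OF finite_atLeastAtMost] by simp
    also have "(\<Sum>t\<in>{t\<in>{1..n}. int t < \<lfloor>real n * d\<rfloor>}. 2 / e) \<le> (\<Sum>t\<in>{1..nat \<lfloor>real n * d\<rfloor>}. 2 / e)"
      using e by (intro sum_mono2) auto
    also have "\<dots> = real (nat \<lfloor>real n * d\<rfloor>) * (2 / e)"
      by simp
    also have "\<dots> \<le> real n * d * (2 / e)"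
      using d e by (intro mult_right_mono) auto
    also have "real n * d * (2 / e) + real n * (r / 5) = real n * (2 / e * d + r / 5)"
      by (simp add: algebra_simps)
    also have "1 / real n * \<dots> = 2 / e * d + r / 5"
      using elim(3) by simp
    finally have C: "trunc_mean M (\<lambda>\<omega>. ?C n \<omega> - smooth \<Phi> e (m n \<omega>)) \<le> 2 / e * d + r / 5"
      by (simp add: divide_right_mono mult_left_mono)
    have "trunc_mean M (\<lambda>\<omega>. ?H n \<omega> - smooth \<Phi> e (m n \<omega>))
        \<le> trunc_mean M (\<lambda>\<omega>. ?H n \<omega> - ?C n \<omega>) + trunc_mean M (\<lambda>\<omega>. ?C n \<omega> - smooth \<Phi> e (m n \<omega>))"
    proof (rule trunc_mean_mono_sum)
      show "AE \<omega> in M. \<bar>?H n \<omega> - smooth \<Phi> e (m n \<omega>)\<bar> \<le> \<bar>?H n \<omega> - ?C n \<omega>\<bar> + \<bar>?C n \<omega> - smooth \<Phi> e (m n \<omega>)\<bar>"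
        by (intro AE_I2) linarith
    qed measurable
    then show ?case
      using C d(2) elim(1) r trunc_mean_nonneg[of "\<lambda>\<omega>. ?H n \<omega> - smooth \<Phi> e (m n \<omega>)"]
      by (simp only: real_norm_def)
  qed
  then show "\<exists>no. \<forall>n\<ge>no. norm (trunc_mean M (\<lambda>\<omega>. ?H n \<omega> - smooth \<Phi> e (m n \<omega>)) - 0) < r"
    by (simp add: eventually_sequentially)
qed

end

section \<open>Convergence of kernel sums\<close>

text \<open>Cutting off both argument and height converges pointwise, with
  \<open>\<bar>K\<bar>\<close> as majorant.\<close>

lemma integrable_truncation:
  fixes K :: "real \<Rightarrow> real"
  assumes K: "integrable lborel K" and r: "0 < r"
  obtains A where "(\<integral>u. \<bar>K u - (if \<bar>u\<bar> \<le> A \<and> \<bar>K u\<bar> \<le> A then K u else 0)\<bar> \<partial>lborel) < r" "0 \<le> A"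
proof -
  have [measurable]: "K \<in> borel_measurable borel"
    using borel_measurable_integrable[OF K] by simp
  let ?k = "\<lambda>(j::nat) u. if \<bar>u\<bar> \<le> real j \<and> \<bar>K u\<bar> \<le> real j then K u else 0"
  have "(\<lambda>j. \<integral>u. \<bar>K u - ?k j u\<bar> \<partial>lborel) \<longlonglongrightarrow> (\<integral>u. 0 \<partial>(lborel :: real measure))"
  proof (rule integral_dominated_convergence[where w = "\<lambda>u. \<bar>K u\<bar>"])
    show "AE u in lborel. (\<lambda>j. \<bar>K u - ?k j u\<bar>) \<longlonglongrightarrow> 0"
    proof (rule AE_I2)
      fix u
      have "\<forall>\<^sub>F j in sequentially. \<bar>K u - ?k j u\<bar> = 0"
        using eventually_ge_at_top[of "nat \<lceil>\<bar>u\<bar>\<rceil>"] eventually_ge_at_top[of "nat \<lceil>\<bar>K u\<bar>\<rceil>"]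
        by eventually_elim (auto simp: nat_le_iff ceiling_le_iff)
      then show "(\<lambda>j. \<bar>K u - ?k j u\<bar>) \<longlonglongrightarrow> 0"
        by (rule tendsto_eventually)
    qed
  qed (use K in auto)
  then have "\<forall>\<^sub>F j in sequentially. (\<integral>u. \<bar>K u - ?k j u\<bar> \<partial>lborel) < r"
    using r by (intro order_tendstoD) auto
  then obtain j where "(\<integral>u. \<bar>K u - ?k j u\<bar> \<partial>lborel) < r"
    by (auto simp: eventually_sequentially)
  then show ?thesis by (rule that) simp
qed

context limit_array
begin

abbreviation kernel_sum :: "(real \<Rightarrow> real) \<Rightarrow> real \<Rightarrow> nat set \<Rightarrow> nat \<Rightarrow> 'a \<Rightarrow> real" where
  "kernel_sum K x T n \<omega> \<equiv> \<beta> n / (bw n * real n) * (\<Sum>t\<in>T. K ((X n t \<omega> - x) / bw n))"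

lemma kernel_sum_measurable:
  "K \<in> borel_measurable borel \<Longrightarrow> T \<subseteq> {1..n} \<Longrightarrow> kernel_sum K x T n \<in> borel_measurable M"
proof -
  assume [measurable]: "K \<in> borel_measurable borel" and T: "T \<subseteq> {1..n}"
  then have [measurable]: "X n t \<in> borel_measurable M" if "t \<in> T" for t
    using X_measurable[of n t] that by auto
  show ?thesis by measurable
qed

text \<open>At most \<open>t0\<close> bounded summands with a prefactor that vanishes by (i). For
  the original kernel, which may be unbounded, condition (ii) supplies the same conclusion.\<close>

lemma kernel_sum_early_tendsto:
  assumes K [measurable]: "K \<in> borel_measurable borel" and B: "\<And>u. \<bar>K u\<bar> \<le> B"
  shows "(\<lambda>n. trunc_mean M (kernel_sum K x {1..<t0} n)) \<longlonglongrightarrow> 0"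
proof (rule Lim_null_comparison)
  show "(\<lambda>n. \<beta> n / (real n * bw n) * (real t0 * B)) \<longlonglongrightarrow> 0"
    by (rule tendsto_mult_left_zero[OF \<beta>_over_bw_tendsto])
  have B0: "0 \<le> B"
    using B[of 0] by linarith
  show "\<forall>\<^sub>F n in sequentially. norm (trunc_mean M (kernel_sum K x {1..<t0} n)) \<le> \<beta> n / (real n * bw n) * (real t0 * B)"
    using eventually_ge_at_top[of t0]
  proof eventually_elim
    case (elim n)
    then have n: "1 \<le> n" using t0_ge_1 by simp
    have "trunc_mean M (kernel_sum K x {1..<t0} n) \<le> \<beta> n / (real n * bw n) * (real t0 * B)"
    proof (rule trunc_mean_le_const)
      show "kernel_sum K x {1..<t0} n \<in> borel_measurable M"
        using elim by (intro kernel_sum_measurable) auto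
      fix \<omega>
      have "\<bar>\<Sum>t\<in>{1..<t0}. K ((X n t \<omega> - x) / bw n)\<bar> \<le> (\<Sum>t\<in>{1..<t0}. B)"
        using B by (intro order_trans[OF sum_abs] sum_mono) auto
      also have "\<dots> \<le> real t0 * B"
        using B0 by (simp add: mult_right_mono)
      finally have "\<bar>kernel_sum K x {1..<t0} n \<omega>\<bar> \<le> \<beta> n / (bw n * real n) * (real t0 * B)"
        using \<beta>_pos[OF n] bw_pos[OF n] n unfolding abs_mult
        by (intro mult_mono) auto
      then show "\<bar>kernel_sum K x {1..<t0} n \<omega>\<bar> \<le> \<beta> n / (real n * bw n) * (real t0 * B)"
        by (simp only: mult.commute[of "bw n"])
    qed
    then show ?case
      by (simp add: trunc_mean_nonneg)
  qed
qed

text \<open>The substitution in the density bound yields \<open>bw n / \<beta> n\<close>, which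
  cancels against the prefactor; what remains is the sum controlled by HL6, so the bound is uniform
  in \<open>n\<close>.\<close>

lemma kernel_sum_late_le:
  assumes db: "dens_bound C n0" and n: "n0 \<le> n"
    and Cb: "\<beta> n / real n * (\<Sum>t=t0..n. 1 / \<beta> t) \<le> Cb" and K: "integrable lborel K"
  shows "trunc_mean M (kernel_sum K x {t0..n} n) \<le> C * Cb * (\<integral>u. \<bar>K u\<bar> \<partial>lborel)"
proof -
  have n1: "1 \<le> n" and C: "1 \<le> C"
    using db n by (auto simp: dens_bound_def)
  note pos = \<beta>_pos[OF n1] bw_pos[OF n1]
  let ?J = "\<integral>u. \<bar>K u\<bar> \<partial>lborel"
  let ?g = "\<lambda>v. K ((- x + \<beta> n * v) / bw n)"
  have g: "integrable lborel ?g"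
    by (rule lborel_integral_affine(2)[OF pos K])
  have eq: "K ((X n t \<omega> - x) / bw n) = ?g (X n t \<omega> / \<beta> n)" for t \<omega>
    using pos by simp
  have i: "integrable M (\<lambda>\<omega>. K ((X n t \<omega> - x) / bw n))"
    and le: "(\<integral>\<omega>. \<bar>K ((X n t \<omega> - x) / bw n)\<bar> \<partial>M) \<le> C * (\<beta> n / \<beta> t) * (bw n / \<beta> n * ?J)"
    if t: "t \<in> {t0..n}" for t
  proof -
    have t': "t0 \<le> t" "t \<le> n" using t by auto
    show "integrable M (\<lambda>\<omega>. K ((X n t \<omega> - x) / bw n))"
      using expectation_le(1)[OF db n t' g] by (simp only: eq)
    show "(\<integral>\<omega>. \<bar>K ((X n t \<omega> - x) / bw n)\<bar> \<partial>M) \<le> C * (\<beta> n / \<beta> t) * (bw n / \<beta> n * ?J)"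
      using expectation_le(2)[OF db n t' g] lborel_integral_affine(1)[OF pos, of "\<lambda>u. \<bar>K u\<bar>" "- x"]
      by (simp only: eq)
  qed
  have "trunc_mean M (kernel_sum K x {t0..n} n) \<le> (\<integral>\<omega>. \<bar>kernel_sum K x {t0..n} n \<omega>\<bar> \<partial>M)"
    using i by (intro trunc_mean_le_expectation integrable_mult_right Bochner_Integration.integrable_sum)
  also have "\<dots> \<le> (\<integral>\<omega>. \<beta> n / (bw n * real n) * (\<Sum>t=t0..n. \<bar>K ((X n t \<omega> - x) / bw n)\<bar>) \<partial>M)"
  proof (rule integral_mono)
    show "integrable M (\<lambda>\<omega>. \<bar>kernel_sum K x {t0..n} n \<omega>\<bar>)"
      using i by (intro integrable_abs integrable_mult_right Bochner_Integration.integrable_sum)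
    show "integrable M (\<lambda>\<omega>. \<beta> n / (bw n * real n) * (\<Sum>t=t0..n. \<bar>K ((X n t \<omega> - x) / bw n)\<bar>))"
      using i by (intro integrable_abs integrable_mult_right Bochner_Integration.integrable_sum)
    show "\<bar>kernel_sum K x {t0..n} n \<omega>\<bar> \<le> \<beta> n / (bw n * real n) * (\<Sum>t=t0..n. \<bar>K ((X n t \<omega> - x) / bw n)\<bar>)" for \<omega>
      unfolding abs_mult using pos n1 by (intro mult_mono sum_abs) auto
  qed
  also have "\<dots> = \<beta> n / (bw n * real n) * (\<Sum>t=t0..n. \<integral>\<omega>. \<bar>K ((X n t \<omega> - x) / bw n)\<bar> \<partial>M)"
    using i by (subst integral_mult_right_zero, subst Bochner_Integration.integral_sum) auto
  also have "\<dots> \<le> \<beta> n / (bw n * real n) * (\<Sum>t=t0..n. C * (\<beta> n / \<beta> t) * (bw n / \<beta> n * ?J))"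
    using pos le by (intro mult_left_mono sum_mono) auto
  also have "\<dots> = C * ?J * (\<beta> n / real n * (\<Sum>t=t0..n. 1 / \<beta> t))"
    using pos n1 by (simp add: sum_distrib_left field_simps)
  also have "\<dots> \<le> C * ?J * Cb"
    using Cb C by (intro mult_left_mono) auto
  finally show ?thesis
    by (simp add: mult_ac)
qed

text \<open>Only the late part is controlled by the integral of \<open>\<bar>K - k\<bar>\<close>,
  which the densities bound in mean. The early sums of \<open>K\<close> and of \<open>k\<close>
  vanish separately, so the swap of kernels need not be estimated there.\<close>

lemma kernel_sum_approx:
  assumes K: "integrable lborel K" and kK: "(\<integral>u. \<bar>K u - k u\<bar> \<partial>lborel) < \<rho>"
    and k_meas: "k \<in> borel_measurable borel" and kB: "\<And>u. \<bar>k u\<bar> \<le> Bk" and kA: "\<And>u. A < \<bar>u\<bar> \<Longrightarrow> k u = 0"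
    and early: "small_o_p M (\<lambda>n \<omega>. ereal (kernel_sum K x {1..<t0} n \<omega>))"
    and db: "dens_bound C n0" and Cb: "\<And>n. 1 \<le> n \<Longrightarrow> \<beta> n / real n * (\<Sum>t=t0..n. 1 / \<beta> t) \<le> Cb"
    and Cb0: "0 \<le> Cb"
    and r: "0 < r" and e1: "0 < e1"
  obtains e where "0 < e" "e < e1"
    "\<forall>\<^sub>F n in sequentially. trunc_mean M (\<lambda>\<omega>. kernel_sum K x {1..n} n \<omega> - (\<integral>u. k u \<partial>lborel) * smooth \<Phi> e (m n \<omega>))
      < C * Cb * \<rho> + r"
proof -
  note [measurable] = k_meas borel_measurable_integrable[OF K, simplified]
  interpret k: kernel_array M F X \<beta> bw D t0 k x A Bk
    by unfold_locales (use kB kA in auto)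
  \<comment> \<open>The two early sums and the hat average cost \<open>d\<close> each and the
    centred average \<open>2 * d\<close>, in total half of \<open>r\<close>.\<close>
  define d where "d = r / 10"
  have d: "0 < d" using r by (simp add: d_def)
  obtain e where e: "0 < e" "e < e1"
    and sm: "\<forall>\<^sub>F n in sequentially. (\<integral>\<omega>. (1 / real n * (\<Sum>t=1..n. k.centred n e (X n t \<omega> / \<beta> n)))\<^sup>2 \<partial>M) \<le> d\<^sup>2"
    by (rule k.second_moment_small[OF zero_less_power[OF d] e1])
  have [measurable]: "smooth \<Phi> e \<in> borel_measurable borel"
    by (intro borel_measurable_continuous_onI lipschitz_on_continuous_on[OF smooth_lipschitz[OF e(1)]])
  let ?H = "\<lambda>n \<omega>. 1 / real n * (\<Sum>t=1..n. hat e (X n t \<omega> / \<beta> n)) - smooth \<Phi> e (m n \<omega>)"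
  have ms: "kernel_sum K x {1..<t0} n \<in> borel_measurable M" if "t0 \<le> n" for n
    using that by (intro kernel_sum_measurable) auto
  have "(\<lambda>n. trunc_mean M (kernel_sum K x {1..<t0} n)) \<longlonglongrightarrow> 0"
    using early ms by (intro trunc_mean_tendsto_0[of t0])
  then have a1: "\<forall>\<^sub>F n in sequentially. trunc_mean M (kernel_sum K x {1..<t0} n) < d"
    using d by (rule order_tendstoD)
  have a2: "\<forall>\<^sub>F n in sequentially. trunc_mean M (kernel_sum k x {1..<t0} n) < d"
    using kernel_sum_early_tendsto[OF k_meas kB] d by (rule order_tendstoD)
  have "(\<lambda>n. max 1 \<bar>k.mass\<bar> * trunc_mean M (?H n)) \<longlonglongrightarrow> 0"
    by (intro tendsto_mult_right_zero hat_average_tendsto e)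
  then have a4: "\<forall>\<^sub>F n in sequentially. max 1 \<bar>k.mass\<bar> * trunc_mean M (?H n) < d"
    using d by (rule order_tendstoD)
  have "\<forall>\<^sub>F n in sequentially. trunc_mean M (\<lambda>\<omega>. kernel_sum K x {1..n} n \<omega> - k.mass * smooth \<Phi> e (m n \<omega>))
      < C * Cb * \<rho> + r"
    using sm a1 a2 a4 eventually_ge_at_top[of n0] eventually_ge_at_top[of t0]
  proof eventually_elim
    case (elim n)
    have n: "1 \<le> n" using elim t0_ge_1 by simp
    note pos = \<beta>_pos[OF n] bw_pos[OF n]
    note [measurable] = m_measurable[OF n]
    have [measurable]: "X n t \<in> borel_measurable M" if "t \<in> {1..n}" for t
      using X_measurable that by simp
    let ?A1 = "kernel_sum K x {1..<t0} n" and ?A1' = "kernel_sum k x {1..<t0} n"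
    let ?A2 = "kernel_sum (\<lambda>u. K u - k u) x {t0..n} n"
    let ?A3 = "\<lambda>\<omega>. 1 / real n * (\<Sum>t=1..n. k.centred n e (X n t \<omega> / \<beta> n))"
    let ?A4 = "\<lambda>\<omega>. k.mass * ?H n \<omega>"
    have m1 [measurable]: "?A1 \<in> borel_measurable M" "?A1' \<in> borel_measurable M"
      using elim(6) by (auto intro!: kernel_sum_measurable)
    have m2 [measurable]: "?A2 \<in> borel_measurable M"
      using t0_ge_1 by (intro kernel_sum_measurable) auto
    have m3 [measurable]: "?A3 \<in> borel_measurable M" "?A4 \<in> borel_measurable M"
      by measurable
    have m5 [measurable]: "kernel_sum K x {1..n} n \<in> borel_measurable M"
      by (intro kernel_sum_measurable) auto
    have b2: "trunc_mean M ?A2 \<le> C * Cb * \<rho>"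
    proof -
      have "integrable lborel (\<lambda>u. K u - k u)"
        using K k.k_integrable by simp
      from kernel_sum_late_le[OF db elim(5) Cb[OF n] this]
      have "trunc_mean M ?A2 \<le> C * Cb * (\<integral>u. \<bar>K u - k u\<bar> \<partial>lborel)" .
      also have "\<dots> \<le> C * Cb * \<rho>"
        using kK db Cb0 by (intro mult_left_mono mult_nonneg_nonneg) (auto simp: dens_bound_def)
      finally show ?thesis .
    qed
    have b3: "trunc_mean M ?A3 \<le> 2 * d"
    proof -
      have bd: "\<bar>?A3 \<omega>\<bar> \<le> k.centred_bound n e" for \<omega>
      proof -
        have "\<bar>\<Sum>t=1..n. k.centred n e (X n t \<omega> / \<beta> n)\<bar> \<le> (\<Sum>t=1..n. k.centred_bound n e)"
          using k.centred_bound[OF n e(1)] by (intro order_trans[OF sum_abs] sum_mono)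
        then show ?thesis
          using n by (simp add: abs_mult field_simps)
      qed
      have i2: "integrable M (\<lambda>\<omega>. (?A3 \<omega>)\<^sup>2)"
      proof (rule integrable_const_bound[of _ "(k.centred_bound n e)\<^sup>2"])
        show "AE \<omega> in M. norm ((?A3 \<omega>)\<^sup>2) \<le> (k.centred_bound n e)\<^sup>2"
          using power_mono[OF bd abs_ge_zero, of _ 2] by (intro AE_I2) (simp only: real_norm_def abs_power2 power2_abs)
      qed measurable
      have "trunc_mean M ?A3 \<le> (\<integral>\<omega>. \<bar>?A3 \<omega>\<bar> \<partial>M)"
        by (intro trunc_mean_le_expectation integrable_const_bound[of _ "k.centred_bound n e"])
           (use bd in \<open>auto simp only: real_norm_def intro!: AE_I2 m3\<close>)
      also have "\<dots> \<le> (\<integral>\<omega>. d + (?A3 \<omega>)\<^sup>2 / d \<partial>M)"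
      proof (rule integral_mono)
        show "integrable M (\<lambda>\<omega>. \<bar>?A3 \<omega>\<bar>)"
          by (intro integrable_abs integrable_const_bound[of _ "k.centred_bound n e"])
             (use bd in \<open>auto simp only: real_norm_def intro!: AE_I2 m3\<close>)
        show "integrable M (\<lambda>\<omega>. d + (?A3 \<omega>)\<^sup>2 / d)"
          using i2 by (intro Bochner_Integration.integrable_add integrable_divide) auto
      qed (rule abs_le_square_div[OF d])
      also have "\<dots> = d + (\<integral>\<omega>. (?A3 \<omega>)\<^sup>2 \<partial>M) / d"
        by (subst Bochner_Integration.integral_add)
           (use i2 in \<open>auto simp only: prob_space integral_divide_zero lebesgue_integral_const intro!: integrable_divide\<close>, auto simp: prob_space)
      also have "\<dots> \<le> d + d\<^sup>2 / d"
        using elim(1) d by (intro add_left_mono divide_right_mono) auto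
      finally show ?thesis
        using d by (simp add: power2_eq_square)
    qed
    have b4: "trunc_mean M ?A4 < d"
      by (rule le_less_trans[OF trunc_mean_cmult_le elim(4)]) measurable
    \<comment> \<open>The full sum of \<open>k\<close> is added and subtracted: together with
      \<open>?A1'\<close> and \<open>?A2\<close> it restores the late sum of \<open>K\<close>, and
      centring turns it into \<open>?A3\<close> plus \<open>k.mass\<close> times the hat
      average.\<close>
    have eq: "kernel_sum K x {1..n} n \<omega> - k.mass * smooth \<Phi> e (m n \<omega>)
        = ?A1 \<omega> - ?A1' \<omega> + ?A2 \<omega> + ?A3 \<omega> + ?A4 \<omega>" for \<omega>
    proof -
      have split: "(\<Sum>t=1..n. f t) = (\<Sum>t\<in>{1..<t0}. f t) + (\<Sum>t\<in>{t0..n}. f t)" for f :: "nat \<Rightarrow> real"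
        using t0_ge_1 elim(6) by (subst sum.union_disjoint[symmetric]) (auto intro!: sum.cong)
      have c: "k.centred n e (X n t \<omega> / \<beta> n) = \<beta> n / bw n * k ((X n t \<omega> - x) / bw n) - k.mass * hat e (X n t \<omega> / \<beta> n)" for t
        using pos by (simp add: k.centred_def)
      have "?A3 \<omega> = kernel_sum k x {1..n} n \<omega> - k.mass * (1 / real n * (\<Sum>t=1..n. hat e (X n t \<omega> / \<beta> n)))"
        unfolding c sum_subtractf sum_distrib_left[symmetric] by (simp add: right_diff_distrib mult_ac)
      moreover have "?A2 \<omega> = kernel_sum K x {t0..n} n \<omega> - kernel_sum k x {t0..n} n \<omega>"
        by (simp add: sum_subtractf right_diff_distrib)
      ultimately show ?thesis
        unfolding split[of "\<lambda>t. K ((X n t \<omega> - x) / bw n)"] split[of "\<lambda>t. k ((X n t \<omega> - x) / bw n)"]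
        by (simp add: algebra_simps)
    qed
    let ?S = "\<lambda>\<omega>. kernel_sum K x {1..n} n \<omega> - k.mass * smooth \<Phi> e (m n \<omega>)"
    have "trunc_mean M ?S \<le> trunc_mean M ?A1 + trunc_mean M (\<lambda>\<omega>. - ?A1' \<omega> + ?A2 \<omega> + ?A3 \<omega> + ?A4 \<omega>)"
      by (rule trunc_mean_mono_sum) (measurable, intro AE_I2, unfold eq, linarith)
    also have "trunc_mean M (\<lambda>\<omega>. - ?A1' \<omega> + ?A2 \<omega> + ?A3 \<omega> + ?A4 \<omega>)
        \<le> trunc_mean M ?A1' + trunc_mean M (\<lambda>\<omega>. ?A2 \<omega> + ?A3 \<omega> + ?A4 \<omega>)"
      by (rule trunc_mean_mono_sum) (measurable, intro AE_I2, linarith)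
    also have "trunc_mean M (\<lambda>\<omega>. ?A2 \<omega> + ?A3 \<omega> + ?A4 \<omega>) \<le> trunc_mean M ?A2 + trunc_mean M (\<lambda>\<omega>. ?A3 \<omega> + ?A4 \<omega>)"
      by (rule trunc_mean_mono_sum) (measurable, intro AE_I2, linarith)
    also have "trunc_mean M (\<lambda>\<omega>. ?A3 \<omega> + ?A4 \<omega>) \<le> trunc_mean M ?A3 + trunc_mean M ?A4"
      by (rule trunc_mean_mono_sum) (measurable, intro AE_I2, linarith)
    finally show ?case
      using b2 b3 b4 elim(2,3) r unfolding d_def by linarith
  qed
  then show ?thesis
    unfolding k.mass_def using e by (intro that[of e])
qed

text \<open>Four gaps of at most \<open>r / 8\<close> are bridged: kernel sum to smoothed functional
  of \<open>m n\<close>, \<open>m n\<close> to \<open>LXm\<close>, smoothed density to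
  \<open>\<Phi>\<close>, and mass of the truncated kernel to that of \<open>K\<close>. The
  truncation is fixed before \<open>e\<close>, and \<open>e\<close> before \<open>n\<close>.\<close>

lemma kernel_sum_lipschitz_limit:
  assumes K: "integrable lborel K"
    and early: "small_o_p M (\<lambda>n \<omega>. ereal (kernel_sum K x {1..<t0} n \<omega>))"
    and f: "L-lipschitz_on UNIV f" and fB: "\<And>y. \<bar>f y\<bar> \<le> (B::real)"
  shows "(\<lambda>n. \<integral>\<omega>. f (kernel_sum K x {1..n} n \<omega>) \<partial>M) \<longlonglongrightarrow> (\<integral>\<omega>. f (\<Phi> (- LXm \<omega>) * (\<integral>u. K u \<partial>lborel)) \<partial>N)"
proof (rule LIMSEQ_I)
  fix r :: real assume r: "0 < r"
  note [measurable] = borel_measurable_integrable[OF K, simplified]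
  obtain C n0 where db: "dens_bound C n0" by (rule dens_bound_exists)
  obtain Cb where Cb0: "0 \<le> Cb" and Cb: "\<And>n. 1 \<le> n \<Longrightarrow> \<beta> n / real n * (\<Sum>t=t0..n. 1 / \<beta> t) \<le> Cb"
    using \<beta>_sum_bound_exists by blast
  obtain B\<Phi> where B\<Phi>: "\<And>y. \<bar>\<Phi> y\<bar> \<le> B\<Phi>"
    using bdd by (auto simp: bounded_iff)
  have B\<Phi>0: "0 \<le> B\<Phi>" using B\<Phi>[of 0] by linarith
  have C: "1 \<le> C" using db by (simp add: dens_bound_def)
  have L: "0 \<le> L" and B: "0 \<le> B"
    using f lipschitz_on_nonneg fB[of 0] by auto
  have fc: "continuous_on UNIV f"
    by (rule lipschitz_on_continuous_on[OF f])
  then have [measurable]: "f \<in> borel_measurable borel"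
    by (rule borel_measurable_continuous_onI)
  define c where "c = L + 2 * B + 1"
  have c: "0 < c" using L B by (simp add: c_def)
  \<comment> \<open>\<open>Q\<close> collects the coefficients with which the truncation error
    \<rho> enters the first and the last gap; the added 1 keeps it positive.\<close>
  define Q where "Q = c * (C * Cb + 1) + L * B\<Phi> + 1"
  have Q: "0 < Q"
    unfolding Q_def using c C Cb0 L B\<Phi>0 by (intro add_nonneg_pos add_nonneg_nonneg mult_nonneg_nonneg) auto
  define \<rho> where "\<rho> = r / (8 * Q)"
  have \<rho>: "0 < \<rho>"
    using r Q by (simp add: \<rho>_def)
  have "\<rho> * Q = r / 8"
    using Q by (simp add: \<rho>_def)
  then have "c * (C * Cb * \<rho> + \<rho>) + L * B\<Phi> * \<rho> + \<rho> = r / 8"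
    by (simp add: Q_def algebra_simps)
  moreover have "0 \<le> c * (C * Cb * \<rho> + \<rho>)" "0 \<le> L * B\<Phi> * \<rho>"
    using c C Cb0 L B\<Phi>0 \<rho> by auto
  ultimately have \<rho>1: "c * (C * Cb * \<rho> + \<rho>) \<le> r / 8" "L * B\<Phi> * \<rho> \<le> r / 8"
    using \<rho> by linarith+
  obtain A where A: "(\<integral>u. \<bar>K u - (if \<bar>u\<bar> \<le> A \<and> \<bar>K u\<bar> \<le> A then K u else 0)\<bar> \<partial>lborel) < \<rho>" "0 \<le> A"
    by (rule integrable_truncation[OF K \<rho>])
  define k where "k u = (if \<bar>u\<bar> \<le> A \<and> \<bar>K u\<bar> \<le> A then K u else 0)" for u
  have k [measurable]: "k \<in> borel_measurable borel"
    unfolding k_def by measurable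
  have kA: "\<bar>k u\<bar> \<le> A" "A < \<bar>u\<bar> \<Longrightarrow> k u = 0" for u
    using A(2) by (auto simp: k_def)
  have ki: "integrable lborel k"
    by (rule Bochner_Integration.integrable_bound[OF K]) (auto simp: k_def)
  have kK: "(\<integral>u. \<bar>K u - k u\<bar> \<partial>lborel) < \<rho>"
    using A(1) by (simp add: k_def)
  define \<kappa> where "\<kappa> = (\<integral>u. k u \<partial>lborel)"
  have \<kappa>: "\<bar>\<kappa> - (\<integral>u. K u \<partial>lborel)\<bar> \<le> \<rho>"
  proof -
    have "\<bar>\<kappa> - (\<integral>u. K u \<partial>lborel)\<bar> = \<bar>\<integral>u. K u - k u \<partial>lborel\<bar>"
      using K ki by (simp add: \<kappa>_def abs_minus_commute)
    also have "\<dots> \<le> (\<integral>u. \<bar>K u - k u\<bar> \<partial>lborel)"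
      by (rule integral_abs_bound)
    finally show ?thesis
      using kK by simp
  qed
  have sc: "continuous_on UNIV (smooth \<Phi> e)" if "0 < e" for e
    by (rule lipschitz_on_continuous_on[OF smooth_lipschitz[OF that]])
  have sm: "smooth \<Phi> e \<in> borel_measurable borel" if "0 < e" for e
    by (rule borel_measurable_continuous_onI[OF sc[OF that]])
  have "((\<lambda>e. \<integral>\<omega>. f (\<kappa> * smooth \<Phi> e (LXm \<omega>)) \<partial>N) \<longlongrightarrow> (\<integral>\<omega>. f (\<kappa> * \<Phi> (- LXm \<omega>)) \<partial>N)) (at_right 0)"
  proof (rule tendsto_at_right_sequentially[of 0 1])
    fix S :: "nat \<Rightarrow> real" assume S: "\<And>n. 0 < S n" "S \<longlonglongrightarrow> 0"
    note [measurable] = sm[OF S(1)]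
    show "(\<lambda>n. \<integral>\<omega>. f (\<kappa> * smooth \<Phi> (S n) (LXm \<omega>)) \<partial>N) \<longlonglongrightarrow> (\<integral>\<omega>. f (\<kappa> * \<Phi> (- LXm \<omega>)) \<partial>N)"
    proof (rule integral_dominated_convergence[where w = "\<lambda>_. B"])
      show "AE \<omega> in N. (\<lambda>n. f (\<kappa> * smooth \<Phi> (S n) (LXm \<omega>))) \<longlonglongrightarrow> f (\<kappa> * \<Phi> (- LXm \<omega>))"
      proof (rule AE_I2)
        fix \<omega>
        have "isCont f (\<kappa> * \<Phi> (- LXm \<omega>))"
          using fc by (simp add: continuous_on_eq_continuous_at)
        then show "(\<lambda>n. f (\<kappa> * smooth \<Phi> (S n) (LXm \<omega>))) \<longlonglongrightarrow> f (\<kappa> * \<Phi> (- LXm \<omega>))"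
          by (rule isCont_tendsto_compose) (intro tendsto_mult tendsto_const smooth_tendsto S)
      qed
    qed (use fB in auto)
  qed simp
  then have "\<forall>\<^sub>F e in at_right 0. dist (\<integral>\<omega>. f (\<kappa> * smooth \<Phi> e (LXm \<omega>)) \<partial>N) (\<integral>\<omega>. f (\<kappa> * \<Phi> (- LXm \<omega>)) \<partial>N) < r / 8"
    using r by (intro tendstoD) auto
  \<comment> \<open>The bound must hold for every \<open>e\<close> below \<open>e1\<close>, because
    the approximation of the kernel sum selects \<open>e\<close> itself.\<close>
  then obtain e1 where e1: "0 < e1" and lim1: "\<And>e. 0 < e \<Longrightarrow> e < e1 \<Longrightarrow>
      \<bar>(\<integral>\<omega>. f (\<kappa> * smooth \<Phi> e (LXm \<omega>)) \<partial>N) - (\<integral>\<omega>. f (\<kappa> * \<Phi> (- LXm \<omega>)) \<partial>N)\<bar> < r / 8"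
    unfolding eventually_at_right_field dist_real_def by blast
  obtain e where e: "0 < e" "e < e1" and ap: "\<forall>\<^sub>F n in sequentially.
      trunc_mean M (\<lambda>\<omega>. kernel_sum K x {1..n} n \<omega> - (\<integral>u. k u \<partial>lborel) * smooth \<Phi> e (m n \<omega>)) < C * Cb * \<rho> + \<rho>"
    by (rule kernel_sum_approx[OF K kK k kA early db Cb Cb0 \<rho> e1])
  note [measurable] = sm[OF e(1)]
  have "continuous_on UNIV (\<lambda>y. f (\<kappa> * smooth \<Phi> e y))"
    by (rule continuous_on_compose2[OF fc]) (auto intro!: continuous_intros sc e)
  moreover have "bounded (range (\<lambda>y. f (\<kappa> * smooth \<Phi> e y)))"
    using fB by (auto simp: bounded_iff)
  ultimately have "(\<lambda>n. \<integral>\<omega>. f (\<kappa> * smooth \<Phi> e (m n \<omega>)) \<partial>M) \<longlonglongrightarrow> (\<integral>\<omega>. f (\<kappa> * smooth \<Phi> e (LXm \<omega>)) \<partial>N)"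
    using m_conv_distr unfolding conv_distr_def by (auto dest!: spec[of _ "\<lambda>y. f (\<kappa> * smooth \<Phi> e y)"])
  then have ev: "\<forall>\<^sub>F n in sequentially. dist (\<integral>\<omega>. f (\<kappa> * smooth \<Phi> e (m n \<omega>)) \<partial>M) (\<integral>\<omega>. f (\<kappa> * smooth \<Phi> e (LXm \<omega>)) \<partial>N) < r / 8"
    using r by (intro tendstoD) auto
  have last: "\<bar>(\<integral>\<omega>. f (\<kappa> * \<Phi> (- LXm \<omega>)) \<partial>N) - (\<integral>\<omega>. f (\<Phi> (- LXm \<omega>) * (\<integral>u. K u \<partial>lborel)) \<partial>N)\<bar> \<le> r / 8"
  proof -
    have i: "integrable N (\<lambda>\<omega>. f (y * \<Phi> (- LXm \<omega>)))" for y
      by (rule N.integrable_const_bound[of _ B]) (use fB in auto)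
    have "\<bar>(\<integral>\<omega>. f (\<kappa> * \<Phi> (- LXm \<omega>)) \<partial>N) - (\<integral>\<omega>. f ((\<integral>u. K u \<partial>lborel) * \<Phi> (- LXm \<omega>)) \<partial>N)\<bar>
        = \<bar>\<integral>\<omega>. f (\<kappa> * \<Phi> (- LXm \<omega>)) - f ((\<integral>u. K u \<partial>lborel) * \<Phi> (- LXm \<omega>)) \<partial>N\<bar>"
      by (subst Bochner_Integration.integral_diff[OF i i]) simp
    also have "\<dots> \<le> (\<integral>\<omega>. \<bar>f (\<kappa> * \<Phi> (- LXm \<omega>)) - f ((\<integral>u. K u \<partial>lborel) * \<Phi> (- LXm \<omega>))\<bar> \<partial>N)"
      by (rule integral_abs_bound)
    also have "\<dots> \<le> (\<integral>\<omega>. L * B\<Phi> * \<rho> \<partial>N)"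
    proof (rule integral_mono)
      fix \<omega>
      have "\<bar>f (\<kappa> * \<Phi> (- LXm \<omega>)) - f ((\<integral>u. K u \<partial>lborel) * \<Phi> (- LXm \<omega>))\<bar>
          \<le> L * \<bar>\<kappa> * \<Phi> (- LXm \<omega>) - (\<integral>u. K u \<partial>lborel) * \<Phi> (- LXm \<omega>)\<bar>"
        using lipschitz_onD[OF f UNIV_I UNIV_I] unfolding dist_real_def .
      also have "\<dots> = L * (\<bar>\<Phi> (- LXm \<omega>)\<bar> * \<bar>\<kappa> - (\<integral>u. K u \<partial>lborel)\<bar>)"
        unfolding left_diff_distrib[symmetric] abs_mult by simp
      also have "\<dots> \<le> L * (B\<Phi> * \<rho>)"
        using B\<Phi> \<kappa> L B\<Phi>0 by (intro mult_left_mono mult_mono) auto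
      finally show "\<bar>f (\<kappa> * \<Phi> (- LXm \<omega>)) - f ((\<integral>u. K u \<partial>lborel) * \<Phi> (- LXm \<omega>))\<bar> \<le> L * B\<Phi> * \<rho>"
        by simp
    qed (use i in auto)
    finally show ?thesis
      using \<rho>1(2) by (simp add: N.prob_space mult.commute)
  qed
  have "\<forall>\<^sub>F n in sequentially. norm ((\<integral>\<omega>. f (kernel_sum K x {1..n} n \<omega>) \<partial>M)
      - (\<integral>\<omega>. f (\<Phi> (- LXm \<omega>) * (\<integral>u. K u \<partial>lborel)) \<partial>N)) < r"
    using ev ap eventually_ge_at_top[of 1]
  proof eventually_elim
    case (elim n)
    note [measurable] = m_measurable[OF elim(3)]
    have [measurable]: "kernel_sum K x {1..n} n \<in> borel_measurable M"
      by (intro kernel_sum_measurable) auto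
    let ?d = "trunc_mean M (\<lambda>\<omega>. kernel_sum K x {1..n} n \<omega> - \<kappa> * smooth \<Phi> e (m n \<omega>))"
    have "\<bar>(\<integral>\<omega>. f (kernel_sum K x {1..n} n \<omega>) \<partial>M) - (\<integral>\<omega>. f (\<kappa> * smooth \<Phi> e (m n \<omega>)) \<partial>M)\<bar> \<le> (L + 2 * B) * ?d"
      by (rule expectation_lipschitz_diff(1)[OF _ _ f fB]) measurable
    also have "\<dots> \<le> c * (C * Cb * \<rho> + \<rho>)"
      using elim(2) L B trunc_mean_nonneg by (intro mult_mono) (auto simp: c_def \<kappa>_def)
    also have "\<dots> \<le> r / 8" by (rule \<rho>1)
    finally show ?case
      using elim(1) lim1[OF e] last r unfolding dist_real_def real_norm_def by linarith
  qed
  then show "\<exists>no. \<forall>n\<ge>no. norm ((\<integral>\<omega>. f (kernel_sum K x {1..n} n \<omega>) \<partial>M)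
      - (\<integral>\<omega>. f (\<Phi> (- LXm \<omega>) * (\<integral>u. K u \<partial>lborel)) \<partial>N)) < r"
    by (simp add: eventually_sequentially)
qed

end

section \<open>From bounded Lipschitz test functions to convergence in distribution\<close>

lemma scaled_cos_sin_lipschitz:
  fixes a :: real
  shows "\<bar>a\<bar>-lipschitz_on UNIV (\<lambda>y. cos (a * y))" "\<bar>a\<bar>-lipschitz_on UNIV (\<lambda>y. sin (a * y))"
proof -
  have c: "norm (cos (a * x) - cos (a * y)) \<le> \<bar>a\<bar> * norm (x - y)" for x y :: real
  proof (rule field_differentiable_bound[of UNIV "\<lambda>y. cos (a * y)" "\<lambda>y. - sin (a * y) * a"])
    show "norm (- sin (a * z) * a) \<le> \<bar>a\<bar>" for z
      using mult_right_mono[OF abs_sin_le_one[of "a * z"], of "\<bar>a\<bar>"] by (simp add: abs_mult)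
  qed (auto intro!: derivative_eq_intros)
  have s: "norm (sin (a * x) - sin (a * y)) \<le> \<bar>a\<bar> * norm (x - y)" for x y :: real
  proof (rule field_differentiable_bound[of UNIV "\<lambda>y. sin (a * y)" "\<lambda>y. cos (a * y) * a"])
    show "norm (cos (a * z) * a) \<le> \<bar>a\<bar>" for z
      using mult_right_mono[OF abs_cos_le_one[of "a * z"], of "\<bar>a\<bar>"] by (simp add: abs_mult)
  qed (auto intro!: derivative_eq_intros)
  show "\<bar>a\<bar>-lipschitz_on UNIV (\<lambda>y. cos (a * y))" "\<bar>a\<bar>-lipschitz_on UNIV (\<lambda>y. sin (a * y))"
    using c s by (auto intro!: lipschitz_onI simp: dist_norm)
qed

text \<open>Characteristic functions only involve the bounded Lipschitz functions sine and cosine.\<close>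

lemma conv_distr_lipschitzI:
  fixes Y :: "nat \<Rightarrow> 'a \<Rightarrow> real" and Z :: "'b \<Rightarrow> real"
  assumes M: "prob_space M" and N: "prob_space N"
    and Y: "\<And>n. Y n \<in> borel_measurable M" and Z: "Z \<in> borel_measurable N"
    and conv: "\<And>f L B. L-lipschitz_on UNIV f \<Longrightarrow> (\<And>y. \<bar>f y\<bar> \<le> (B::real)) \<Longrightarrow>
      (\<lambda>n. \<integral>\<omega>. f (Y n \<omega>) \<partial>M) \<longlonglongrightarrow> (\<integral>\<omega>. f (Z \<omega>) \<partial>N)"
  shows "conv_distr M Y N Z"
proof -
  have char: "char (distr P borel W) a = Complex (\<integral>\<omega>. cos (a * W \<omega>) \<partial>P) (\<integral>\<omega>. sin (a * W \<omega>) \<partial>P)"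
    if "prob_space P" and [measurable]: "W \<in> borel_measurable P" for P :: "'x measure" and W :: "'x \<Rightarrow> real" and a
  proof -
    interpret P: prob_space P by fact
    have "char (distr P borel W) a = (\<integral>\<omega>. iexp (a * W \<omega>) \<partial>P)"
      unfolding char_def by (subst integral_distr) auto
    moreover have "integrable P (\<lambda>\<omega>. iexp (a * W \<omega>))"
      by (rule P.integrable_const_bound[of _ 1]) auto
    ultimately show ?thesis
      by (simp add: complex_eq_iff integral_Re[symmetric] integral_Im[symmetric] Re_exp Im_exp)
  qed
  have "weak_conv_m (\<lambda>n. distr M borel (Y n)) (distr N borel Z)"
  proof (rule levy_continuity)
    show "real_distribution (distr M borel (Y n))" for n
      using M Y by (intro prob_space.real_distribution_distr)
    show "real_distribution (distr N borel Z)"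
      using N Z by (intro prob_space.real_distribution_distr)
    show "(\<lambda>n. char (distr M borel (Y n)) a) \<longlonglongrightarrow> char (distr N borel Z) a" for a
      unfolding char[OF M Y] char[OF N Z]
      by (intro tendsto_Complex conv[OF scaled_cos_sin_lipschitz(1), of _ 1] conv[OF scaled_cos_sin_lipschitz(2), of _ 1]) auto
  qed
  then show ?thesis
    using conv_distr_iff_weak_conv_m[OF M N Y Z] by simp
qed

text \<open>An integrable function is finite almost everywhere, and a Lebesgue measurable one agrees
  almost everywhere with a Borel function. Both exceptional sets are covered by one Borel null set
  \<open>Z\<close>, since conditional densities are tested on Borel sets.\<close>

lemma ereal_integrable_representative:
  assumes K: "ereal_integrable lebesgue K"
  obtains K0 :: "real \<Rightarrow> real" and Z where "integrable lborel K0" "Z \<in> null_sets lborel"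
    "\<And>u. u \<notin> Z \<Longrightarrow> K u = ereal (K0 u)" "ereal_integral lebesgue K = (\<integral>u. K0 u \<partial>lborel)"
proof -
  have [measurable]: "K \<in> borel_measurable lebesgue" and fin: "(\<integral>\<^sup>+u. e2ennreal \<bar>K u\<bar> \<partial>lebesgue) < \<infinity>"
    using K by (auto simp: ereal_integrable_def)
  have "AE u in lebesgue. e2ennreal \<bar>K u\<bar> \<noteq> \<infinity>"
    using fin by (intro nn_integral_PInf_AE) auto
  then have 1: "AE u in lebesgue. K u = ereal (real_of_ereal (K u))"
    by eventually_elim (auto simp: ereal_real)
  obtain K0 where K0 [measurable]: "K0 \<in> borel_measurable lborel" and "AE u in lborel. real_of_ereal (K u) = K0 u"
    using completion_ex_borel_measurable_real[of "\<lambda>u. real_of_ereal (K u)" lborel] by auto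
  then have 2: "AE u in lebesgue. real_of_ereal (K u) = K0 u"
    by (rule_tac AE_completion)
  have K0': "K0 \<in> borel_measurable lebesgue"
    using K0 by (rule measurable_completion)
  have ae: "AE u in lebesgue. K u = ereal (K0 u)"
    using 1 2 by eventually_elim simp
  then have "AE u in lborel. K u = ereal (K0 u)"
    by (simp add: AE_completion_iff)
  then obtain Z where Z: "{u \<in> space lborel. \<not> K u = ereal (K0 u)} \<subseteq> Z" "Z \<in> null_sets lborel"
    by (metis AE_E null_setsI)
  have "(\<integral>\<^sup>+u. ennreal (norm (K0 u)) \<partial>lborel) = (\<integral>\<^sup>+u. ennreal (norm (K0 u)) \<partial>lebesgue)"
    by (rule nn_integral_completion[symmetric])
  also have "\<dots> = (\<integral>\<^sup>+u. e2ennreal \<bar>K u\<bar> \<partial>lebesgue)"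
    using ae by (intro nn_integral_cong_AE) (auto elim!: eventually_mono simp: e2ennreal_ereal)
  finally have i: "integrable lborel K0"
    using fin by (intro integrableI_bounded) auto
  then have i': "integrable lebesgue K0"
    by (simp add: integrable_completion)
  have "ereal_integral lebesgue K = ereal_integral lebesgue (\<lambda>u. ereal (K0 u))"
  proof -
    have "(\<integral>\<^sup>+u. e2ennreal (K u) \<partial>lebesgue) = (\<integral>\<^sup>+u. e2ennreal (ereal (K0 u)) \<partial>lebesgue)"
      "(\<integral>\<^sup>+u. e2ennreal (- K u) \<partial>lebesgue) = (\<integral>\<^sup>+u. e2ennreal (- ereal (K0 u)) \<partial>lebesgue)"
      using ae by (auto intro!: nn_integral_cong_AE elim!: eventually_mono)
    then show ?thesis
      by (simp only: ereal_integral_def)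
  qed
  also have "\<dots> = (\<integral>u. K0 u \<partial>lebesgue)"
    by (rule ereal_integral_ereal(2)[OF i'])
  also have "\<dots> = (\<integral>u. K0 u \<partial>lborel)"
    using K0 by (rule integral_completion)
  finally show ?thesis
    using i Z by (intro that[of K0 Z]) auto
qed

theorem theorem3p3:
  fixes M :: "'a measure" and F :: "int \<Rightarrow> 'a measure" and \<beta> bw :: "nat \<Rightarrow> real"
    and X Xp Xm R :: "nat \<Rightarrow> nat \<Rightarrow> 'a \<Rightarrow> real"
    and N :: "'b measure" and LXp LXm :: "'b \<Rightarrow> real" and \<Phi> :: "real \<Rightarrow> real"
    and D :: "nat \<Rightarrow> nat \<Rightarrow> nat \<Rightarrow> 'a \<Rightarrow> real \<Rightarrow> real" and t0 :: nat
    and K :: "real \<Rightarrow> ereal"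
  assumes "prob_space M" and "prob_space N"
    and "ereal_integrable lebesgue K" and "ereal_integrable lebesgue (\<lambda>u. (K u)\<^sup>2)"
    and K_rv: "\<And>n t x. 1 \<le> t \<Longrightarrow> t \<le> n \<Longrightarrow>
      (\<lambda>\<omega>. K ((X n t \<omega> - x) / bw n)) \<in> borel_measurable M"
    and "HL0 M F X \<beta>"
    and "HL1 M F X \<beta> Xp Xm R"
    and "HL2 M F \<beta> Xp Xm N LXp LXm \<Phi>"
    and "HL4 M F X \<beta>"
    and "HL6 \<beta> t0"
    and "HL7 M F X \<beta> D t0"
    and "HL8 M D"
    and "HL9 \<beta> t0"
    and i: "\<And>n. n \<ge> 1 \<Longrightarrow> bw n > 0"
      "(\<lambda>n. bw n / \<beta> n + \<beta> n / (real n * bw n)) \<longlonglongrightarrow> 0"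
    and ii: "\<And>x. small_o_p M (\<lambda>n \<omega>.
      ereal (\<beta> n / (real n * bw n)) * (\<Sum>t=1..<t0. K ((X n t \<omega> - x) / bw n)))"
  shows "\<forall>x. conv_distr M
      (\<lambda>n \<omega>. ereal (\<beta> n / (bw n * real n)) * (\<Sum>t=1..n. K ((X n t \<omega> - x) / bw n)))
      N (\<lambda>\<omega>. ereal (\<Phi> (- LXm \<omega>) * ereal_integral lebesgue K))"
proof
  fix x :: real
  interpret M: prob_space M by fact
  interpret N: prob_space N by fact
  interpret limit_array M F X \<beta> bw D t0 N Xp Xm R LXp LXm \<Phi>
    by unfold_locales (fact | rule i(1), assumption)+
  obtain K0 Z where K0: "integrable lborel K0" and Z: "Z \<in> null_sets lborel"
    and KZ: "\<And>u. u \<notin> Z \<Longrightarrow> K u = ereal (K0 u)"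
    and IK: "ereal_integral lebesgue K = (\<integral>u. K0 u \<partial>lborel)"
    using ereal_integrable_representative[OF assms(3)] by blast
  have K0m: "K0 \<in> borel_measurable borel"
    using borel_measurable_integrable[OF K0] by simp
  \<comment> \<open>Each of the finitely many kernel arguments avoids \<open>Z\<close> almost
    surely, because \<open>X n t\<close> has a density. So \<open>K\<close> may be replaced by the
    real valued \<open>K0\<close>.\<close>
  have sum_eq: "AE \<omega> in M. ereal (\<beta> n / (bw n * real n)) * (\<Sum>t\<in>T. K ((X n t \<omega> - x) / bw n))
      = ereal (kernel_sum K0 x T n \<omega>)" if T: "T \<subseteq> {1..n}" for T n
  proof -
    have "finite T" using T finite_subset by blast
    moreover have "AE \<omega> in M. (X n t \<omega> - x) / bw n \<notin> Z" if "t \<in> T" for t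
      using that T by (intro AE_X_notin[OF Z]) auto
    ultimately have "AE \<omega> in M. \<forall>t\<in>T. (X n t \<omega> - x) / bw n \<notin> Z"
      by (intro AE_finite_allI)
    then show ?thesis
    proof eventually_elim
      case (elim \<omega>)
      then have "(\<Sum>t\<in>T. K ((X n t \<omega> - x) / bw n)) = (\<Sum>t\<in>T. ereal (K0 ((X n t \<omega> - x) / bw n)))"
        using KZ by (intro sum.cong) auto
      then show ?case by simp
    qed
  qed
  have Sm [measurable]: "(\<lambda>\<omega>. ereal (\<beta> n / (bw n * real n)) * (\<Sum>t\<in>T. K ((X n t \<omega> - x) / bw n))) \<in> borel_measurable M"
    if "T \<subseteq> {1..n}" for T n
    using that by (intro borel_measurable_ereal_times borel_measurable_const borel_measurable_ereal_sum K_rv) auto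
  have km: "kernel_sum K0 x T n \<in> borel_measurable M" if "T \<subseteq> {1..n}" for T n
    using K0m that by (rule kernel_sum_measurable)
  \<comment> \<open>Condition (ii) passes to \<open>K0\<close> once \<open>t0 \<le> n\<close>; in
    shorter rows the sum would involve times beyond the row.\<close>
  have early: "small_o_p M (\<lambda>n \<omega>. ereal (kernel_sum K0 x {1..<t0} n \<omega>))"
    unfolding small_o_p_def
  proof (intro allI impI)
    fix \<epsilon> :: real assume "0 < \<epsilon>"
    then have lim: "(\<lambda>n. measure M {\<omega> \<in> space M. \<bar>ereal (\<beta> n / (real n * bw n)) * (\<Sum>t=1..<t0. K ((X n t \<omega> - x) / bw n))\<bar> > ereal \<epsilon>}) \<longlonglongrightarrow> 0"
      using ii[of x] unfolding small_o_p_def by blast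
    show "(\<lambda>n. measure M {\<omega> \<in> space M. \<bar>ereal (kernel_sum K0 x {1..<t0} n \<omega>)\<bar> > ereal \<epsilon>}) \<longlonglongrightarrow> 0"
    proof (rule Lim_transform_eventually[OF lim])
      show "\<forall>\<^sub>F n in sequentially.
          measure M {\<omega> \<in> space M. \<bar>ereal (\<beta> n / (real n * bw n)) * (\<Sum>t=1..<t0. K ((X n t \<omega> - x) / bw n))\<bar> > ereal \<epsilon>}
        = measure M {\<omega> \<in> space M. \<bar>ereal (kernel_sum K0 x {1..<t0} n \<omega>)\<bar> > ereal \<epsilon>}"
        using eventually_ge_at_top[of t0]
      proof eventually_elim
        case (elim n)
        then have T: "{1..<t0} \<subseteq> {1..n}" by auto
        note [measurable] = Sm[OF T] km[OF T]
        show ?case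
          unfolding mult.commute[of "real n" "bw n"]
        proof (rule M.finite_measure_eq_AE)
          show "AE \<omega> in M. \<omega> \<in> {\<omega> \<in> space M. \<bar>ereal (\<beta> n / (bw n * real n)) * (\<Sum>t=1..<t0. K ((X n t \<omega> - x) / bw n))\<bar> > ereal \<epsilon>}
            \<longleftrightarrow> \<omega> \<in> {\<omega> \<in> space M. \<bar>ereal (kernel_sum K0 x {1..<t0} n \<omega>)\<bar> > ereal \<epsilon>}"
            using sum_eq[OF T] by eventually_elim simp
        qed measurable
      qed
    qed
  qed
  have rl: "conv_distr M (\<lambda>n. kernel_sum K0 x {1..n} n) N (\<lambda>\<omega>. \<Phi> (- LXm \<omega>) * (\<integral>u. K0 u \<partial>lborel))"
    by (rule conv_distr_lipschitzI[OF assms(1,2) km _ kernel_sum_lipschitz_limit[OF K0 early]]) measurable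
  show "conv_distr M
      (\<lambda>n \<omega>. ereal (\<beta> n / (bw n * real n)) * (\<Sum>t=1..n. K ((X n t \<omega> - x) / bw n)))
      N (\<lambda>\<omega>. ereal (\<Phi> (- LXm \<omega>) * ereal_integral lebesgue K))"
    unfolding conv_distr_def
  proof (intro allI impI)
    fix f :: "ereal \<Rightarrow> real" assume f: "continuous_on UNIV f \<and> bounded (range f)"
    then have fm [measurable]: "f \<in> borel_measurable borel"
      by (intro borel_measurable_continuous_onI) auto
    \<comment> \<open>Restricted to the reals, a test function on the extended line is still bounded
      and continuous, so convergence on the real line suffices.\<close>
    have "continuous_on UNIV (\<lambda>y. f (ereal y)) \<and> bounded (range (\<lambda>y. f (ereal y)))"
      using f by (auto intro!: continuous_on_compose2[of UNIV f] continuous_on_ereal bounded_subset[of "range f"])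
    then have lim: "(\<lambda>n. \<integral>\<omega>. f (ereal (kernel_sum K0 x {1..n} n \<omega>)) \<partial>M)
        \<longlonglongrightarrow> (\<integral>\<omega>. f (ereal (\<Phi> (- LXm \<omega>) * (\<integral>u. K0 u \<partial>lborel))) \<partial>N)"
      using rl unfolding conv_distr_def by (auto dest!: spec[of _ "\<lambda>y. f (ereal y)"])
    have "(\<integral>\<omega>. f (ereal (\<beta> n / (bw n * real n)) * (\<Sum>t=1..n. K ((X n t \<omega> - x) / bw n))) \<partial>M)
        = (\<integral>\<omega>. f (ereal (kernel_sum K0 x {1..n} n \<omega>)) \<partial>M)" for n
    proof (rule integral_cong_AE)
      show "(\<lambda>\<omega>. f (ereal (\<beta> n / (bw n * real n)) * (\<Sum>t=1..n. K ((X n t \<omega> - x) / bw n)))) \<in> borel_measurable M"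
        by (rule measurable_compose[OF Sm fm]) simp
      show "(\<lambda>\<omega>. f (ereal (kernel_sum K0 x {1..n} n \<omega>))) \<in> borel_measurable M"
        using km[of "{1..n}" n] by measurable
      show "AE \<omega> in M. f (ereal (\<beta> n / (bw n * real n)) * (\<Sum>t=1..n. K ((X n t \<omega> - x) / bw n)))
          = f (ereal (kernel_sum K0 x {1..n} n \<omega>))"
        using sum_eq[of "{1..n}" n] by (auto elim!: eventually_mono)
    qed
    with lim show "(\<lambda>n. \<integral>\<omega>. f (ereal (\<beta> n / (bw n * real n)) * (\<Sum>t=1..n. K ((X n t \<omega> - x) / bw n))) \<partial>M)
        \<longlonglongrightarrow> (\<integral>\<omega>. f (ereal (\<Phi> (- LXm \<omega>) * ereal_integral lebesgue K)) \<partial>N)"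
      by (simp only: IK)
  qed
qed

end
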